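(* Let $k$ be an arbitrary field. (a) For every $k$-bialgebra $B$, the component $B\to H^*(B)$ of the unit of the adjunction $(H^*,j)$ is an epimorphism in the category $\mathrm{BiAlg}$ of bialgebras, and the component $H_*(B)\to B$ of the counit of the adjunction $(j,H_* )$ is a monomorphism in $\mathrm{BiAlg}$. (b) For every Hopf algebra $H$ over $k$, the unit $H\to K^*(H)$ of the adjunction $(K^*,i)$ is an epimorphism in the category $\mathrm{HopfAlg}$ of Hopf algebras, and the counit $K_*(H)\to H$ of the adjunction $(i,K_* )$ is a monomorphism in $\mathrm{HopfAlg}$.
   Context: All bialgebras and Hopf algebras are over the fixed field $k$. $\mathrm{BiAlg}$ is the category of $k$-bialgebras; $\mathrm{HopfAlg}$ is its full subcategory of Hopf algebras; $\mathrm{SHopfAlg}$ is the full subcategory of $\mathrm{HopfAlg}$ consisting of Hopf algebras with bijective antipode. The inclusion $j:\mathrm{HopfAlg}\to\mathrm{BiAlg}$ has a left adjoint $H^*$ and a right adjoint $H_*$; the inclusion $i:\mathrm{SHopfAlg}\to\mathrm{HopfAlg}$ has a left adjoint $K^*$ and a right adjoint $K_*$. The notation $(F,U)$ for an adjunction means that $F$ is left adjoint to $U$. The inclusion functors are suppressed in the notation, so that e.g. $H^*(B)$ is written for $jH^*(B)$. Epimorphism and monomorphism are meant in the categorical sense. *)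

theory Defs
  imports "HOL-Algebra.Module" "HOL-Algebra.Generated_Groups" "HOL-Algebra.Free_Abelian_Groups"
begin

section \<open>Tensor products of vector spaces\<close>

text \<open>
  \<open>V \<otimes> W\<close> is the free Abelian group on \<open>V \<times> W\<close> modulo the subgroup generated by the
  usual relations. Since the last family of relations makes it \<open>k\<close>-balanced, the action of \<open>k\<close>
  on the first factor turns the quotient into the tensor product over \<open>k\<close>.
\<close>

definition tensor_rels ::
  "('k, 'm) ring_scheme \<Rightarrow> ('k, 'v, 'x) module_scheme \<Rightarrow> ('k, 'w, 'y) module_scheme
    \<Rightarrow> ('v \<times> 'w \<Rightarrow>\<^sub>0 int) set" where
  "tensor_rels K V W =
     {frag_of (v \<oplus>\<^bsub>V\<^esub> v', w) - frag_of (v, w) - frag_of (v', w) | v v' w.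
        v \<in> carrier V \<and> v' \<in> carrier V \<and> w \<in> carrier W}
   \<union> {frag_of (v, w \<oplus>\<^bsub>W\<^esub> w') - frag_of (v, w) - frag_of (v, w') | v w w'.
        v \<in> carrier V \<and> w \<in> carrier W \<and> w' \<in> carrier W}
   \<union> {frag_of (a \<odot>\<^bsub>V\<^esub> v, w) - frag_of (v, a \<odot>\<^bsub>W\<^esub> w) | a v w.
        a \<in> carrier K \<and> v \<in> carrier V \<and> w \<in> carrier W}"

definition tensor_kernel ::
  "('k, 'm) ring_scheme \<Rightarrow> ('k, 'v, 'x) module_scheme \<Rightarrow> ('k, 'w, 'y) module_scheme
    \<Rightarrow> ('v \<times> 'w \<Rightarrow>\<^sub>0 int) set" where
  "tensor_kernel K V W =
     generate (free_Abelian_group (carrier V \<times> carrier W)) (tensor_rels K V W)"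

definition tensor_group ::
  "('k, 'm) ring_scheme \<Rightarrow> ('k, 'v, 'x) module_scheme \<Rightarrow> ('k, 'w, 'y) module_scheme
    \<Rightarrow> ('v \<times> 'w \<Rightarrow>\<^sub>0 int) set monoid" where
  "tensor_group K V W =
     free_Abelian_group (carrier V \<times> carrier W) Mod tensor_kernel K V W"

definition pure_tensor ::
  "('k, 'm) ring_scheme \<Rightarrow> ('k, 'v, 'x) module_scheme \<Rightarrow> ('k, 'w, 'y) module_scheme
    \<Rightarrow> 'v \<Rightarrow> 'w \<Rightarrow> ('v \<times> 'w \<Rightarrow>\<^sub>0 int) set" where
  "pure_tensor K V W v w =
     tensor_kernel K V W #>\<^bsub>free_Abelian_group (carrier V \<times> carrier W)\<^esub> frag_of (v, w)"

text \<open>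
  \<open>tensor_lift G \<phi>\<close> is the additive map \<open>v \<otimes> w \<mapsto> \<phi> v w\<close> into the commutative group \<open>G\<close>. It is only
  meaningful for balanced biadditive \<open>\<phi>\<close>, where the image below is a singleton.
\<close>

definition frag_eval ::
  "('g, 'm) monoid_scheme \<Rightarrow> ('v \<Rightarrow> 'w \<Rightarrow> 'g) \<Rightarrow> ('v \<times> 'w \<Rightarrow>\<^sub>0 int) \<Rightarrow> 'g" where
  "frag_eval G \<phi> x =
     finprod G (\<lambda>p. \<phi> (fst p) (snd p) [^]\<^bsub>G\<^esub> Poly_Mapping.lookup x p) (Poly_Mapping.keys x)"

definition tensor_lift ::
  "('g, 'm) monoid_scheme \<Rightarrow> ('v \<Rightarrow> 'w \<Rightarrow> 'g) \<Rightarrow> ('v \<times> 'w \<Rightarrow>\<^sub>0 int) set \<Rightarrow> 'g" where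
  "tensor_lift G \<phi> X = the_elem (frag_eval G \<phi> ` X)"

text \<open>
  The multiplication and unit are those of the tensor product of two algebras,
  \<open>(a \<otimes> b) (c \<otimes> d) = a c \<otimes> b d\<close>; they are irrelevant when \<open>V\<close> and \<open>W\<close> are just vector spaces.
\<close>

definition tensor ::
  "('k, 'm) ring_scheme \<Rightarrow> ('k, 'v, 'x) module_scheme \<Rightarrow> ('k, 'w, 'y) module_scheme
    \<Rightarrow> ('k, ('v \<times> 'w \<Rightarrow>\<^sub>0 int) set) module" where
  "tensor K V W =
     \<lparr>carrier = carrier (tensor_group K V W),
      monoid.mult = (\<lambda>X Y. tensor_lift (tensor_group K V W)
        (\<lambda>a b. tensor_lift (tensor_group K V W)
          (\<lambda>c d. pure_tensor K V W (a \<otimes>\<^bsub>V\<^esub> c) (b \<otimes>\<^bsub>W\<^esub> d)) Y) X),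
      one = pure_tensor K V W \<one>\<^bsub>V\<^esub> \<one>\<^bsub>W\<^esub>,
      ring.zero = \<one>\<^bsub>tensor_group K V W\<^esub>,
      ring.add = monoid.mult (tensor_group K V W),
      smult = (\<lambda>a. tensor_lift (tensor_group K V W)
        (\<lambda>v w. pure_tensor K V W (a \<odot>\<^bsub>V\<^esub> v) w))\<rparr>"

text \<open>
  \<open>tensor_map K V W f g\<close> is \<open>f \<otimes> g\<close>, and \<open>tensor_assoc K U V W\<close> the canonical isomorphism
  \<open>(U \<otimes> V) \<otimes> W \<rightarrow> U \<otimes> (V \<otimes> W)\<close>. Here \<open>V\<close> and \<open>W\<close> are the targets of \<open>f\<close> and \<open>g\<close>; as the
  maps are not restricted to their domain, the sources need not be given.
\<close>

definition tensor_map ::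
  "('k, 'm) ring_scheme \<Rightarrow> ('k, 'v, 'x) module_scheme \<Rightarrow> ('k, 'w, 'y) module_scheme
    \<Rightarrow> ('a \<Rightarrow> 'v) \<Rightarrow> ('b \<Rightarrow> 'w) \<Rightarrow> ('a \<times> 'b \<Rightarrow>\<^sub>0 int) set \<Rightarrow> ('v \<times> 'w \<Rightarrow>\<^sub>0 int) set" where
  "tensor_map K V W f g =
     tensor_lift (tensor_group K V W) (\<lambda>a b. pure_tensor K V W (f a) (g b))"

definition tensor_assoc ::
  "('k, 'm) ring_scheme \<Rightarrow> ('k, 'u, 'x) module_scheme \<Rightarrow> ('k, 'v, 'y) module_scheme
    \<Rightarrow> ('k, 'w, 'z) module_scheme
    \<Rightarrow> (('u \<times> 'v \<Rightarrow>\<^sub>0 int) set \<times> 'w \<Rightarrow>\<^sub>0 int) set \<Rightarrow> ('u \<times> ('v \<times> 'w \<Rightarrow>\<^sub>0 int) set \<Rightarrow>\<^sub>0 int) set" where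
  "tensor_assoc K U V W =
     tensor_lift (tensor_group K U (tensor K V W))
       (\<lambda>X w. tensor_lift (tensor_group K U (tensor K V W))
         (\<lambda>u v. pure_tensor K U (tensor K V W) u (pure_tensor K V W v w)) X)"

definition linear_maps ::
  "('k, 'm) ring_scheme \<Rightarrow> ('k, 'v, 'x) module_scheme \<Rightarrow> ('k, 'w, 'y) module_scheme
    \<Rightarrow> ('v \<Rightarrow> 'w) set" where
  "linear_maps K V W =
     {f \<in> hom (add_monoid V) (add_monoid W).
        \<forall>a \<in> carrier K. \<forall>v \<in> carrier V. f (a \<odot>\<^bsub>V\<^esub> v) = a \<odot>\<^bsub>W\<^esub> f v}"

definition regular_module :: "('k, 'm) ring_scheme \<Rightarrow> ('k, 'k) module" where
  "regular_module K =
     \<lparr>carrier = carrier K, monoid.mult = monoid.mult K, one = one K, ring.zero = ring.zero K,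
      ring.add = ring.add K, smult = monoid.mult K\<rparr>"


section \<open>Bialgebras and Hopf algebras\<close>

text \<open>The library's \<^locale>\<open>algebra\<close> is restricted to commutative algebras.\<close>

locale assoc_algebra = module K A + ring A for K (structure) and A (structure) +
  assumes smult_mult_left:
      "\<lbrakk>a \<in> carrier K; x \<in> carrier A; y \<in> carrier A\<rbrakk>
        \<Longrightarrow> (a \<odot>\<^bsub>A\<^esub> x) \<otimes>\<^bsub>A\<^esub> y = a \<odot>\<^bsub>A\<^esub> (x \<otimes>\<^bsub>A\<^esub> y)"
    and smult_mult_right:
      "\<lbrakk>a \<in> carrier K; x \<in> carrier A; y \<in> carrier A\<rbrakk>
        \<Longrightarrow> x \<otimes>\<^bsub>A\<^esub> (a \<odot>\<^bsub>A\<^esub> y) = a \<odot>\<^bsub>A\<^esub> (x \<otimes>\<^bsub>A\<^esub> y)"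

record ('k, 'a) bialg = "('k, 'a) module" +
  comult :: "'a \<Rightarrow> ('a \<times> 'a \<Rightarrow>\<^sub>0 int) set"
  counit :: "'a \<Rightarrow> 'k"

text \<open>
  The two counit laws are \<open>(\<epsilon> \<otimes> id) \<circ> \<Delta> = id = (id \<otimes> \<epsilon>) \<circ> \<Delta>\<close>, composed with the canonical
  isomorphisms \<open>k \<otimes> C \<cong> C \<cong> C \<otimes> k\<close>.
\<close>

locale coalgebra = module K C for K (structure) and C (structure) +
  assumes comult_linear: "comult C \<in> linear_maps K C (tensor K C C)"
    and counit_linear: "counit C \<in> linear_maps K C (regular_module K)"
    and coassoc: "x \<in> carrier C \<Longrightarrow>
      tensor_assoc K C C C (tensor_map K (tensor K C C) C (comult C) (\<lambda>c. c) (comult C x))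
      = tensor_map K C (tensor K C C) (\<lambda>c. c) (comult C) (comult C x)"
    and counit_left: "x \<in> carrier C \<Longrightarrow>
      tensor_lift (add_monoid C) (\<lambda>c d. counit C c \<odot>\<^bsub>C\<^esub> d) (comult C x) = x"
    and counit_right: "x \<in> carrier C \<Longrightarrow>
      tensor_lift (add_monoid C) (\<lambda>c d. counit C d \<odot>\<^bsub>C\<^esub> c) (comult C x) = x"

locale bialgebra = field K + assoc_algebra K B + coalgebra K B
  for K (structure) and B (structure) +
  assumes comult_ring_hom: "comult B \<in> ring_hom B (tensor K B B)"
    and counit_ring_hom: "counit B \<in> ring_hom B K"

text \<open>
  \<open>convolution A C f g = \<mu>\<^sub>A \<circ> (f \<otimes> g) \<circ> \<Delta>\<^sub>C\<close>, and an antipode is a two-sided convolution inverse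
  of the identity.
\<close>

definition convolution ::
  "('k, 'c, 'x) bialg_scheme \<Rightarrow> ('k, 'a, 'y) module_scheme \<Rightarrow> ('c \<Rightarrow> 'a) \<Rightarrow> ('c \<Rightarrow> 'a) \<Rightarrow> 'c \<Rightarrow> 'a"
  where
  "convolution C A f g x =
     tensor_lift (add_monoid A) (\<lambda>c d. f c \<otimes>\<^bsub>A\<^esub> g d) (comult C x)"

definition antipode ::
  "('k, 'm) ring_scheme \<Rightarrow> ('k, 'a, 'x) bialg_scheme \<Rightarrow> ('a \<Rightarrow> 'a) \<Rightarrow> bool" where
  "antipode K H S \<longleftrightarrow>
     S \<in> linear_maps K H H \<and>
     (\<forall>x \<in> carrier H.
        convolution H H S (\<lambda>y. y) x = counit H x \<odot>\<^bsub>H\<^esub> \<one>\<^bsub>H\<^esub> \<and>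
        convolution H H (\<lambda>y. y) S x = counit H x \<odot>\<^bsub>H\<^esub> \<one>\<^bsub>H\<^esub>)"

definition hopf_algebra :: "('k, 'm) ring_scheme \<Rightarrow> ('k, 'a, 'x) bialg_scheme \<Rightarrow> bool" where
  "hopf_algebra K H \<longleftrightarrow> bialgebra K H \<and> (\<exists>S. antipode K H S)"

text \<open>The antipode is unique on the carrier, so the choice of \<open>S\<close> below is immaterial.\<close>

definition bijective_antipode :: "('k, 'm) ring_scheme \<Rightarrow> ('k, 'a, 'x) bialg_scheme \<Rightarrow> bool" where
  "bijective_antipode K H \<longleftrightarrow> (\<exists>S. antipode K H S \<and> bij_betw S (carrier H) (carrier H))"

text \<open>Extensionality makes equality of functions the equality of morphisms.\<close>

definition bialg_hom ::
  "('k, 'm) ring_scheme \<Rightarrow> ('k, 'a, 'x) bialg_scheme \<Rightarrow> ('k, 'b, 'y) bialg_scheme \<Rightarrow> ('a \<Rightarrow> 'b) set"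
  where
  "bialg_hom K A B =
     {f \<in> extensional (carrier A).
        f \<in> linear_maps K A B \<and> f \<in> ring_hom A B \<and>
        (\<forall>x \<in> carrier A.
           comult B (f x) = tensor_map K B B f f (comult A x) \<and>
           counit B (f x) = counit A x)}"


section \<open>Categories and adjunctions\<close>

text \<open>
  Hom-sets need not be disjoint, so composition \<open>cat_comp C X Y Z g f\<close> of \<open>f : X \<rightarrow> Y\<close> and
  \<open>g : Y \<rightarrow> Z\<close> takes the three objects as arguments.
\<close>

record ('o, 'f) cat =
  cat_obj :: "'o set"
  cat_hom :: "'o \<Rightarrow> 'o \<Rightarrow> 'f set"
  cat_id :: "'o \<Rightarrow> 'f"
  cat_comp :: "'o \<Rightarrow> 'o \<Rightarrow> 'o \<Rightarrow> 'f \<Rightarrow> 'f \<Rightarrow> 'f"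

locale category =
  fixes C :: "('o, 'f) cat"
  assumes id_in_hom: "X \<in> cat_obj C \<Longrightarrow> cat_id C X \<in> cat_hom C X X"
    and comp_in_hom: "\<lbrakk>X \<in> cat_obj C; Y \<in> cat_obj C; Z \<in> cat_obj C;
      f \<in> cat_hom C X Y; g \<in> cat_hom C Y Z\<rbrakk> \<Longrightarrow> cat_comp C X Y Z g f \<in> cat_hom C X Z"
    and comp_id_right: "\<lbrakk>X \<in> cat_obj C; Y \<in> cat_obj C; f \<in> cat_hom C X Y\<rbrakk>
      \<Longrightarrow> cat_comp C X X Y f (cat_id C X) = f"
    and comp_id_left: "\<lbrakk>X \<in> cat_obj C; Y \<in> cat_obj C; f \<in> cat_hom C X Y\<rbrakk>
      \<Longrightarrow> cat_comp C X Y Y (cat_id C Y) f = f"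
    and comp_assoc: "\<lbrakk>W \<in> cat_obj C; X \<in> cat_obj C; Y \<in> cat_obj C; Z \<in> cat_obj C;
      f \<in> cat_hom C W X; g \<in> cat_hom C X Y; h \<in> cat_hom C Y Z\<rbrakk>
      \<Longrightarrow> cat_comp C W X Z (cat_comp C X Y Z h g) f
          = cat_comp C W Y Z h (cat_comp C W X Y g f)"

definition full_subcategory :: "('o, 'f) cat \<Rightarrow> 'o set \<Rightarrow> ('o, 'f) cat" where
  "full_subcategory C P = C\<lparr>cat_obj := cat_obj C \<inter> P\<rparr>"

definition epimorphism :: "('o, 'f) cat \<Rightarrow> 'o \<Rightarrow> 'o \<Rightarrow> 'f \<Rightarrow> bool" where
  "epimorphism C X Y f \<longleftrightarrow>
     X \<in> cat_obj C \<and> Y \<in> cat_obj C \<and> f \<in> cat_hom C X Y \<and>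
     (\<forall>Z \<in> cat_obj C. \<forall>g \<in> cat_hom C Y Z. \<forall>h \<in> cat_hom C Y Z.
        cat_comp C X Y Z g f = cat_comp C X Y Z h f \<longrightarrow> g = h)"

definition monomorphism :: "('o, 'f) cat \<Rightarrow> 'o \<Rightarrow> 'o \<Rightarrow> 'f \<Rightarrow> bool" where
  "monomorphism C X Y f \<longleftrightarrow>
     X \<in> cat_obj C \<and> Y \<in> cat_obj C \<and> f \<in> cat_hom C X Y \<and>
     (\<forall>W \<in> cat_obj C. \<forall>g \<in> cat_hom C W X. \<forall>h \<in> cat_hom C W X.
        cat_comp C W X Y f g = cat_comp C W X Y f h \<longrightarrow> g = h)"

record ('o, 'f, 'p, 'g) cat_functor =
  fun_obj :: "'o \<Rightarrow> 'p"
  fun_map :: "'o \<Rightarrow> 'o \<Rightarrow> 'f \<Rightarrow> 'g"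

locale is_functor = C: category C + D: category D
  for C :: "('o, 'f) cat" and D :: "('p, 'g) cat" and F :: "('o, 'f, 'p, 'g) cat_functor" +
  assumes fun_obj_closed: "X \<in> cat_obj C \<Longrightarrow> fun_obj F X \<in> cat_obj D"
    and fun_map_closed: "\<lbrakk>X \<in> cat_obj C; Y \<in> cat_obj C; f \<in> cat_hom C X Y\<rbrakk>
      \<Longrightarrow> fun_map F X Y f \<in> cat_hom D (fun_obj F X) (fun_obj F Y)"
    and fun_map_id: "X \<in> cat_obj C \<Longrightarrow> fun_map F X X (cat_id C X) = cat_id D (fun_obj F X)"
    and fun_map_comp: "\<lbrakk>X \<in> cat_obj C; Y \<in> cat_obj C; Z \<in> cat_obj C;
      f \<in> cat_hom C X Y; g \<in> cat_hom C Y Z\<rbrakk>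
      \<Longrightarrow> fun_map F X Z (cat_comp C X Y Z g f)
          = cat_comp D (fun_obj F X) (fun_obj F Y) (fun_obj F Z) (fun_map F Y Z g) (fun_map F X Y f)"

definition inclusion_functor :: "('o, 'f, 'o, 'f) cat_functor" where
  "inclusion_functor = \<lparr>fun_obj = (\<lambda>X. X), fun_map = (\<lambda>_ _ f. f)\<rparr>"

definition identity_functor :: "('o, 'f, 'o, 'f) cat_functor" where
  "identity_functor = \<lparr>fun_obj = (\<lambda>X. X), fun_map = (\<lambda>_ _ f. f)\<rparr>"

definition functor_comp ::
  "('p, 'g, 'q, 'h) cat_functor \<Rightarrow> ('o, 'f, 'p, 'g) cat_functor \<Rightarrow> ('o, 'f, 'q, 'h) cat_functor"
  where
  "functor_comp G F =
     \<lparr>fun_obj = (\<lambda>X. fun_obj G (fun_obj F X)),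
      fun_map = (\<lambda>X Y f. fun_map G (fun_obj F X) (fun_obj F Y) (fun_map F X Y f))\<rparr>"

locale natural_transformation = F: is_functor C D F + G: is_functor C D G
  for C :: "('o, 'f) cat" and D :: "('p, 'g) cat"
    and F :: "('o, 'f, 'p, 'g) cat_functor" and G :: "('o, 'f, 'p, 'g) cat_functor"
    and \<tau> :: "'o \<Rightarrow> 'g" +
  assumes component: "X \<in> cat_obj C \<Longrightarrow> \<tau> X \<in> cat_hom D (fun_obj F X) (fun_obj G X)"
    and naturality: "\<lbrakk>X \<in> cat_obj C; Y \<in> cat_obj C; f \<in> cat_hom C X Y\<rbrakk>
      \<Longrightarrow> cat_comp D (fun_obj F X) (fun_obj F Y) (fun_obj G Y) (\<tau> Y) (fun_map F X Y f)
          = cat_comp D (fun_obj F X) (fun_obj G X) (fun_obj G Y) (fun_map G X Y f) (\<tau> X)"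

text \<open>The adjunction \<open>(F, U)\<close>, with \<open>F : C \<rightarrow> D\<close> left adjoint to \<open>U : D \<rightarrow> C\<close>.\<close>

locale adjunction =
  F: is_functor C D F + U: is_functor D C U +
  unit: natural_transformation C C identity_functor "functor_comp U F" unit +
  counit: natural_transformation D D "functor_comp F U" identity_functor counit
  for C :: "('o, 'f) cat" and D :: "('p, 'g) cat"
    and F :: "('o, 'f, 'p, 'g) cat_functor" and U :: "('p, 'g, 'o, 'f) cat_functor"
    and unit :: "'o \<Rightarrow> 'f" and counit :: "'p \<Rightarrow> 'g" +
  assumes triangle_left: "X \<in> cat_obj C \<Longrightarrow>
      cat_comp D (fun_obj F X) (fun_obj F (fun_obj U (fun_obj F X))) (fun_obj F X)
        (counit (fun_obj F X)) (fun_map F X (fun_obj U (fun_obj F X)) (unit X))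
      = cat_id D (fun_obj F X)"
    and triangle_right: "Y \<in> cat_obj D \<Longrightarrow>
      cat_comp C (fun_obj U Y) (fun_obj U (fun_obj F (fun_obj U Y))) (fun_obj U Y)
        (fun_map U (fun_obj F (fun_obj U Y)) Y (counit Y)) (unit (fun_obj U Y))
      = cat_id C (fun_obj U Y)"

text \<open>
  The objects are the structures carried by subsets of the type \<open>'a\<close>, which plays the role of the
  universe; \<open>'a\<close> is arbitrary, hence arbitrarily large.
\<close>

definition BiAlg :: "('k, 'm) ring_scheme \<Rightarrow> (('k, 'a) bialg, 'a \<Rightarrow> 'a) cat" where
  "BiAlg K =
     \<lparr>cat_obj = {B. bialgebra K B},
      cat_hom = bialg_hom K,
      cat_id = (\<lambda>B. \<lambda>x \<in> carrier B. x),
      cat_comp = (\<lambda>A B C g f. compose (carrier A) g f)\<rparr>"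

definition HopfAlg :: "('k, 'm) ring_scheme \<Rightarrow> (('k, 'a) bialg, 'a \<Rightarrow> 'a) cat" where
  "HopfAlg K = full_subcategory (BiAlg K) {H. hopf_algebra K H}"

definition SHopfAlg :: "('k, 'm) ring_scheme \<Rightarrow> (('k, 'a) bialg, 'a \<Rightarrow> 'a) cat" where
  "SHopfAlg K = full_subcategory (HopfAlg K) {H. bijective_antipode K H}"


section \<open>Sanity checks\<close>

text \<open>
  The universal property of the tensor product: \<open>lift_pure\<close> and \<open>lift_hom\<close> give existence and
  \<open>T_eqI\<close> uniqueness. With it, \<open>BiAlg\<close>, \<open>HopfAlg\<close> and \<open>SHopfAlg\<close> are shown to be categories.
\<close>

definition balanced ::
  "('k, 'm) ring_scheme \<Rightarrow> ('k, 'v, 'x) module_scheme \<Rightarrow> ('k, 'w, 'y) module_scheme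
    \<Rightarrow> ('g, 'n) monoid_scheme \<Rightarrow> ('v \<Rightarrow> 'w \<Rightarrow> 'g) \<Rightarrow> bool" where
 "balanced K V W G \<phi> \<longleftrightarrow>
   (\<forall>v\<in>carrier V. \<forall>w\<in>carrier W. \<phi> v w \<in> carrier G) \<and>
   (\<forall>v\<in>carrier V. \<forall>v'\<in>carrier V. \<forall>w\<in>carrier W. \<phi> (v \<oplus>\<^bsub>V\<^esub> v') w = \<phi> v w \<otimes>\<^bsub>G\<^esub> \<phi> v' w) \<and>
   (\<forall>v\<in>carrier V. \<forall>w\<in>carrier W. \<forall>w'\<in>carrier W. \<phi> v (w \<oplus>\<^bsub>W\<^esub> w') = \<phi> v w \<otimes>\<^bsub>G\<^esub> \<phi> v w') \<and>
   (\<forall>a\<in>carrier K. \<forall>v\<in>carrier V. \<forall>w\<in>carrier W. \<phi> (a \<odot>\<^bsub>V\<^esub> v) w = \<phi> v (a \<odot>\<^bsub>W\<^esub> w))"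

locale tensor_pair = V: module K V + W: module K W for K (structure) and V and W
begin
abbreviation "S \<equiv> carrier V \<times> carrier W"
abbreviation "F \<equiv> free_Abelian_group S"
abbreviation "N \<equiv> tensor_kernel K V W"
abbreviation "T \<equiv> tensor_group K V W"

lemma rels_sub: "tensor_rels K V W \<subseteq> carrier F"
proof -
  have d: "Poly_Mapping.keys (frag_of a - frag_of b) \<subseteq> S" if "a\<in>S" "b\<in>S" for a b :: "'c \<times> 'e"
    using that keys_diff[of "frag_of a" "frag_of b"] by (auto simp: keys_frag_of)
  have d3: "Poly_Mapping.keys (frag_of a - frag_of b - frag_of c) \<subseteq> S" if "a\<in>S" "b\<in>S" "c\<in>S" for a b c :: "'c \<times> 'e"
    using that keys_diff[of "frag_of a - frag_of b" "frag_of c"] d[of a b] by (auto simp: keys_frag_of)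
  show ?thesis
    unfolding tensor_rels_def
    apply (intro Un_least subsetI; elim CollectE exE conjE; hypsubst; unfold carrier_free_Abelian_group_iff)
      apply (rule d3; simp)
     apply (rule d3; simp)
    apply (rule d; simp)
    done
qed

lemma N_subgroup: "subgroup N F"
  unfolding tensor_kernel_def by (rule group.generate_is_subgroup[OF group_free_Abelian_group rels_sub])

lemma N_normal: "N \<lhd> F"
  by (rule comm_group.normal_iff_subgroup[OF abelian_free_Abelian_group, THEN iffD2, OF N_subgroup])

lemma T_comm: "comm_group T"
  unfolding tensor_group_def
  by (rule comm_group.abelian_FactGroup[OF abelian_free_Abelian_group N_subgroup])

lemma eval_superset:
  assumes "comm_group G" "\<forall>p\<in>S. \<phi> (fst p) (snd p) \<in> carrier G" "finite I" "I \<subseteq> S" "Poly_Mapping.keys x \<subseteq> I"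
  shows "frag_eval G \<phi> x = finprod G (\<lambda>p. \<phi> (fst p) (snd p) [^]\<^bsub>G\<^esub> Poly_Mapping.lookup x p) I"
proof -
  interpret comm_group G by fact
  show ?thesis unfolding frag_eval_def
    apply (rule finprod_mono_neutral_cong_left)
    using assms by (auto simp: in_keys_iff Pi_iff subset_iff)
qed

lemma eval_hom:
  assumes "comm_group G" "\<forall>p\<in>S. \<phi> (fst p) (snd p) \<in> carrier G"
  shows "frag_eval G \<phi> \<in> hom F G"
proof (rule homI)
  interpret comm_group G by fact
  fix x assume x: "x \<in> carrier F"
  show "frag_eval G \<phi> x \<in> carrier G" unfolding frag_eval_def
    using assms x by (intro finprod_closed) (auto simp: Pi_iff subset_iff)
  fix y assume y: "y \<in> carrier F"
  let ?I = "Poly_Mapping.keys x \<union> Poly_Mapping.keys y"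
  have I: "finite ?I" "?I \<subseteq> S" using x y by auto
  have "frag_eval G \<phi> (x + y) = finprod G (\<lambda>p. \<phi> (fst p) (snd p) [^]\<^bsub>G\<^esub> Poly_Mapping.lookup (x+y) p) ?I"
    by (rule eval_superset[OF assms I]) (rule keys_add)
  also have "\<dots> = finprod G (\<lambda>p. \<phi> (fst p) (snd p) [^]\<^bsub>G\<^esub> Poly_Mapping.lookup x p \<otimes>\<^bsub>G\<^esub> \<phi> (fst p) (snd p) [^]\<^bsub>G\<^esub> Poly_Mapping.lookup y p) ?I"
    apply (rule finprod_cong) using assms(2) I(2) by (auto simp: lookup_add int_pow_mult Pi_iff simp_implies_def subset_iff)
  also have "\<dots> = frag_eval G \<phi> x \<otimes>\<^bsub>G\<^esub> frag_eval G \<phi> y"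
    using assms(2) I(2)
    by (subst eval_superset[OF assms I], simp, subst eval_superset[OF assms I], simp, intro finprod_multf) (auto simp: Pi_iff subset_iff)
  finally show "frag_eval G \<phi> (x \<otimes>\<^bsub>F\<^esub> y) = frag_eval G \<phi> x \<otimes>\<^bsub>G\<^esub> frag_eval G \<phi> y" by simp
qed

lemma eval_of:
  assumes "comm_group G" "\<phi> v w \<in> carrier G"
  shows "frag_eval G \<phi> (frag_of (v,w)) = \<phi> v w"
proof -
  interpret comm_group G by fact
  have k: "Poly_Mapping.keys (frag_of (v,w)) = {(v,w)}" by (rule keys_frag_of)
  show ?thesis using assms(2)
    unfolding frag_eval_def k by (subst finprod_insert) auto
qed

lemma eval_kernel:
  assumes G: "comm_group G" and b: "balanced K V W G \<phi>" and n: "n \<in> N"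
  shows "frag_eval G \<phi> n = \<one>\<^bsub>G\<^esub>"
proof -
  interpret comm_group G by fact
  have c: "\<forall>p\<in>S. \<phi> (fst p) (snd p) \<in> carrier G" using b by (auto simp: balanced_def)
  have h: "frag_eval G \<phi> \<in> hom F G" by (rule eval_hom[OF G c])
  interpret h: group_hom F G "frag_eval G \<phi>"
    by (simp add: group_hom_def group_hom_axioms_def h is_group)
  have ho: "frag_eval G \<phi> (frag_of (v,w)) = \<phi> v w" if "v\<in>carrier V" "w\<in>carrier W" for v w
    by (rule eval_of[OF G]) (use c that in auto)
  have hd: "frag_eval G \<phi> (a - b) = frag_eval G \<phi> a \<otimes>\<^bsub>G\<^esub> inv\<^bsub>G\<^esub> frag_eval G \<phi> b" if "a\<in>carrier F" "b\<in>carrier F" for a b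
  proof -
    have "a - b = a \<otimes>\<^bsub>F\<^esub> inv\<^bsub>F\<^esub> b" using that by simp
    then show ?thesis using that using h.hom_mult[of a "inv\<^bsub>F\<^esub> b"] h.hom_inv[of b] group.inv_closed[OF group_free_Abelian_group, of b S] by metis
  qed
  have k2: "frag_of a - frag_of b \<in> carrier F" if "a\<in>S" "b\<in>S" for a b
    using that keys_diff[of "frag_of a" "frag_of b"] by (auto simp: keys_frag_of)
  have cl: "\<phi> v w \<in> carrier G" if "v\<in>carrier V" "w\<in>carrier W" for v w using b that by (auto simp: balanced_def)
  have "tensor_rels K V W \<subseteq> kernel F G (frag_eval G \<phi>)"
  proof
    fix r assume r: "r \<in> tensor_rels K V W"
    with rels_sub have rc: "r \<in> carrier F" by blast
    have "frag_eval G \<phi> r = \<one>\<^bsub>G\<^esub>"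
      using r unfolding tensor_rels_def
    proof (elim UnE CollectE exE conjE)
      fix v v' w assume "r = frag_of (v \<oplus>\<^bsub>V\<^esub> v', w) - frag_of (v, w) - frag_of (v', w)" "v \<in> carrier V" "v' \<in> carrier V" "w \<in> carrier W"
      moreover then have "\<phi> (v \<oplus>\<^bsub>V\<^esub> v') w = \<phi> v w \<otimes>\<^bsub>G\<^esub> \<phi> v' w" using b by (auto simp: balanced_def)
      ultimately show ?thesis
        by (simp add: hd k2 ho cl del: carrier_free_Abelian_group_iff) (simp add: cl m_ac hd k2 ho)
    next
      fix v w w' assume "r = frag_of (v, w \<oplus>\<^bsub>W\<^esub> w') - frag_of (v, w) - frag_of (v, w')" "v \<in> carrier V" "w \<in> carrier W" "w' \<in> carrier W"
      moreover then have "\<phi> v (w \<oplus>\<^bsub>W\<^esub> w') = \<phi> v w \<otimes>\<^bsub>G\<^esub> \<phi> v w'" using b by (auto simp: balanced_def)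
      ultimately show ?thesis
        by (simp add: hd k2 ho cl del: carrier_free_Abelian_group_iff) (simp add: cl m_ac hd k2 ho)
    next
      fix a v w assume "r = frag_of (a \<odot>\<^bsub>V\<^esub> v, w) - frag_of (v, a \<odot>\<^bsub>W\<^esub> w)" "a \<in> carrier K" "v \<in> carrier V" "w \<in> carrier W"
      moreover then have "\<phi> (a \<odot>\<^bsub>V\<^esub> v) w = \<phi> v (a \<odot>\<^bsub>W\<^esub> w)" using b by (auto simp: balanced_def)
      ultimately show ?thesis
        by (simp add: hd k2 ho cl del: carrier_free_Abelian_group_iff)
    qed
    with rc show "r \<in> kernel F G (frag_eval G \<phi>)" by (simp add: kernel_def)
  qed
  then have "N \<subseteq> kernel F G (frag_eval G \<phi>)"
    unfolding tensor_kernel_def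
    by (rule group.generate_subgroup_incl[OF group_free_Abelian_group _ h.subgroup_kernel])
  with n show ?thesis by (auto simp: kernel_def)
qed

lemma lift_coset:
  assumes G: "comm_group G" and b: "balanced K V W G \<phi>" and x: "x \<in> carrier F"
  shows "tensor_lift G \<phi> (N #>\<^bsub>F\<^esub> x) = frag_eval G \<phi> x"
proof -
  interpret comm_group G by fact
  have c: "\<forall>p\<in>S. \<phi> (fst p) (snd p) \<in> carrier G" using b by (auto simp: balanced_def)
  have h: "frag_eval G \<phi> \<in> hom F G" by (rule eval_hom[OF G c])
  have "frag_eval G \<phi> ` (N #>\<^bsub>F\<^esub> x) = {frag_eval G \<phi> x}"
  proof -
    have "frag_eval G \<phi> (n \<otimes>\<^bsub>F\<^esub> x) = frag_eval G \<phi> x" if "n \<in> N" for n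
    proof -
      have "n \<in> carrier F" using N_subgroup that subgroup.mem_carrier by metis
      then show ?thesis using hom_mult[OF h, of n x] x eval_kernel[OF G b that] hom_in_carrier[OF h x] by simp
    qed
    moreover have "N \<noteq> {}" using subgroup.one_closed[OF N_subgroup] by blast
    ultimately show ?thesis by (auto simp: r_coset_def image_iff)
  qed
  then show ?thesis unfolding tensor_lift_def by simp
qed

lemma lift_pure:
  assumes G: "comm_group G" and b: "balanced K V W G \<phi>" and "v\<in>carrier V" "w\<in>carrier W"
  shows "tensor_lift G \<phi> (pure_tensor K V W v w) = \<phi> v w"
  unfolding pure_tensor_def
  using assms by (subst lift_coset[OF G b]) (auto simp: eval_of balanced_def)

lemma lift_hom:
  assumes G: "comm_group G" and b: "balanced K V W G \<phi>"
  shows "tensor_lift G \<phi> \<in> hom T G"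
proof -
  have c: "\<forall>p\<in>S. \<phi> (fst p) (snd p) \<in> carrier G" using b by (auto simp: balanced_def)
  have h: "frag_eval G \<phi> \<in> hom F G" by (rule eval_hom[OF G c])
  show ?thesis
  proof (rule homI)
    fix X assume "X \<in> carrier T"
    then obtain x where x: "x \<in> carrier F" "X = N #>\<^bsub>F\<^esub> x" by (auto simp: tensor_group_def carrier_FactGroup)
    then show "tensor_lift G \<phi> X \<in> carrier G" using lift_coset[OF G b] hom_in_carrier[OF h] by simp
    fix Y assume "Y \<in> carrier T"
    then obtain y where y: "y \<in> carrier F" "Y = N #>\<^bsub>F\<^esub> y" by (auto simp: tensor_group_def carrier_FactGroup)
    have xy: "x \<otimes>\<^bsub>F\<^esub> y \<in> carrier F" using x y group.subgroup_self
      by (meson group.is_monoid group_free_Abelian_group monoid.m_closed)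
    have "X \<otimes>\<^bsub>T\<^esub> Y = N #>\<^bsub>F\<^esub> (x \<otimes>\<^bsub>F\<^esub> y)"
      using x y normal.rcos_sum[OF N_normal x(1) y(1)] by (simp add: tensor_group_def)
    then show "tensor_lift G \<phi> (X \<otimes>\<^bsub>T\<^esub> Y) = tensor_lift G \<phi> X \<otimes>\<^bsub>G\<^esub> tensor_lift G \<phi> Y"
      using lift_coset[OF G b xy] lift_coset[OF G b x(1)] lift_coset[OF G b y(1)] hom_mult[OF h x(1) y(1)] x y by simp
  qed
qed

lemma pure_balanced: "balanced K V W T (pure_tensor K V W)"
proof -
  have eq: "N #>\<^bsub>F\<^esub> x = N #>\<^bsub>F\<^esub> y" if "x - y \<in> N" "x \<in> carrier F" "y \<in> carrier F" for x y
  proof -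
    have "x \<otimes>\<^bsub>F\<^esub> inv\<^bsub>F\<^esub> y \<in> N" using that by simp
    then have "x \<in> N #>\<^bsub>F\<^esub> y" using that
      unfolding r_coset_def by (auto intro!: bexI[of _ "x-y"])
    then show ?thesis using group.repr_independence[OF group_free_Abelian_group _ that(3) N_subgroup] that by metis
  qed
  have ad: "(N #>\<^bsub>F\<^esub> x) \<otimes>\<^bsub>T\<^esub> (N #>\<^bsub>F\<^esub> y) = N #>\<^bsub>F\<^esub> (x + y)" if "x\<in>carrier F" "y\<in>carrier F" for x y
    using normal.rcos_sum[OF N_normal that] by (simp add: tensor_group_def)
  have gen: "r \<in> N" if "r \<in> tensor_rels K V W" for r
    unfolding tensor_kernel_def by (rule generate.incl[OF that])
  have ka: "frag_of a + frag_of b \<in> carrier F" if "a\<in>S" "b\<in>S" for a b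
    using that keys_add[of "frag_of a" "frag_of b"] by (auto simp: keys_frag_of)
  show ?thesis
    unfolding balanced_def pure_tensor_def
  proof (intro conjI ballI)
    fix v w assume "v \<in> carrier V" "w\<in>carrier W"
    then show "N #>\<^bsub>F\<^esub> frag_of (v, w) \<in> carrier T"
      by (auto simp: tensor_group_def carrier_FactGroup)
  next
    fix v v' w assume a: "v \<in> carrier V" "v' \<in> carrier V" "w\<in>carrier W"
    have "frag_of (v \<oplus>\<^bsub>V\<^esub> v', w) - frag_of (v, w) - frag_of (v', w) \<in> tensor_rels K V W"
      unfolding tensor_rels_def using a by blast
    then show "N #>\<^bsub>F\<^esub> frag_of (v \<oplus>\<^bsub>V\<^esub> v', w) = (N #>\<^bsub>F\<^esub> frag_of (v, w)) \<otimes>\<^bsub>T\<^esub> (N #>\<^bsub>F\<^esub> frag_of (v', w))"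
      using a by (subst ad; (intro eq gen)?) (simp_all add: diff_diff_add ka del: carrier_free_Abelian_group_iff, (simp_all)?)
  next
    fix v w w' assume a: "v \<in> carrier V" "w \<in> carrier W" "w'\<in>carrier W"
    have "frag_of (v, w \<oplus>\<^bsub>W\<^esub> w') - frag_of (v, w) - frag_of (v, w') \<in> tensor_rels K V W"
      unfolding tensor_rels_def using a by blast
    then show "N #>\<^bsub>F\<^esub> frag_of (v, w \<oplus>\<^bsub>W\<^esub> w') = (N #>\<^bsub>F\<^esub> frag_of (v, w)) \<otimes>\<^bsub>T\<^esub> (N #>\<^bsub>F\<^esub> frag_of (v, w'))"
      using a by (subst ad; (intro eq gen)?) (simp_all add: diff_diff_add ka del: carrier_free_Abelian_group_iff, (simp_all)?)
  next
    fix c v w assume a: "c \<in> carrier K" "v \<in> carrier V" "w\<in>carrier W"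
    have "frag_of (c \<odot>\<^bsub>V\<^esub> v, w) - frag_of (v, c \<odot>\<^bsub>W\<^esub> w) \<in> tensor_rels K V W"
      unfolding tensor_rels_def using a by blast
    then show "N #>\<^bsub>F\<^esub> frag_of (c \<odot>\<^bsub>V\<^esub> v, w) = N #>\<^bsub>F\<^esub> frag_of (v, c \<odot>\<^bsub>W\<^esub> w)"
      using a by (intro eq gen) (auto)
  qed
qed

lemma T_eqI:
  assumes G: "comm_group G" and f: "f \<in> hom T G" and g: "g \<in> hom T G"
    and eq: "\<And>v w. v\<in>carrier V \<Longrightarrow> w\<in>carrier W \<Longrightarrow> f (pure_tensor K V W v w) = g (pure_tensor K V W v w)"
    and X: "X \<in> carrier T"
  shows "f X = g X"
proof -
  interpret T: comm_group T by (rule T_comm)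
  interpret comm_group G by fact
  interpret f: group_hom T G f by (simp add: group_hom_def group_hom_axioms_def f is_group)
  interpret g: group_hom T G g by (simp add: group_hom_def group_hom_axioms_def g is_group)
  obtain x where x: "x \<in> carrier F" "X = N #>\<^bsub>F\<^esub> x" using X by (auto simp: tensor_group_def carrier_FactGroup)
  have "f (N #>\<^bsub>F\<^esub> x) = g (N #>\<^bsub>F\<^esub> x)"
  proof (rule free_Abelian_group_induct[of x S])
    show "Poly_Mapping.keys x \<subseteq> S" using x by simp
    have 0: "N #>\<^bsub>F\<^esub> 0 = \<one>\<^bsub>T\<^esub>"
      using group.coset_mult_one[OF group_free_Abelian_group, of N S] N_subgroup[THEN subgroup.subset]
      by (simp add: tensor_group_def)
    show "f (N #>\<^bsub>F\<^esub> 0) = g (N #>\<^bsub>F\<^esub> 0)" by (simp add: 0)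
  next
    fix a assume "a \<in> S" then show "f (N #>\<^bsub>F\<^esub> frag_of a) = g (N #>\<^bsub>F\<^esub> frag_of a)"
      using eq[of "fst a" "snd a"] by (auto simp: pure_tensor_def)
  next
    fix x y assume a: "Poly_Mapping.keys x \<subseteq> S" "Poly_Mapping.keys y \<subseteq> S"
     "f (N #>\<^bsub>F\<^esub> x) = g (N #>\<^bsub>F\<^esub> x)" "f (N #>\<^bsub>F\<^esub> y) = g (N #>\<^bsub>F\<^esub> y)"
    then have xyS: "x - y \<in> carrier F" using keys_diff[of x y] by (simp only: carrier_free_Abelian_group_iff) blast
    have c: "N #>\<^bsub>F\<^esub> (x - y) \<in> carrier T" "N #>\<^bsub>F\<^esub> y \<in> carrier T" "N #>\<^bsub>F\<^esub> x \<in> carrier T"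
      unfolding tensor_group_def carrier_FactGroup using xyS a by (simp_all del: subset_iff carrier_free_Abelian_group_iff add: carrier_free_Abelian_group_iff[symmetric] image_eqI)
    have "(N #>\<^bsub>F\<^esub> (x - y)) \<otimes>\<^bsub>T\<^esub> (N #>\<^bsub>F\<^esub> y) = N #>\<^bsub>F\<^esub> x"
      using normal.rcos_sum[OF N_normal, of "x-y" y] a keys_diff[of x y] by (auto simp: tensor_group_def)
    then have d: "N #>\<^bsub>F\<^esub> (x - y) = (N #>\<^bsub>F\<^esub> x) \<otimes>\<^bsub>T\<^esub> inv\<^bsub>T\<^esub> (N #>\<^bsub>F\<^esub> y)"
      using c by (metis T.inv_solve_right)
    show "f (N #>\<^bsub>F\<^esub> (x - y)) = g (N #>\<^bsub>F\<^esub> (x - y))"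
      unfolding d using c a by simp
  qed
  with x show ?thesis by simp
qed
end

lemma lin_map: "f \<in> linear_maps K V W \<Longrightarrow> v \<in> carrier V \<Longrightarrow> f v \<in> carrier W"
  by (auto simp: linear_maps_def hom_def Pi_iff)

lemma map_balanced2:
  assumes "module K A" "module K A'" "module K B" "module K B'" and f: "f \<in> linear_maps K A B" and g: "g \<in> linear_maps K A' B'"
  shows "balanced K A A' (tensor_group K B B') (\<lambda>a b. pure_tensor K B B' (f a) (g b))"
proof -
  interpret B: tensor_pair K B B' using assms by (simp add: tensor_pair_def)
  have "f v \<in> carrier B" if "v \<in> carrier A" for v using that f by (auto simp: lin_map)
  moreover have "g v \<in> carrier B'" if "v \<in> carrier A'" for v using that g by (auto simp: lin_map)
  ultimately show ?thesis using B.pure_balanced f g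
    unfolding balanced_def linear_maps_def hom_def by simp
qed

lemma map_balanced:
  assumes "module K A" "module K B" and f: "f \<in> linear_maps K A B" and g: "g \<in> linear_maps K A B"
  shows "balanced K A A (tensor_group K B B) (\<lambda>a b. pure_tensor K B B (f a) (g b))"
  by (rule map_balanced2) (use assms in auto)

lemma tmap_comp:
  assumes A: "module K A" and B: "module K B" and C: "module K C"
    and f: "f \<in> linear_maps K A B" and g: "g \<in> linear_maps K B C"
    and h: "\<And>x. x \<in> carrier A \<Longrightarrow> h x = g (f x)" and hl: "h \<in> linear_maps K A C"
    and X: "X \<in> carrier (tensor_group K A A)"
  shows "tensor_map K C C h h X = tensor_map K C C g g (tensor_map K B B f f X)"
proof -
  interpret A: tensor_pair K A A using assms by (simp add: tensor_pair_def)
  interpret B: tensor_pair K B B using assms by (simp add: tensor_pair_def)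
  interpret C: tensor_pair K C C using assms by (simp add: tensor_pair_def)
  note bf = map_balanced[OF A B f f] and bg = map_balanced[OF B C g g] and bh = map_balanced[OF A C hl hl]
  note hf = A.lift_hom[OF B.T_comm bf] and hg = B.lift_hom[OF C.T_comm bg] and hh = A.lift_hom[OF C.T_comm bh]
  show ?thesis
    using A.T_eqI[OF C.T_comm hh hom_compose[OF hf hg] _ X]
    by (simp add: tensor_map_def A.lift_pure[OF B.T_comm bf] A.lift_pure[OF C.T_comm bh] B.lift_pure[OF C.T_comm bg] h lin_map[OF f])
qed

lemma tmap_id:
  assumes A: "module K A" and h: "\<And>x. x \<in> carrier A \<Longrightarrow> h x = x" and hl: "h \<in> linear_maps K A A"
    and X: "X \<in> carrier (tensor_group K A A)"
  shows "tensor_map K A A h h X = X"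
proof -
  interpret A: tensor_pair K A A using assms by (simp add: tensor_pair_def)
  interpret T: comm_group "tensor_group K A A" by (rule A.T_comm)
  note bh = map_balanced[OF A A hl hl]
  note hh = A.lift_hom[OF A.T_comm bh]
  have i: "(\<lambda>x. x) \<in> hom (tensor_group K A A) (tensor_group K A A)" by (auto simp: hom_def)
  show ?thesis
    using A.T_eqI[OF A.T_comm hh i _ X]
    by (simp add: tensor_map_def A.lift_pure[OF A.T_comm bh] h)
qed

lemma category_BiAlg: "category (BiAlg K :: (('k,'a) bialg, _) cat)"
proof
  fix X :: "('k,'a) bialg" assume "X \<in> cat_obj (BiAlg K)"
  then interpret X: bialgebra K X by (simp add: BiAlg_def)
  have l: "(\<lambda>x\<in>carrier X. x) \<in> linear_maps K X X"
    by (auto simp: linear_maps_def hom_def)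
  have "comult X x \<in> carrier (tensor_group K X X)" if "x \<in> carrier X" for x
    using lin_map[OF X.comult_linear that] by (simp add: tensor_def)
  then show "cat_id (BiAlg K) X \<in> cat_hom (BiAlg K) X X"
    using l tmap_id[OF X.module_axioms _ l]
    by (auto simp: BiAlg_def bialg_hom_def ring_hom_def)
next
  fix X Y Z :: "('k,'a) bialg" and f g
  assume "X \<in> cat_obj (BiAlg K)" "Y \<in> cat_obj (BiAlg K)" "Z \<in> cat_obj (BiAlg K)"
   and f: "f \<in> cat_hom (BiAlg K) X Y" and g: "g \<in> cat_hom (BiAlg K) Y Z"
  then interpret X: bialgebra K X + Y: bialgebra K Y + Z: bialgebra K Z by (simp_all add: BiAlg_def)
  have fl: "f \<in> linear_maps K X Y" and gl: "g \<in> linear_maps K Y Z" using f g by (auto simp: BiAlg_def bialg_hom_def)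
  have fc: "f x \<in> carrier Y" if "x \<in> carrier X" for x using lin_map[OF fl that] .
  have c: "compose (carrier X) g f \<in> linear_maps K X Z"
    using fl gl by (auto simp: linear_maps_def hom_def compose_def Pi_iff)
  have r: "compose (carrier X) g f \<in> ring_hom X Z"
    using f g by (auto simp: BiAlg_def bialg_hom_def compose_def ring_hom_def Pi_iff)
  have cx: "comult X x \<in> carrier (tensor_group K X X)" if "x \<in> carrier X" for x
    using lin_map[OF X.comult_linear that] by (simp add: tensor_def)
  show "cat_comp (BiAlg K) X Y Z g f \<in> cat_hom (BiAlg K) X Z"
    using f g c r fc cx tmap_comp[OF X.module_axioms Y.module_axioms Z.module_axioms fl gl _ c]
    by (auto simp: BiAlg_def bialg_hom_def compose_def)
next
  fix X Y :: "('k,'a) bialg" and f assume "f \<in> cat_hom (BiAlg K) X Y"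
  then show "cat_comp (BiAlg K) X X Y f (cat_id (BiAlg K) X) = f"
    by (auto simp: BiAlg_def bialg_hom_def compose_def extensional_def)
next
  fix X Y :: "('k,'a) bialg" and f assume f: "f \<in> cat_hom (BiAlg K) X Y"
  then have "f x \<in> carrier Y" if "x \<in> carrier X" for x using that lin_map by (fastforce simp: BiAlg_def bialg_hom_def)
  with f show "cat_comp (BiAlg K) X Y Y (cat_id (BiAlg K) Y) f = f"
    by (auto simp: BiAlg_def bialg_hom_def compose_def extensional_def fun_eq_iff)
next
  fix W X Y Z :: "('k,'a) bialg" and f g h
  assume f: "f \<in> cat_hom (BiAlg K) W X"
  then have "f x \<in> carrier X" if "x \<in> carrier W" for x using that lin_map by (fastforce simp: BiAlg_def bialg_hom_def)
  then show "cat_comp (BiAlg K) W X Z (cat_comp (BiAlg K) X Y Z h g) f =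
       cat_comp (BiAlg K) W Y Z h (cat_comp (BiAlg K) W X Y g f)"
    by (auto simp: BiAlg_def compose_def fun_eq_iff)
qed

lemma category_full: assumes "category C" shows "category (full_subcategory C P)"
proof -
  interpret category C by fact
  show ?thesis by unfold_locales
    (auto simp: full_subcategory_def id_in_hom comp_id_right comp_id_left comp_in_hom comp_assoc)
qed

lemma category_HopfAlg: "category (HopfAlg K)"
  unfolding HopfAlg_def by (intro category_full category_BiAlg)

lemma category_SHopfAlg: "category (SHopfAlg K)"
  unfolding SHopfAlg_def by (intro category_full category_HopfAlg)

end

theory Submission
  imports Defs
begin

text \<open>
  An epimorphism test. Let \<open>R\<close> be a reflector of a full subcategory, and let \<open>f, g : R X \<rightarrow> Z\<close> agree
  after composition with the unit \<open>\<eta> : X \<rightarrow> R X\<close>. If \<open>\<eta>\<close> factors through some \<open>i : E \<rightarrow> R X\<close> with \<open>E\<close> in the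
  subcategory and \<open>f i = g i\<close>, the universal property of \<open>\<eta>\<close> gives a section of \<open>i\<close>, so \<open>f = g\<close>
  (\<open>epimorphism_reflection_unit\<close>). Dually, for \<open>f, g : W \<rightarrow> R X\<close> which agree after composition with
  the counit \<open>\<epsilon>\<close> of a coreflection it is enough to factor \<open>\<epsilon>\<close> through some \<open>q : R X \<rightarrow> Q\<close> with \<open>q f = q g\<close>
  (\<open>monomorphism_coreflection_counit\<close>). It remains to construct \<open>E\<close> and \<open>Q\<close>.

  Let \<open>H = R X\<close>, with antipode \<open>S\<close>. For the epimorphisms \<open>E\<close> is the largest subcoalgebra of \<open>H\<close> on which \<open>f\<close> and \<open>g\<close> agree.
  It contains the image of \<open>\<eta>\<close>, and it is closed under products because \<open>f\<close> and \<open>g\<close> are multiplicative.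
  For the antipode, note that \<open>f S\<close> and \<open>g S\<close> are convolution inverses of \<open>f\<close> and \<open>g\<close>, and that inverses \<open>l\<close>
  of \<open>m\<close> and \<open>r\<close> of \<open>m'\<close> satisfy
  \<open>l - r = l * (m' - m) * r\<close>.
  Hence \<open>f S\<close> and \<open>g S\<close> agree on \<open>E\<close>. As \<open>S\<close> reverses the comultiplication, \<open>S(E)\<close> is a subcoalgebra, so
  \<open>S(E) \<subseteq> E\<close> and \<open>E\<close> is a Hopf subalgebra (\<open>factor_through_hopf_subalgebra\<close>).

  For the monomorphisms \<open>Q\<close> is the quotient of \<open>H\<close> by the ideal \<open>I\<close> generated by all \<open>f w - g w\<close>. It is a
  coideal because \<open>f\<close> and \<open>g\<close> are comultiplicative, and it is contained in the kernel of \<open>\<epsilon>\<close>. The same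
  identity, now for \<open>S f\<close> and \<open>S g\<close>, writes \<open>S(f w) - S(g w)\<close> as an element of \<open>I\<close>; as \<open>S\<close> reverses
  products, \<open>S(I) \<subseteq> I\<close> and \<open>I\<close> is a Hopf ideal (\<open>factor_through_hopf_quotient\<close>).

  If \<open>S\<close> is bijective, its inverse satisfies the antipode laws for the opposite multiplication. The
  two arguments apply to it as well, so \<open>E\<close> and \<open>Q\<close> again have a bijective antipode. Here \<open>Z\<close> and \<open>W\<close>
  are arbitrary bialgebras, so this settles the adjunctions of both inclusions.

  Two devices keep the constructions inside one type of elements. The quotient is realised on a
  linear complement of \<open>I\<close>. A linear projection \<open>p\<close> (\<open>linear_projection_onto_submodule\<close>) onto the complement,
  or onto \<open>E\<close>, yields the comultiplication \<open>(p \<otimes> p) \<Delta>\<close>, with values in the tensor square of the smaller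
  space, so that subalgebra and quotient are two instances of one construction
  (\<open>bialgebra_subquotient\<close>). Computations in Sweedler notation are computations with the operator
  \<open>sweedler\<close>, where \<open>sweedler C M \<phi> x\<close> is \<open>\<Sum> \<phi> x\<^sub>1 x\<^sub>2\<close> in \<open>M\<close>.
\<close>

section \<open>Linear and bilinear maps\<close>

lemma linear_mapsI:
  assumes "\<And>v. v \<in> carrier V \<Longrightarrow> f v \<in> carrier W"
    and "\<And>v v'. v \<in> carrier V \<Longrightarrow> v' \<in> carrier V \<Longrightarrow> f (v \<oplus>\<^bsub>V\<^esub> v') = f v \<oplus>\<^bsub>W\<^esub> f v'"
    and "\<And>a v. a \<in> carrier K \<Longrightarrow> v \<in> carrier V \<Longrightarrow> f (a \<odot>\<^bsub>V\<^esub> v) = a \<odot>\<^bsub>W\<^esub> f v"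
  shows "f \<in> linear_maps K V W"
  using assms by (auto simp: linear_maps_def hom_def)

lemma linear_add:
  "f \<in> linear_maps K V W \<Longrightarrow> v \<in> carrier V \<Longrightarrow> v' \<in> carrier V \<Longrightarrow> f (v \<oplus>\<^bsub>V\<^esub> v') = f v \<oplus>\<^bsub>W\<^esub> f v'"
  by (auto simp: linear_maps_def hom_def)

lemma linear_smult:
  "f \<in> linear_maps K V W \<Longrightarrow> a \<in> carrier K \<Longrightarrow> v \<in> carrier V \<Longrightarrow> f (a \<odot>\<^bsub>V\<^esub> v) = a \<odot>\<^bsub>W\<^esub> f v"
  by (auto simp: linear_maps_def)

lemma linear_hom: "f \<in> linear_maps K V W \<Longrightarrow> f \<in> hom (add_monoid V) (add_monoid W)"
  by (simp add: linear_maps_def)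

lemma linear_zero:
  assumes "module K V" "module K W" "f \<in> linear_maps K V W"
  shows "f \<zero>\<^bsub>V\<^esub> = \<zero>\<^bsub>W\<^esub>"
proof -
  interpret V: module K V by fact
  interpret W: module K W by fact
  have "f \<zero>\<^bsub>V\<^esub> \<oplus>\<^bsub>W\<^esub> f \<zero>\<^bsub>V\<^esub> = f \<zero>\<^bsub>V\<^esub>"
    using linear_add[OF assms(3), of "\<zero>\<^bsub>V\<^esub>" "\<zero>\<^bsub>V\<^esub>"] by simp
  then show ?thesis using lin_map[OF assms(3), of "\<zero>\<^bsub>V\<^esub>"] W.add.l_cancel_one' by (metis V.zero_closed)
qed

lemma linear_uminus:
  assumes "module K V" "module K W" "f \<in> linear_maps K V W" "x \<in> carrier V"
  shows "f (\<ominus>\<^bsub>V\<^esub> x) = \<ominus>\<^bsub>W\<^esub> f x"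
proof -
  interpret V: module K V by fact
  interpret W: module K W by fact
  have "f x \<oplus>\<^bsub>W\<^esub> f (\<ominus>\<^bsub>V\<^esub> x) = \<zero>\<^bsub>W\<^esub>"
    using linear_add[OF assms(3,4), of "\<ominus>\<^bsub>V\<^esub> x"] linear_zero[OF assms(1-3)] assms(4)
    by (simp add: V.r_neg)
  then show ?thesis using lin_map[OF assms(3)] assms(4)
    by (metis V.a_inv_closed W.minus_equality W.a_comm)
qed

lemma linear_minus:
  assumes "module K V" "module K W" "f \<in> linear_maps K V W" "x \<in> carrier V" "y \<in> carrier V"
  shows "f (x \<ominus>\<^bsub>V\<^esub> y) = f x \<ominus>\<^bsub>W\<^esub> f y"
proof -
  interpret V: module K V by fact
  show ?thesis using assms linear_add[OF assms(3), of x "\<ominus>\<^bsub>V\<^esub> y"] 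
    by (simp add: a_minus_def linear_uminus)
qed

lemma linear_id: "(\<lambda>x. x) \<in> linear_maps K V V"
  by (simp add: linear_mapsI)

lemma linear_comp:
  "g \<in> linear_maps K V W \<Longrightarrow> f \<in> linear_maps K U V \<Longrightarrow> (\<lambda>x. g (f x)) \<in> linear_maps K U W"
  by (rule linear_mapsI) (simp_all add: lin_map linear_add linear_smult)

lemma linear_cong:
  assumes "module K V" "f \<in> linear_maps K V W" "\<And>x. x \<in> carrier V \<Longrightarrow> g x = f x"
  shows "g \<in> linear_maps K V W"
proof -
  interpret V: module K V by fact
  show ?thesis by (rule linear_mapsI) (simp_all add: assms(3) lin_map[OF assms(2)] linear_add[OF assms(2)] linear_smult[OF assms(2)])
qed

text \<open>
  Bilinearity is phrased through linearity in each argument, so that the bilinearity of a nested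
  expression is proved by composing linear maps.
\<close>

definition bilinear_maps ::
  "('k, 'm) ring_scheme \<Rightarrow> ('k, 'v, 'x) module_scheme \<Rightarrow> ('k, 'w, 'y) module_scheme
    \<Rightarrow> ('k, 'u, 'z) module_scheme \<Rightarrow> ('v \<Rightarrow> 'w \<Rightarrow> 'u) set" where
  "bilinear_maps K V W U =
     {\<phi>. (\<forall>w\<in>carrier W. (\<lambda>v. \<phi> v w) \<in> linear_maps K V U) \<and> (\<forall>v\<in>carrier V. \<phi> v \<in> linear_maps K W U)}"

lemma bilinearI:
  assumes "\<And>w. w \<in> carrier W \<Longrightarrow> (\<lambda>v. \<phi> v w) \<in> linear_maps K V U"
    and "\<And>v. v \<in> carrier V \<Longrightarrow> (\<lambda>w. \<phi> v w) \<in> linear_maps K W U"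
  shows "\<phi> \<in> bilinear_maps K V W U"
  using assms by (simp add: bilinear_maps_def)

lemma bilinear_left: "\<phi> \<in> bilinear_maps K V W U \<Longrightarrow> w \<in> carrier W \<Longrightarrow> (\<lambda>v. \<phi> v w) \<in> linear_maps K V U"
  by (simp add: bilinear_maps_def)

lemma bilinear_right: "\<phi> \<in> bilinear_maps K V W U \<Longrightarrow> v \<in> carrier V \<Longrightarrow> (\<lambda>w. \<phi> v w) \<in> linear_maps K W U"
  by (simp add: bilinear_maps_def)

lemma bilinear_closed:
  "\<phi> \<in> bilinear_maps K V W U \<Longrightarrow> v \<in> carrier V \<Longrightarrow> w \<in> carrier W \<Longrightarrow> \<phi> v w \<in> carrier U"
  by (blast dest: bilinear_right lin_map)

lemma linear_bilinear_left:
  "\<phi> \<in> bilinear_maps K V W U \<Longrightarrow> f \<in> linear_maps K A V \<Longrightarrow> w \<in> carrier W \<Longrightarrow> (\<lambda>x. \<phi> (f x) w) \<in> linear_maps K A U"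
  by (rule linear_comp[OF bilinear_left])

lemma linear_bilinear_right:
  "\<phi> \<in> bilinear_maps K V W U \<Longrightarrow> f \<in> linear_maps K A W \<Longrightarrow> v \<in> carrier V \<Longrightarrow> (\<lambda>x. \<phi> v (f x)) \<in> linear_maps K A U"
  by (rule linear_comp[OF bilinear_right])

lemma bilinear_comp:
  assumes "\<phi> \<in> bilinear_maps K V W U" "f \<in> linear_maps K V' V" "g \<in> linear_maps K W' W"
  shows "(\<lambda>a b. \<phi> (f a) (g b)) \<in> bilinear_maps K V' W' U"
  by (rule bilinearI, rule linear_bilinear_left[OF assms(1,2)], rule lin_map[OF assms(3)], assumption,
      rule linear_bilinear_right[OF assms(1,3)], rule lin_map[OF assms(2)])

lemma bilinear_post:
  assumes "h \<in> linear_maps K U U'" "\<phi> \<in> bilinear_maps K V W U"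
  shows "(\<lambda>a b. h (\<phi> a b)) \<in> bilinear_maps K V W U'"
  by (rule bilinearI; rule linear_comp[OF assms(1)])
    (rule bilinear_left[OF assms(2)] bilinear_right[OF assms(2)]; assumption)+

lemma bilinear_flip:
  "\<phi> \<in> bilinear_maps K V W U \<Longrightarrow> (\<lambda>a b. \<phi> b a) \<in> bilinear_maps K W V U"
  by (simp add: bilinear_maps_def)

lemma bilinear_balanced:
  "\<phi> \<in> bilinear_maps K V W U \<Longrightarrow> balanced K V W (add_monoid U) \<phi>"
  unfolding balanced_def bilinear_maps_def linear_maps_def hom_def Pi_iff by simp

lemma (in module) add_comm_group: "comm_group (add_monoid M)"
  by (rule M.a_comm_group)

section \<open>Tensor products\<close>

lemma frag_eval_cong:
  assumes "carrier G = carrier G'" "monoid.mult G = monoid.mult G'" "one G = one G'"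
  shows "frag_eval G \<phi> = frag_eval G' \<phi>"
  unfolding frag_eval_def finprod_def int_pow_def nat_pow_def m_inv_def assms by (rule refl)

text \<open>
  The additive group of the vector space \<open>V \<otimes> W\<close> and the group \<open>tensor_group\<close> differ only in their
  irrelevant record extension. All lifts are taken with values in the additive group of a module,
  so that the linear structure of the target is at hand.
\<close>

lemma tensor_lift_tensor_group:
  "tensor_lift (tensor_group K V W) = tensor_lift (add_monoid (tensor K V W))"
  by (intro ext, unfold tensor_lift_def, subst frag_eval_cong) (auto simp: tensor_def)

lemma tensor_map_eq: "tensor_map K V W f g = tensor_lift (add_monoid (tensor K V W)) (\<lambda>a b. pure_tensor K V W (f a) (g b))"
  by (simp add: tensor_map_def tensor_lift_tensor_group)

lemma hom_generate_subgroup: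
  assumes "group G" "group H" "f \<in> hom G H" "subgroup B H" "A \<subseteq> carrier G"
    and "\<And>a. a \<in> A \<Longrightarrow> f a \<in> B" and x: "x \<in> generate G A"
  shows "f x \<in> B"
proof -
  interpret group_hom G H f using assms by (simp add: group_hom_def group_hom_axioms_def)
  have "subgroup {x \<in> carrier G. f x \<in> B} G"
    using assms(4) by (intro G.subgroupI) (auto simp: subgroup.m_inv_closed subgroup.m_closed subgroup.one_closed intro: exI[of _ "\<one>\<^bsub>G\<^esub>"])
  then have "generate G A \<subseteq> {x \<in> carrier G. f x \<in> B}"
    using assms(5,6) by (intro G.generate_subgroup_incl) auto
  with x show ?thesis by blast
qed

lemma hom_generate_eq:
  assumes "group G" "group H" "f \<in> hom G H" "g \<in> hom G H" "A \<subseteq> carrier G"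
    and "\<And>a. a \<in> A \<Longrightarrow> f a = g a" and x: "x \<in> generate G A"
  shows "f x = g x"
proof -
  interpret f: group_hom G H f using assms by (simp add: group_hom_def group_hom_axioms_def)
  interpret g: group_hom G H g using assms by (simp add: group_hom_def group_hom_axioms_def)
  have "subgroup {x \<in> carrier G. f x = g x} G"
    by (intro f.G.subgroupI) (auto intro: exI[of _ "\<one>\<^bsub>G\<^esub>"])
  then have "generate G A \<subseteq> {x \<in> carrier G. f x = g x}"
    using assms(5,6) by (intro f.G.generate_subgroup_incl) auto
  with x show ?thesis by blast
qed

text \<open>
  The image of \<open>X \<otimes> Y\<close> in \<open>V \<otimes> W\<close>. If \<open>X\<close> or \<open>Y\<close> is closed under scalars, the additive span is already the
  linear span.
\<close>

definition tensor_span ::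
  "('k, 'm) ring_scheme \<Rightarrow> ('k, 'v, 'x) module_scheme \<Rightarrow> ('k, 'w, 'y) module_scheme
    \<Rightarrow> 'v set \<Rightarrow> 'w set \<Rightarrow> ('v \<times> 'w \<Rightarrow>\<^sub>0 int) set set" where
  "tensor_span K V W X Y =
     generate (add_monoid (tensor K V W)) {pure_tensor K V W x y | x y. x \<in> X \<and> y \<in> Y}"

context tensor_pair
begin

lemma tensor_comm_group: "comm_group (add_monoid (tensor K V W))"
proof -
  interpret T: comm_group T by (rule T_comm)
  show ?thesis
    by (rule comm_groupI) (auto simp: tensor_def T.m_ac intro: bexI[of _ "inv\<^bsub>T\<^esub> _"])
qed

lemma pure_closed: "v \<in> carrier V \<Longrightarrow> w \<in> carrier W \<Longrightarrow> pure_tensor K V W v w \<in> carrier (tensor K V W)"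
  using pure_balanced by (simp add: balanced_def tensor_def)

lemma tensor_lift_pure:
  assumes "module K M" "\<phi> \<in> bilinear_maps K V W M" "v \<in> carrier V" "w \<in> carrier W"
  shows "tensor_lift (add_monoid M) \<phi> (pure_tensor K V W v w) = \<phi> v w"
  by (rule lift_pure[OF module.add_comm_group[OF assms(1)] bilinear_balanced[OF assms(2)] assms(3,4)])

lemma tensor_lift_additive:
  assumes "comm_group G" "balanced K V W G \<phi>"
  shows "tensor_lift G \<phi> \<in> hom (add_monoid (tensor K V W)) G"
  using lift_hom[OF assms] by (simp add: hom_def tensor_def)

lemma tensor_eqI:
  assumes "comm_group G" "f \<in> hom (add_monoid (tensor K V W)) G" "g \<in> hom (add_monoid (tensor K V W)) G"
    "\<And>v w. v\<in>carrier V \<Longrightarrow> w\<in>carrier W \<Longrightarrow> f (pure_tensor K V W v w) = g (pure_tensor K V W v w)"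
    "X \<in> carrier (tensor K V W)"
  shows "f X = g X"
  using T_eqI[OF assms(1), of f g X] assms by (simp add: hom_def tensor_def)

lemma tensor_abelian_group: "abelian_group (tensor K V W)"
  using tensor_comm_group
  by (intro abelian_group.intro abelian_monoid.intro abelian_group_axioms.intro) (auto simp: comm_group_def)

lemma smult_balanced:
  assumes "a \<in> carrier K" shows "balanced K V W (add_monoid (tensor K V W)) (\<lambda>v w. pure_tensor K V W (a \<odot>\<^bsub>V\<^esub> v) w)"
  using pure_balanced assms unfolding balanced_def
  by (simp add: tensor_def V.smult_r_distr W.smult_assoc1[symmetric] V.R.m_comm)

lemma tensor_smult_eq:
  "smult (tensor K V W) a =
    tensor_lift (add_monoid (tensor K V W)) (\<lambda>v w. pure_tensor K V W (a \<odot>\<^bsub>V\<^esub> v) w)"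
  by (subst tensor_lift_tensor_group[symmetric]) (simp add: tensor_def)

lemma tensor_smult_hom:
  "a \<in> carrier K \<Longrightarrow> (\<lambda>X. a \<odot>\<^bsub>tensor K V W\<^esub> X) \<in> hom (add_monoid (tensor K V W)) (add_monoid (tensor K V W))"
  using tensor_lift_additive[OF tensor_comm_group smult_balanced]
  by (simp add: tensor_smult_eq)

lemma tensor_smult_pure:
  assumes "a \<in> carrier K" "v \<in> carrier V" "w \<in> carrier W"
  shows "a \<odot>\<^bsub>tensor K V W\<^esub> pure_tensor K V W v w = pure_tensor K V W (a \<odot>\<^bsub>V\<^esub> v) w"
  using lift_pure[OF tensor_comm_group smult_balanced[OF assms(1)] assms(2,3)]
  by (simp add: tensor_smult_eq)

lemma pure_add_left: "v \<in> carrier V \<Longrightarrow> v' \<in> carrier V \<Longrightarrow> w \<in> carrier W \<Longrightarrow>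
   pure_tensor K V W (v \<oplus>\<^bsub>V\<^esub> v') w = pure_tensor K V W v w \<oplus>\<^bsub>tensor K V W\<^esub> pure_tensor K V W v' w"
  using pure_balanced by (simp add: balanced_def tensor_def)

lemma pure_add_right: "v \<in> carrier V \<Longrightarrow> w \<in> carrier W \<Longrightarrow> w' \<in> carrier W \<Longrightarrow>
   pure_tensor K V W v (w \<oplus>\<^bsub>W\<^esub> w') = pure_tensor K V W v w \<oplus>\<^bsub>tensor K V W\<^esub> pure_tensor K V W v w'"
  using pure_balanced by (simp add: balanced_def tensor_def)

lemma pure_smult_right: "a \<in> carrier K \<Longrightarrow> v \<in> carrier V \<Longrightarrow> w \<in> carrier W \<Longrightarrow>
   pure_tensor K V W v (a \<odot>\<^bsub>W\<^esub> w) = a \<odot>\<^bsub>tensor K V W\<^esub> pure_tensor K V W v w"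
  using pure_balanced by (simp add: balanced_def tensor_smult_pure)

lemma tensor_module: "module K (tensor K V W)"
proof (rule moduleI)
  let ?T = "tensor K V W"
  interpret T: abelian_group ?T by (rule tensor_abelian_group)
  note cg = tensor_comm_group
  show "cring K" by (rule V.R.is_cring)
  show "abelian_group ?T" by (rule tensor_abelian_group)
  show cl: "a \<odot>\<^bsub>?T\<^esub> X \<in> carrier ?T" if "a \<in> carrier K" "X \<in> carrier ?T" for a X
    using hom_in_carrier[OF tensor_smult_hom[OF that(1)]] that by simp
  show ad: "a \<odot>\<^bsub>?T\<^esub> (X \<oplus>\<^bsub>?T\<^esub> Y) = a \<odot>\<^bsub>?T\<^esub> X \<oplus>\<^bsub>?T\<^esub> a \<odot>\<^bsub>?T\<^esub> Y" if "a \<in> carrier K" "X \<in> carrier ?T" "Y \<in> carrier ?T" for a X Y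
    using hom_mult[OF tensor_smult_hom[OF that(1)], of X Y] that by simp
  show "(a \<oplus>\<^bsub>K\<^esub> b) \<odot>\<^bsub>?T\<^esub> X = a \<odot>\<^bsub>?T\<^esub> X \<oplus>\<^bsub>?T\<^esub> b \<odot>\<^bsub>?T\<^esub> X"
    if a: "a \<in> carrier K" "b \<in> carrier K" and X: "X \<in> carrier ?T" for a b X
  proof (rule tensor_eqI[OF cg _ _ _ X])
    show "(\<lambda>X. (a \<oplus>\<^bsub>K\<^esub> b) \<odot>\<^bsub>?T\<^esub> X) \<in> hom (add_monoid ?T) (add_monoid ?T)" using a by (intro tensor_smult_hom) simp
    show "(\<lambda>X. a \<odot>\<^bsub>?T\<^esub> X \<oplus>\<^bsub>?T\<^esub> b \<odot>\<^bsub>?T\<^esub> X) \<in> hom (add_monoid ?T) (add_monoid ?T)"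
      using a by (auto simp: hom_def cl ad T.a_ac)
    show "(a \<oplus>\<^bsub>K\<^esub> b) \<odot>\<^bsub>?T\<^esub> pure_tensor K V W v w = a \<odot>\<^bsub>?T\<^esub> pure_tensor K V W v w \<oplus>\<^bsub>?T\<^esub> b \<odot>\<^bsub>?T\<^esub> pure_tensor K V W v w"
      if "v \<in> carrier V" "w \<in> carrier W" for v w
      using that a by (simp add: tensor_smult_pure V.smult_l_distr pure_add_left)
  qed
  show "(a \<otimes>\<^bsub>K\<^esub> b) \<odot>\<^bsub>?T\<^esub> X = a \<odot>\<^bsub>?T\<^esub> (b \<odot>\<^bsub>?T\<^esub> X)"
    if a: "a \<in> carrier K" "b \<in> carrier K" and X: "X \<in> carrier ?T" for a b X
  proof (rule tensor_eqI[OF cg _ _ _ X])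
    show "(\<lambda>X. (a \<otimes>\<^bsub>K\<^esub> b) \<odot>\<^bsub>?T\<^esub> X) \<in> hom (add_monoid ?T) (add_monoid ?T)" using a by (intro tensor_smult_hom) simp
    show "(\<lambda>X. a \<odot>\<^bsub>?T\<^esub> (b \<odot>\<^bsub>?T\<^esub> X)) \<in> hom (add_monoid ?T) (add_monoid ?T)"
      using a by (auto simp: hom_def cl ad)
    show "(a \<otimes>\<^bsub>K\<^esub> b) \<odot>\<^bsub>?T\<^esub> pure_tensor K V W v w = a \<odot>\<^bsub>?T\<^esub> (b \<odot>\<^bsub>?T\<^esub> pure_tensor K V W v w)"
      if "v \<in> carrier V" "w \<in> carrier W" for v w
      using that a by (simp add: tensor_smult_pure V.smult_assoc1)
  qed
  show "\<one>\<^bsub>K\<^esub> \<odot>\<^bsub>?T\<^esub> X = X" if X: "X \<in> carrier ?T" for X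
  proof (rule tensor_eqI[OF cg _ _ _ X])
    show "(\<lambda>X. \<one>\<^bsub>K\<^esub> \<odot>\<^bsub>?T\<^esub> X) \<in> hom (add_monoid ?T) (add_monoid ?T)" by (intro tensor_smult_hom) simp
    show "(\<lambda>X. X) \<in> hom (add_monoid ?T) (add_monoid ?T)" by (auto simp: hom_def)
  qed (simp add: tensor_smult_pure)
qed

lemma pure_bilinear: "pure_tensor K V W \<in> bilinear_maps K V W (tensor K V W)"
  by (intro bilinearI linear_mapsI)
    (simp_all add: pure_closed pure_add_left pure_add_right tensor_smult_pure pure_smult_right)

lemma tensor_lift_linear:
  assumes M: "module K M" and \<phi>: "\<phi> \<in> bilinear_maps K V W M"
  shows "tensor_lift (add_monoid M) \<phi> \<in> linear_maps K (tensor K V W) M"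
proof -
  interpret M: module K M by fact
  interpret T: module K "tensor K V W" by (rule tensor_module)
  have h: "tensor_lift (add_monoid M) \<phi> \<in> hom (add_monoid (tensor K V W)) (add_monoid M)"
    by (rule tensor_lift_additive[OF M.add_comm_group bilinear_balanced[OF \<phi>]])
  have "tensor_lift (add_monoid M) \<phi> (a \<odot>\<^bsub>tensor K V W\<^esub> X) = a \<odot>\<^bsub>M\<^esub> tensor_lift (add_monoid M) \<phi> X"
    if a: "a \<in> carrier K" and X: "X \<in> carrier (tensor K V W)" for a X
  proof (rule tensor_eqI[OF M.add_comm_group _ _ _ X])
    show "(\<lambda>X. tensor_lift (add_monoid M) \<phi> (a \<odot>\<^bsub>tensor K V W\<^esub> X)) \<in> hom (add_monoid (tensor K V W)) (add_monoid M)"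
      using h a by (auto simp: hom_def T.smult_r_distr Pi_iff)
    show "(\<lambda>X. a \<odot>\<^bsub>M\<^esub> tensor_lift (add_monoid M) \<phi> X) \<in> hom (add_monoid (tensor K V W)) (add_monoid M)"
      using h a by (auto simp: hom_def M.smult_r_distr Pi_iff)
    show "tensor_lift (add_monoid M) \<phi> (a \<odot>\<^bsub>tensor K V W\<^esub> pure_tensor K V W v w) = a \<odot>\<^bsub>M\<^esub> tensor_lift (add_monoid M) \<phi> (pure_tensor K V W v w)"
      if "v \<in> carrier V" "w \<in> carrier W" for v w
      using that a \<phi> by (simp add: tensor_smult_pure tensor_lift_pure[OF M] linear_smult[OF bilinear_left])
  qed
  with h show ?thesis by (simp add: linear_maps_def)
qed

lemma tensor_linear_eqI:
  assumes "module K M" "f \<in> linear_maps K (tensor K V W) M" "g \<in> linear_maps K (tensor K V W) M"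
    "\<And>v w. v\<in>carrier V \<Longrightarrow> w\<in>carrier W \<Longrightarrow> f (pure_tensor K V W v w) = g (pure_tensor K V W v w)"
    "X \<in> carrier (tensor K V W)"
  shows "f X = g X"
  by (rule tensor_eqI[OF module.add_comm_group[OF assms(1)] linear_hom[OF assms(2)] linear_hom[OF assms(3)] assms(4,5)])

lemma tensor_span_subset:
  assumes "X \<subseteq> carrier V" "Y \<subseteq> carrier W"
  shows "{pure_tensor K V W x y | x y. x \<in> X \<and> y \<in> Y} \<subseteq> carrier (add_monoid (tensor K V W))"
  using assms pure_closed by auto

lemma tensor_span_subgroup:
  assumes "X \<subseteq> carrier V" "Y \<subseteq> carrier W"
  shows "subgroup (tensor_span K V W X Y) (add_monoid (tensor K V W))"
  unfolding tensor_span_def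
  by (rule group.generate_is_subgroup[OF _ tensor_span_subset[OF assms]])
    (rule abelian_group.a_group[OF tensor_abelian_group])

lemma pure_in_span: "x \<in> X \<Longrightarrow> y \<in> Y \<Longrightarrow> pure_tensor K V W x y \<in> tensor_span K V W X Y"
  unfolding tensor_span_def by (rule generate.incl) blast

text \<open>
  Two additive maps on \<open>V \<otimes> W\<close> which agree on pure tensors are equal; apply this to maps into the
  quotient by the span of the pure tensors.
\<close>

lemma tensor_span_carrier: 
  assumes Z: "Z \<in> carrier (tensor K V W)"
  shows "Z \<in> tensor_span K V W (carrier V) (carrier W)"
proof -
  let ?G = "add_monoid (tensor K V W)" and ?B = "tensor_span K V W (carrier V) (carrier W)"
  interpret G: comm_group ?G by (rule tensor_comm_group)
  have N: "?B \<lhd> ?G" using G.normal_iff_subgroup tensor_span_subgroup by simp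
  interpret N: normal ?B ?G by fact
  \<comment> \<open>The projection to the quotient by the span and the zero map agree on pure tensors.\<close>
  have "(\<lambda>x. ?B #>\<^bsub>?G\<^esub> x) Z = (\<lambda>x. ?B) Z"
  proof (rule tensor_eqI[OF _ _ _ _ Z])
    show "comm_group (?G Mod ?B)" by (rule G.abelian_FactGroup) (simp add: tensor_span_subgroup)
    show "(\<lambda>x. ?B #>\<^bsub>?G\<^esub> x) \<in> hom ?G (?G Mod ?B)" by (rule N.r_coset_hom_Mod)
    show "(\<lambda>x. ?B) \<in> hom ?G (?G Mod ?B)"
      using N.factorgroup_is_group group.is_monoid monoid.one_closed monoid.l_one
      by (fastforce simp: hom_def)
    show "?B #>\<^bsub>?G\<^esub> pure_tensor K V W v w = ?B" if "v \<in> carrier V" "w \<in> carrier W" for v w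
      using that by (intro G.coset_join2) (auto simp: tensor_span_subgroup pure_in_span pure_closed[simplified])
  qed
  then show ?thesis using G.coset_join1[of ?B Z] Z tensor_span_subgroup[OF subset_refl subset_refl] by simp
qed

lemma tensor_span_linear:
  assumes "module K M" "f \<in> linear_maps K (tensor K V W) M" "subgroup B (add_monoid M)"
    "X \<subseteq> carrier V" "Y \<subseteq> carrier W"
    "\<And>x y. x \<in> X \<Longrightarrow> y \<in> Y \<Longrightarrow> f (pure_tensor K V W x y) \<in> B"
    "Z \<in> tensor_span K V W X Y"
  shows "f Z \<in> B"
proof -
  interpret M: module K M by fact
  show ?thesis
    by (rule hom_generate_subgroup[OF _ _ linear_hom[OF assms(2)] assms(3) tensor_span_subset[OF assms(4,5)] _ assms(7)[unfolded tensor_span_def]])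
      (use assms(6) in \<open>auto simp: M.a_group abelian_group.a_group[OF tensor_abelian_group]\<close>)
qed

lemma tensor_span_eqI:
  assumes "module K M" "f \<in> linear_maps K (tensor K V W) M" "g \<in> linear_maps K (tensor K V W) M"
    "X \<subseteq> carrier V" "Y \<subseteq> carrier W"
    "\<And>x y. x \<in> X \<Longrightarrow> y \<in> Y \<Longrightarrow> f (pure_tensor K V W x y) = g (pure_tensor K V W x y)"
    "Z \<in> tensor_span K V W X Y"
  shows "f Z = g Z"
proof -
  interpret M: module K M by fact
  show ?thesis
    by (rule hom_generate_eq[OF _ _ linear_hom[OF assms(2)] linear_hom[OF assms(3)] tensor_span_subset[OF assms(4,5)] _ assms(7)[unfolded tensor_span_def]])
      (use assms(6) in \<open>auto simp: M.a_group abelian_group.a_group[OF tensor_abelian_group]\<close>)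
qed

text \<open>
  A lift depends linearly on every parameter on which the lifted bilinear map depends linearly.
  This is what makes iterated Sweedler sums multilinear.
\<close>

lemma tensor_lift_param:
  assumes A: "module K A" and M: "module K M"
    and 1: "\<And>a. a \<in> carrier A \<Longrightarrow> \<phi> a \<in> bilinear_maps K V W M"
    and 2: "\<And>v w. v \<in> carrier V \<Longrightarrow> w \<in> carrier W \<Longrightarrow> (\<lambda>a. \<phi> a v w) \<in> linear_maps K A M"
    and X: "X \<in> carrier (tensor K V W)"
  shows "(\<lambda>a. tensor_lift (add_monoid M) (\<phi> a) X) \<in> linear_maps K A M"
proof (rule linear_mapsI)
  interpret A: module K A by fact
  interpret M: module K M by fact
  note lin = tensor_lift_linear[OF M 1]
  show "tensor_lift (add_monoid M) (\<phi> a) X \<in> carrier M" if "a \<in> carrier A" for a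
    by (rule lin_map[OF lin[OF that] X])
  show "tensor_lift (add_monoid M) (\<phi> (a \<oplus>\<^bsub>A\<^esub> a')) X = tensor_lift (add_monoid M) (\<phi> a) X \<oplus>\<^bsub>M\<^esub> tensor_lift (add_monoid M) (\<phi> a') X"
    if "a \<in> carrier A" "a' \<in> carrier A" for a a'
  proof (rule tensor_linear_eqI[OF M lin _ _ X])
    show "(\<lambda>X. tensor_lift (add_monoid M) (\<phi> a) X \<oplus>\<^bsub>M\<^esub> tensor_lift (add_monoid M) (\<phi> a') X) \<in> linear_maps K (tensor K V W) M"
      using lin[OF that(1)] lin[OF that(2)]
      by (intro linear_mapsI) (simp_all add: lin_map linear_add linear_smult M.a_ac M.smult_r_distr)
  qed (use that in \<open>simp_all add: tensor_lift_pure[OF M 1] linear_add[OF 2]\<close>)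
  show "tensor_lift (add_monoid M) (\<phi> (c \<odot>\<^bsub>A\<^esub> a)) X = c \<odot>\<^bsub>M\<^esub> tensor_lift (add_monoid M) (\<phi> a) X"
    if "c \<in> carrier K" "a \<in> carrier A" for c a
  proof (rule tensor_linear_eqI[OF M lin _ _ X])
    show "(\<lambda>X. c \<odot>\<^bsub>M\<^esub> tensor_lift (add_monoid M) (\<phi> a) X) \<in> linear_maps K (tensor K V W) M"
      using lin[OF that(2)] that(1)
      by (intro linear_mapsI) (simp_all add: lin_map linear_add linear_smult M.smult_r_distr M.smult_assoc1[symmetric] V.R.m_comm)
  qed (use that in \<open>simp_all add: tensor_lift_pure[OF M 1] linear_smult[OF 2]\<close>)
qed

end

section \<open>Complements of subspaces\<close>

text \<open>
  By Zorn's lemma there is a maximal subspace \<open>W\<close> with \<open>W \<inter> N = 0\<close>. A vector \<open>x\<close> outside \<open>N + W\<close> could be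
  added to \<open>W\<close>, since a nonzero multiple of \<open>x\<close> plus an element of \<open>W\<close> never lies in \<open>N\<close>; so \<open>W\<close> is a
  complement, and \<open>p\<close> is the projection along it.
\<close>

lemma (in module) linear_projection_onto_submodule:
  assumes "field R" and N: "submodule N R M"
  shows "\<exists>p \<in> linear_maps R M M. (\<forall>x \<in> carrier M. p x \<in> N) \<and> (\<forall>x \<in> N. p x = x)"
proof -
  interpret field R by fact
  have sub: "W \<subseteq> carrier M" "\<zero>\<^bsub>M\<^esub> \<in> W" if "submodule W R M" for W
    using submoduleE[OF that] subgroup.one_closed[OF submodule.axioms(1)[OF that]] by auto
  define A where "A = {W. submodule W R M \<and> W \<inter> N = {\<zero>\<^bsub>M\<^esub>}}"
  have "\<exists>W\<in>A. \<forall>X\<in>A. W \<subseteq> X \<longrightarrow> X = W"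
  proof (rule subset_Zorn_nonempty)
    have "submodule {\<zero>\<^bsub>M\<^esub>} R M" by (rule submoduleI) auto
    then show "A \<noteq> {}" using sub[OF N] unfolding A_def by blast
  next
    fix \<C> assume ne: "\<C> \<noteq> {}" and ch: "subset.chain A \<C>"
    then have sC: "submodule X R M" "X \<inter> N = {\<zero>\<^bsub>M\<^esub>}" if "X \<in> \<C>" for X
      using that unfolding A_def subset.chain_def by auto
    have dir: "\<exists>Z\<in>\<C>. x \<in> Z \<and> y \<in> Z" if "x \<in> \<Union>\<C>" "y \<in> \<Union>\<C>" for x y
      using that ch unfolding subset.chain_def by blast
    have "submodule (\<Union>\<C>) R M"
    proof (rule submoduleI)
      show "\<Union>\<C> \<subseteq> carrier M" using sC(1) sub(1) by blast
      show "\<zero>\<^bsub>M\<^esub> \<in> \<Union>\<C>" using ne sC(1) sub(2) by blast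
      show "\<ominus>\<^bsub>M\<^esub> a \<in> \<Union>\<C>" if "a \<in> \<Union>\<C>" for a
        using that submoduleE(3)[OF sC(1)] by (meson Union_iff)
      show "a \<oplus>\<^bsub>M\<^esub> b \<in> \<Union>\<C>" if "a \<in> \<Union>\<C>" "b \<in> \<Union>\<C>" for a b
        using dir[OF that] submoduleE(5)[OF sC(1)] by (meson Union_iff)
      show "a \<odot>\<^bsub>M\<^esub> x \<in> \<Union>\<C>" if "a \<in> carrier R" "x \<in> \<Union>\<C>" for a x
        using that submoduleE(4)[OF sC(1)] by (meson Union_iff)
    qed
    moreover have "\<Union>\<C> \<inter> N = {\<zero>\<^bsub>M\<^esub>}" using ne sC(2) by blast
    ultimately show "\<Union>\<C> \<in> A" by (simp add: A_def)
  qed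
  then obtain W where "W \<in> A" and max0: "\<forall>X\<in>A. W \<subseteq> X \<longrightarrow> X = W" ..
  then have W: "submodule W R M" "W \<inter> N = {\<zero>\<^bsub>M\<^esub>}" by (simp_all add: A_def)
  have max: "X = W" if "submodule X R M" "X \<inter> N = {\<zero>\<^bsub>M\<^esub>}" "W \<subseteq> X" for X
    using max0 that by (simp add: A_def)
  note NE = submoduleE[OF N] and WE = submoduleE[OF W(1)]
  note Nc[simp] = subsetD[OF sub(1)[OF N]] and Wc[simp] = subsetD[OF sub(1)[OF W(1)]]
  have ex: "\<exists>n\<in>N. x \<ominus>\<^bsub>M\<^esub> n \<in> W" if x: "x \<in> carrier M" for x
  proof (rule ccontr)
    assume no: "\<not> ?thesis"
    \<comment> \<open>The span of \<open>W\<close> and \<open>x\<close> meets \<open>N\<close> trivially, against the maximality of \<open>W\<close>.\<close>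
    define X where "X = {w \<oplus>\<^bsub>M\<^esub> a \<odot>\<^bsub>M\<^esub> x | w a. w \<in> W \<and> a \<in> carrier R}"
    have XI: "w \<oplus>\<^bsub>M\<^esub> a \<odot>\<^bsub>M\<^esub> x \<in> X" if "w \<in> W" "a \<in> carrier R" for w a using that unfolding X_def by blast
    have "submodule X R M"
    proof (rule submoduleI)
      show "X \<subseteq> carrier M" unfolding X_def using x by auto
      show "\<zero>\<^bsub>M\<^esub> \<in> X" using XI[of "\<zero>\<^bsub>M\<^esub>" \<zero>] x sub(2)[OF W(1)] by simp
      show "\<ominus>\<^bsub>M\<^esub> u \<in> X" if "u \<in> X" for u
      proof -
        from that obtain w a where u: "u = w \<oplus>\<^bsub>M\<^esub> a \<odot>\<^bsub>M\<^esub> x" "w \<in> W" "a \<in> carrier R" unfolding X_def by blast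
        then show ?thesis using XI[of "\<ominus>\<^bsub>M\<^esub> w" "\<ominus> a"] x by (simp add: M.minus_add smult_l_minus WE)
      qed
      show "u \<oplus>\<^bsub>M\<^esub> v \<in> X" if uv: "u \<in> X" "v \<in> X" for u v
      proof -
        from uv obtain w a w' a' where u: "u = w \<oplus>\<^bsub>M\<^esub> a \<odot>\<^bsub>M\<^esub> x" "w \<in> W" "a \<in> carrier R"
          "v = w' \<oplus>\<^bsub>M\<^esub> a' \<odot>\<^bsub>M\<^esub> x" "w' \<in> W" "a' \<in> carrier R" unfolding X_def by blast
        then show ?thesis using XI[of "w \<oplus>\<^bsub>M\<^esub> w'" "a \<oplus> a'"] x by (simp add: smult_l_distr WE M.a_ac)
      qed
      show "c \<odot>\<^bsub>M\<^esub> u \<in> X" if uv: "c \<in> carrier R" "u \<in> X" for c u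
      proof -
        from uv obtain w a where u: "u = w \<oplus>\<^bsub>M\<^esub> a \<odot>\<^bsub>M\<^esub> x" "w \<in> W" "a \<in> carrier R" unfolding X_def by blast
        then show ?thesis using XI[of "c \<odot>\<^bsub>M\<^esub> w" "c \<otimes> a"] x uv by (simp add: smult_r_distr smult_assoc1 WE)
      qed
    qed
    moreover have "X \<inter> N = {\<zero>\<^bsub>M\<^esub>}"
    proof -
      have "u = \<zero>\<^bsub>M\<^esub>" if u: "u \<in> X" "u \<in> N" for u
      proof -
        from u obtain w a where ua: "u = w \<oplus>\<^bsub>M\<^esub> a \<odot>\<^bsub>M\<^esub> x" "w \<in> W" "a \<in> carrier R" unfolding X_def by blast
        have "a = \<zero>"
        proof (rule ccontr)
          assume "a \<noteq> \<zero>"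
          then have "a \<in> Units R" using ua field_Units by simp
          then obtain b where b: "b \<in> carrier R" "b \<otimes> a = \<one>" by (auto simp: Units_def)
          have "b \<odot>\<^bsub>M\<^esub> u = b \<odot>\<^bsub>M\<^esub> w \<oplus>\<^bsub>M\<^esub> x"
            using ua b x by (simp add: smult_r_distr smult_assoc1[symmetric])
          then have "x \<ominus>\<^bsub>M\<^esub> b \<odot>\<^bsub>M\<^esub> u = \<ominus>\<^bsub>M\<^esub> (b \<odot>\<^bsub>M\<^esub> w)"
            using ua b x by (simp add: a_minus_def M.minus_add M.a_ac M.r_neg1 M.r_neg2 M.r_neg)
          then show False using no u ua b NE WE by metis
        qed
        then have "u = w" using ua x by simp
        then show ?thesis using W(2) u ua by blast
      qed
      then show ?thesis using \<open>submodule X R M\<close> sub N by blast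
    qed
    moreover have "W \<subseteq> X" using XI[of _ \<zero>] x by auto
    ultimately have "X = W" by (rule max)
    moreover have "x \<in> X" using XI[of "\<zero>\<^bsub>M\<^esub>" \<one>] x sub(2)[OF W(1)] by simp
    moreover have zero_neg: "\<ominus>\<^bsub>M\<^esub> \<zero>\<^bsub>M\<^esub> = \<zero>\<^bsub>M\<^esub>" by (metis M.l_neg M.r_zero M.a_inv_closed M.zero_closed)
    ultimately show False using no x sub(2)[OF N] by (auto dest!: bspec[of _ _ "\<zero>\<^bsub>M\<^esub>"] simp: a_minus_def zero_neg)
  qed
  have cancel: "x \<oplus>\<^bsub>M\<^esub> (y \<oplus>\<^bsub>M\<^esub> \<ominus>\<^bsub>M\<^esub> x) = y" if "x \<in> carrier M" "y \<in> carrier M" for x y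
    using that M.a_lcomm[of x y "\<ominus>\<^bsub>M\<^esub> x"] by (simp add: M.r_neg)
  have uniq: "n = n'" if "n \<in> N" "n' \<in> N" "x \<ominus>\<^bsub>M\<^esub> n \<in> W" "x \<ominus>\<^bsub>M\<^esub> n' \<in> W" "x \<in> carrier M" for n n' x
  proof -
    have "(x \<ominus>\<^bsub>M\<^esub> n) \<oplus>\<^bsub>M\<^esub> \<ominus>\<^bsub>M\<^esub> (x \<ominus>\<^bsub>M\<^esub> n') = n' \<ominus>\<^bsub>M\<^esub> n"
      using that by (simp add: a_minus_def M.minus_add M.a_ac M.r_neg1 M.r_neg2 M.r_neg cancel)
    then have "n' \<ominus>\<^bsub>M\<^esub> n \<in> W \<inter> N"
      using that WE(3,5) NE(3,5) by (metis IntI a_minus_def)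
    then show ?thesis using W(2) that cancel[of n n'] by (simp add: a_minus_def)
  qed
  define p where "p x = (SOME n. n \<in> N \<and> x \<ominus>\<^bsub>M\<^esub> n \<in> W)" for x
  have p: "p x \<in> N" "x \<ominus>\<^bsub>M\<^esub> p x \<in> W" if "x \<in> carrier M" for x
    using someI_ex[OF ex[OF that, unfolded Bex_def]] unfolding p_def by auto
  have pI: "p x = n" if "x \<in> carrier M" "n \<in> N" "x \<ominus>\<^bsub>M\<^esub> n \<in> W" for x n
    by (rule uniq[OF p(1)[OF that(1)] that(2) p(2)[OF that(1)] that(3) that(1)])
  have "p \<in> linear_maps R M M"
  proof (rule linear_mapsI)
    fix x y assume xy: "x \<in> carrier M" "y \<in> carrier M"
    have "x \<oplus>\<^bsub>M\<^esub> y \<ominus>\<^bsub>M\<^esub> (p x \<oplus>\<^bsub>M\<^esub> p y) = (x \<ominus>\<^bsub>M\<^esub> p x) \<oplus>\<^bsub>M\<^esub> (y \<ominus>\<^bsub>M\<^esub> p y)"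
      using xy p by (simp add: a_minus_def M.minus_add M.a_ac)
    then show "p (x \<oplus>\<^bsub>M\<^esub> y) = p x \<oplus>\<^bsub>M\<^esub> p y" using xy p WE NE by (intro pI) auto
  next
    fix a x assume xy: "a \<in> carrier R" "x \<in> carrier M"
    have "a \<odot>\<^bsub>M\<^esub> x \<ominus>\<^bsub>M\<^esub> a \<odot>\<^bsub>M\<^esub> p x = a \<odot>\<^bsub>M\<^esub> (x \<ominus>\<^bsub>M\<^esub> p x)"
      using xy p by (simp add: a_minus_def smult_r_distr smult_r_minus)
    then show "p (a \<odot>\<^bsub>M\<^esub> x) = a \<odot>\<^bsub>M\<^esub> p x" using xy p WE NE by (intro pI) auto
  qed (simp add: p)
  moreover have "p x = x" if "x \<in> N" for x
    using that sub(2)[OF W(1)] by (intro pI) (auto simp: a_minus_def M.r_neg)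
  ultimately show ?thesis using p by blast
qed

section \<open>Algebras\<close>

lemma assoc_algebraI:
  assumes M: "module K A" and b: "monoid.mult A \<in> bilinear_maps K A A A"
    and one: "\<one>\<^bsub>A\<^esub> \<in> carrier A"
    and assoc: "\<And>x y z. \<lbrakk>x \<in> carrier A; y \<in> carrier A; z \<in> carrier A\<rbrakk> \<Longrightarrow> (x \<otimes>\<^bsub>A\<^esub> y) \<otimes>\<^bsub>A\<^esub> z = x \<otimes>\<^bsub>A\<^esub> (y \<otimes>\<^bsub>A\<^esub> z)"
    and unit: "\<And>x. x \<in> carrier A \<Longrightarrow> \<one>\<^bsub>A\<^esub> \<otimes>\<^bsub>A\<^esub> x = x" "\<And>x. x \<in> carrier A \<Longrightarrow> x \<otimes>\<^bsub>A\<^esub> \<one>\<^bsub>A\<^esub> = x"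
  shows "assoc_algebra K A"
proof -
  interpret module K A by fact
  note l = bilinear_left[OF b] and r = bilinear_right[OF b]
  show ?thesis
  proof (intro assoc_algebra.intro M ringI assoc_algebra_axioms.intro monoidI)
    show "abelian_group A" ..
  qed (simp_all add: one assoc unit bilinear_closed[OF b] linear_add[OF l] linear_add[OF r] linear_smult[OF l] linear_smult[OF r])
qed

context assoc_algebra
begin

lemma mult_bilinear: "monoid.mult A \<in> bilinear_maps K A A A"
  by (intro bilinearI linear_mapsI)
    (simp_all add: l_distr r_distr smult_mult_left smult_mult_right)

lemmas mult_linear_left = linear_bilinear_left[OF mult_bilinear]
lemmas mult_linear_right = linear_bilinear_right[OF mult_bilinear]
lemmas mult_bilinear_comp = bilinear_comp[OF mult_bilinear]

end

definition opposite_algebra :: "('k, 'a, 'x) module_scheme \<Rightarrow> ('k, 'a, 'x) module_scheme" where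
  "opposite_algebra A = A\<lparr>monoid.mult := (\<lambda>x y. y \<otimes>\<^bsub>A\<^esub> x)\<rparr>"

lemma opposite_algebra_simps [simp]:
  "carrier (opposite_algebra A) = carrier A" "one (opposite_algebra A) = one A"
  "monoid.mult (opposite_algebra A) = (\<lambda>x y. y \<otimes>\<^bsub>A\<^esub> x)"
  "ring.zero (opposite_algebra A) = ring.zero A" "ring.add (opposite_algebra A) = ring.add A"
  "smult (opposite_algebra A) = smult A"
  by (simp_all add: opposite_algebra_def)

lemma linear_maps_opposite [simp]:
  "linear_maps K V (opposite_algebra A) = linear_maps K V A"
  "linear_maps K (opposite_algebra A) V = linear_maps K A V"
  by (simp_all add: linear_maps_def hom_def)

lemma (in assoc_algebra) opposite_assoc_algebra: "assoc_algebra K (opposite_algebra A)"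
proof (rule assoc_algebraI)
  show "module K (opposite_algebra A)"
    by (intro moduleI abelian_groupI)
      (auto simp: R.is_cring smult_l_distr smult_r_distr smult_assoc1 a_ac intro: bexI[of _ "\<ominus>\<^bsub>A\<^esub> _"] l_neg)
  show "monoid.mult (opposite_algebra A) \<in> bilinear_maps K (opposite_algebra A) (opposite_algebra A) (opposite_algebra A)"
    using bilinear_flip[OF mult_bilinear] by (simp add: bilinear_maps_def)
qed (auto simp: m_assoc)

locale tensor_algebras = A: assoc_algebra K A + B: assoc_algebra K B for K (structure) and A and B
begin

sublocale tensor_pair K A B ..

interpretation T: module K "tensor K A B" by (rule tensor_module)

lemma tensor_mult_eq:
  "X \<otimes>\<^bsub>tensor K A B\<^esub> Y = tensor_lift (add_monoid (tensor K A B))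
     (\<lambda>a b. tensor_lift (add_monoid (tensor K A B)) (\<lambda>c d. pure_tensor K A B (a \<otimes>\<^bsub>A\<^esub> c) (b \<otimes>\<^bsub>B\<^esub> d)) Y) X"
  by (subst (1 2) tensor_lift_tensor_group[symmetric]) (simp add: tensor_def)

lemma tensor_mult_inner_bilinear:
  assumes "a \<in> carrier A" "b \<in> carrier B"
  shows "(\<lambda>c d. pure_tensor K A B (a \<otimes>\<^bsub>A\<^esub> c) (b \<otimes>\<^bsub>B\<^esub> d)) \<in> bilinear_maps K A B (tensor K A B)"
  by (rule bilinear_comp[OF pure_bilinear A.mult_linear_right[OF linear_id assms(1)] B.mult_linear_right[OF linear_id assms(2)]])

lemma tensor_mult_outer_bilinear:
  assumes Y: "Y \<in> carrier (tensor K A B)"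
  shows "(\<lambda>a b. tensor_lift (add_monoid (tensor K A B)) (\<lambda>c d. pure_tensor K A B (a \<otimes>\<^bsub>A\<^esub> c) (b \<otimes>\<^bsub>B\<^esub> d)) Y)
     \<in> bilinear_maps K A B (tensor K A B)"
proof (rule bilinearI; rule tensor_lift_param[OF _ tensor_module tensor_mult_inner_bilinear _ Y])
  fix b v w assume "b \<in> carrier B" "v \<in> carrier A" "w \<in> carrier B"
  then show "(\<lambda>a. pure_tensor K A B (a \<otimes>\<^bsub>A\<^esub> v) (b \<otimes>\<^bsub>B\<^esub> w)) \<in> linear_maps K A (tensor K A B)"
    by (intro linear_bilinear_left[OF pure_bilinear] A.mult_linear_left linear_id) auto
next
  fix b v w assume "b \<in> carrier A" "v \<in> carrier A" "w \<in> carrier B"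
  then show "(\<lambda>a. pure_tensor K A B (b \<otimes>\<^bsub>A\<^esub> v) (a \<otimes>\<^bsub>B\<^esub> w)) \<in> linear_maps K B (tensor K A B)"
    by (intro linear_bilinear_right[OF pure_bilinear] B.mult_linear_left linear_id) auto
qed (auto intro: A.module_axioms B.module_axioms)

lemma tensor_mult_pure_left:
  assumes "a \<in> carrier A" "b \<in> carrier B" "Y \<in> carrier (tensor K A B)"
  shows "pure_tensor K A B a b \<otimes>\<^bsub>tensor K A B\<^esub> Y =
    tensor_lift (add_monoid (tensor K A B)) (\<lambda>c d. pure_tensor K A B (a \<otimes>\<^bsub>A\<^esub> c) (b \<otimes>\<^bsub>B\<^esub> d)) Y"
  unfolding tensor_mult_eq by (rule tensor_lift_pure[OF tensor_module tensor_mult_outer_bilinear[OF assms(3)] assms(1,2)])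

lemma tensor_mult_pure:
  assumes "a \<in> carrier A" "b \<in> carrier B" "c \<in> carrier A" "d \<in> carrier B"
  shows "pure_tensor K A B a b \<otimes>\<^bsub>tensor K A B\<^esub> pure_tensor K A B c d
    = pure_tensor K A B (a \<otimes>\<^bsub>A\<^esub> c) (b \<otimes>\<^bsub>B\<^esub> d)"
  using assms by (simp add: tensor_mult_pure_left pure_closed tensor_lift_pure[OF tensor_module tensor_mult_inner_bilinear])

lemma tensor_mult_bilinear:
  "monoid.mult (tensor K A B) \<in> bilinear_maps K (tensor K A B) (tensor K A B) (tensor K A B)"
proof (rule bilinearI)
  fix Y assume Y: "Y \<in> carrier (tensor K A B)"
  show "(\<lambda>X. X \<otimes>\<^bsub>tensor K A B\<^esub> Y) \<in> linear_maps K (tensor K A B) (tensor K A B)"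
    unfolding tensor_mult_eq by (rule tensor_lift_linear[OF tensor_module tensor_mult_outer_bilinear[OF Y]])
  show "(\<lambda>X. Y \<otimes>\<^bsub>tensor K A B\<^esub> X) \<in> linear_maps K (tensor K A B) (tensor K A B)"
    unfolding tensor_mult_eq
    by (rule tensor_lift_param[OF tensor_module tensor_module tensor_mult_outer_bilinear _ Y])
      (simp_all add: tensor_lift_linear[OF tensor_module tensor_mult_inner_bilinear])
qed

text \<open>
  Both sides of each law are linear in every argument, so it suffices to compare them on pure
  tensors.
\<close>

lemma tensor_assoc_algebra: "assoc_algebra K (tensor K A B)"
proof (rule assoc_algebraI[OF tensor_module tensor_mult_bilinear])
  let ?T = "tensor K A B"
  note b = tensor_mult_bilinear and l = linear_bilinear_left[OF tensor_mult_bilinear] and r = linear_bilinear_right[OF tensor_mult_bilinear]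
  note cl = bilinear_closed[OF b]
  have one: "\<one>\<^bsub>?T\<^esub> = pure_tensor K A B \<one>\<^bsub>A\<^esub> \<one>\<^bsub>B\<^esub>" by (simp add: tensor_def)
  then show 1: "\<one>\<^bsub>?T\<^esub> \<in> carrier ?T" by (simp add: pure_closed)
  show "\<one>\<^bsub>?T\<^esub> \<otimes>\<^bsub>?T\<^esub> x = x" if x: "x \<in> carrier ?T" for x
    by (rule tensor_linear_eqI[OF tensor_module r[OF linear_id 1] linear_id _ x]) (simp add: one tensor_mult_pure)
  show "x \<otimes>\<^bsub>?T\<^esub> \<one>\<^bsub>?T\<^esub> = x" if x: "x \<in> carrier ?T" for x
    by (rule tensor_linear_eqI[OF tensor_module l[OF linear_id 1] linear_id _ x]) (simp add: one tensor_mult_pure)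
  show "x \<otimes>\<^bsub>?T\<^esub> y \<otimes>\<^bsub>?T\<^esub> z = x \<otimes>\<^bsub>?T\<^esub> (y \<otimes>\<^bsub>?T\<^esub> z)"
    if x: "x \<in> carrier ?T" and y: "y \<in> carrier ?T" and z: "z \<in> carrier ?T" for x y z
  proof (rule tensor_linear_eqI[OF tensor_module l[OF l[OF linear_id y] z] l[OF linear_id cl[OF y z]] _ x])
    fix a b assume ab: "a \<in> carrier A" "b \<in> carrier B"
    then have p: "pure_tensor K A B a b \<in> carrier ?T" by (simp add: pure_closed)
    show "pure_tensor K A B a b \<otimes>\<^bsub>?T\<^esub> y \<otimes>\<^bsub>?T\<^esub> z = pure_tensor K A B a b \<otimes>\<^bsub>?T\<^esub> (y \<otimes>\<^bsub>?T\<^esub> z)"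
    proof (rule tensor_linear_eqI[OF tensor_module l[OF r[OF linear_id p] z] r[OF l[OF linear_id z] p] _ y])
      fix c d assume cd: "c \<in> carrier A" "d \<in> carrier B"
      then have q: "pure_tensor K A B c d \<in> carrier ?T" by (simp add: pure_closed)
      show "pure_tensor K A B a b \<otimes>\<^bsub>?T\<^esub> pure_tensor K A B c d \<otimes>\<^bsub>?T\<^esub> z = pure_tensor K A B a b \<otimes>\<^bsub>?T\<^esub> (pure_tensor K A B c d \<otimes>\<^bsub>?T\<^esub> z)"
        by (rule tensor_linear_eqI[OF tensor_module r[OF linear_id cl[OF p q]] r[OF r[OF linear_id q] p] _ z])
          (use ab cd in \<open>simp add: tensor_mult_pure A.m_assoc B.m_assoc\<close>)
    qed
  qed
qed

end

section \<open>Sweedler sums\<close>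

text \<open>
  Sweedler's \<open>\<Sum> \<phi> x\<^sub>1 x\<^sub>2\<close>, computed in \<open>M\<close>. Iterated sums are written by nesting: \<open>\<Sum> \<phi> x\<^sub>1 x\<^sub>2 x\<^sub>3\<close>
  is the sum over \<open>a\<close>, \<open>b\<close> for \<open>x\<close> of the sum over \<open>c\<close>, \<open>d\<close> for \<open>b\<close> of \<open>\<phi> a c d\<close>.
\<close>

definition sweedler ::
  "('k, 'c, 'x) bialg_scheme \<Rightarrow> ('k, 'a, 'y) module_scheme \<Rightarrow> ('c \<Rightarrow> 'c \<Rightarrow> 'a) \<Rightarrow> 'c \<Rightarrow> 'a" where
  "sweedler C M \<phi> x = tensor_lift (add_monoid M) \<phi> (comult C x)"

lemma convolution_sweedler: "convolution C A f g = sweedler C A (\<lambda>c d. f c \<otimes>\<^bsub>A\<^esub> g d)"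
  by (intro ext) (simp add: convolution_def sweedler_def)

text \<open>
  A linear subspace is coclosed iff it is a subcoalgebra. Subspaces are not required, because then
  unions and sets of products of coclosed sets are again coclosed, and the largest coclosed set
  with a given property turns out to be a subspace.
\<close>

definition coclosed :: "('k, 'm) ring_scheme \<Rightarrow> ('k, 'c, 'x) bialg_scheme \<Rightarrow> 'c set \<Rightarrow> bool" where
  "coclosed K C X \<longleftrightarrow> X \<subseteq> carrier C \<and> (\<forall>x\<in>X. comult C x \<in> tensor_span K C C X X)"

definition trilinear_maps ::
  "('k, 'm) ring_scheme \<Rightarrow> ('k, 'v, 'x) module_scheme \<Rightarrow> ('k, 'u, 'z) module_scheme \<Rightarrow> ('v \<Rightarrow> 'v \<Rightarrow> 'v \<Rightarrow> 'u) set" where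
  "trilinear_maps K V U = {\<phi>. (\<forall>a\<in>carrier V. \<phi> a \<in> bilinear_maps K V V U) \<and>
      (\<forall>b\<in>carrier V. \<forall>c\<in>carrier V. (\<lambda>a. \<phi> a b c) \<in> linear_maps K V U)}"

lemma trilinearI:
  assumes "\<And>b c. b \<in> carrier V \<Longrightarrow> c \<in> carrier V \<Longrightarrow> (\<lambda>a. \<phi> a b c) \<in> linear_maps K V U"
    "\<And>a c. a \<in> carrier V \<Longrightarrow> c \<in> carrier V \<Longrightarrow> (\<lambda>b. \<phi> a b c) \<in> linear_maps K V U"
    "\<And>a b. a \<in> carrier V \<Longrightarrow> b \<in> carrier V \<Longrightarrow> (\<lambda>c. \<phi> a b c) \<in> linear_maps K V U"
  shows "\<phi> \<in> trilinear_maps K V U"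
  using assms by (auto simp: trilinear_maps_def bilinear_maps_def)

lemma trilinearD:
  assumes "\<phi> \<in> trilinear_maps K V U"
  shows "\<And>b c. b \<in> carrier V \<Longrightarrow> c \<in> carrier V \<Longrightarrow> (\<lambda>a. \<phi> a b c) \<in> linear_maps K V U"
    "\<And>a c. a \<in> carrier V \<Longrightarrow> c \<in> carrier V \<Longrightarrow> (\<lambda>b. \<phi> a b c) \<in> linear_maps K V U"
    "\<And>a b. a \<in> carrier V \<Longrightarrow> b \<in> carrier V \<Longrightarrow> (\<lambda>c. \<phi> a b c) \<in> linear_maps K V U"
  using assms by (auto simp: trilinear_maps_def bilinear_maps_def)

lemma trilinear_bilinear:
  assumes "\<phi> \<in> trilinear_maps K V U" 
  shows "a \<in> carrier V \<Longrightarrow> \<phi> a \<in> bilinear_maps K V V U"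
    and "c \<in> carrier V \<Longrightarrow> (\<lambda>a b. \<phi> a b c) \<in> bilinear_maps K V V U"
  using assms by (auto simp: trilinear_maps_def bilinear_maps_def)

text \<open>
  The part of \<open>coalgebra\<close> which is available while the other coalgebra laws are still being proved.
\<close>

locale comultiplication = module K C for K (structure) and C (structure) +
  assumes comult_is_linear: "comult C \<in> linear_maps K C (tensor K C C)"
begin

sublocale CC: tensor_pair K C C ..

lemma comult_closed: "x \<in> carrier C \<Longrightarrow> comult C x \<in> carrier (tensor K C C)"
  by (rule lin_map[OF comult_is_linear])

context
  fixes M :: "('a, 'n, 'y) module_scheme"
  assumes M: "module K M"
begin

lemma sweedler_linear:
  "\<phi> \<in> bilinear_maps K C C M \<Longrightarrow> sweedler C M \<phi> \<in> linear_maps K C M"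
  using linear_comp[OF CC.tensor_lift_linear[OF M] comult_is_linear] by (simp add: sweedler_def[abs_def])

text \<open>
  With \<open>\<phi> a = (\<lambda>c d. \<psi> a c d)\<close> this yields the linearity in \<open>a\<close> of a sum that is nested in another one.
\<close>

lemma sweedler_linear_param:
  assumes "module K A" 
    and "\<And>a. a \<in> carrier A \<Longrightarrow> \<phi> a \<in> bilinear_maps K C C M"
    and "\<And>v w. v \<in> carrier C \<Longrightarrow> w \<in> carrier C \<Longrightarrow> (\<lambda>a. \<phi> a v w) \<in> linear_maps K A M"
    and "x \<in> carrier C"
  shows "(\<lambda>a. sweedler C M (\<phi> a) x) \<in> linear_maps K A M"
  unfolding sweedler_def by (rule CC.tensor_lift_param[OF assms(1) M assms(2,3) comult_closed[OF assms(4)]])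

lemma sweedler_post:
  assumes N: "module K N" and h: "h \<in> linear_maps K M N" and \<phi>: "\<phi> \<in> bilinear_maps K C C M" and x: "x \<in> carrier C"
  shows "h (sweedler C M \<phi> x) = sweedler C N (\<lambda>a b. h (\<phi> a b)) x"
  unfolding sweedler_def
  by (rule CC.tensor_linear_eqI[OF N linear_comp[OF h CC.tensor_lift_linear[OF M \<phi>]]
        CC.tensor_lift_linear[OF N bilinear_post[OF h \<phi>]] _ comult_closed[OF x]])
    (simp add: CC.tensor_lift_pure[OF M \<phi>] CC.tensor_lift_pure[OF N bilinear_post[OF h \<phi>]])

lemma sweedler_in_subgroup:
  assumes "coclosed K C X" "\<phi> \<in> bilinear_maps K C C M" "subgroup B (add_monoid M)"
    and "\<And>a b. a \<in> X \<Longrightarrow> b \<in> X \<Longrightarrow> \<phi> a b \<in> B" and "x \<in> X"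
  shows "sweedler C M \<phi> x \<in> B"
proof -
  have X: "X \<subseteq> carrier C" and \<Delta>: "comult C x \<in> tensor_span K C C X X"
    using assms(1,5) by (auto simp: coclosed_def)
  show ?thesis unfolding sweedler_def
    by (rule CC.tensor_span_linear[OF M CC.tensor_lift_linear[OF M assms(2)] assms(3) X X _ \<Delta>])
      (use assms(2,4) X in \<open>auto simp: CC.tensor_lift_pure[OF M] subset_iff\<close>)
qed

text \<open>
  If \<open>x\<close> lies in a subcoalgebra, the components \<open>x\<^sub>1\<close> and \<open>x\<^sub>2\<close> may be assumed to lie there, too.
\<close>

lemma sweedler_cong_coclosed:
  assumes "coclosed K C X" "\<phi> \<in> bilinear_maps K C C M" "\<psi> \<in> bilinear_maps K C C M"
    and "\<And>a b. a \<in> X \<Longrightarrow> b \<in> X \<Longrightarrow> \<phi> a b = \<psi> a b" and "x \<in> X"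
  shows "sweedler C M \<phi> x = sweedler C M \<psi> x"
proof -
  have X: "X \<subseteq> carrier C" and \<Delta>: "comult C x \<in> tensor_span K C C X X"
    using assms(1,5) by (auto simp: coclosed_def)
  show ?thesis unfolding sweedler_def
    by (rule CC.tensor_span_eqI[OF M CC.tensor_lift_linear[OF M assms(2)] CC.tensor_lift_linear[OF M assms(3)] X X _ \<Delta>])
      (use assms(2-4) X in \<open>auto simp: CC.tensor_lift_pure[OF M] subset_iff\<close>)
qed

end

lemma coclosed_carrier: "coclosed K C (carrier C)"
  by (simp add: coclosed_def CC.tensor_span_carrier comult_closed)

lemma sweedler_cong:
  assumes "module K M" "\<phi> \<in> bilinear_maps K C C M"
    and "\<And>a b. a \<in> carrier C \<Longrightarrow> b \<in> carrier C \<Longrightarrow> \<psi> a b = \<phi> a b" and "x \<in> carrier C"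
  shows "sweedler C M \<psi> x = sweedler C M \<phi> x"
proof -
  have "(\<lambda>v. \<psi> v w) \<in> linear_maps K C M" if "w \<in> carrier C" for w
    by (rule linear_cong[OF module_axioms bilinear_left[OF assms(2) that]]) (simp add: assms(3) that)
  moreover have "(\<lambda>w. \<psi> v w) \<in> linear_maps K C M" if "v \<in> carrier C" for v
    by (rule linear_cong[OF module_axioms bilinear_right[OF assms(2) that]]) (simp add: assms(3) that)
  ultimately have "\<psi> \<in> bilinear_maps K C C M" by (rule bilinearI)
  then show ?thesis by (rule sweedler_cong_coclosed[OF assms(1) coclosed_carrier _ assms(2,3,4)])
qed

lemma sweedler_pure: "x \<in> carrier C \<Longrightarrow> sweedler C (tensor K C C) (pure_tensor K C C) x = comult C x"
  unfolding sweedler_def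
  by (rule CC.tensor_linear_eqI[OF CC.tensor_module CC.tensor_lift_linear[OF CC.tensor_module CC.pure_bilinear] linear_id _ comult_closed])
    (simp_all add: CC.tensor_lift_pure[OF CC.tensor_module CC.pure_bilinear])

lemma trilinear_sweedler_right:
  assumes M: "module K M" and \<phi>: "\<phi> \<in> trilinear_maps K C M"
  shows "(\<lambda>a b. sweedler C M (\<phi> a) b) \<in> bilinear_maps K C C M"
  using trilinear_bilinear[OF \<phi>] trilinearD[OF \<phi>]
  by (intro bilinearI sweedler_linear_param[OF M module_axioms] sweedler_linear[OF M]) auto

lemma trilinear_sweedler_left:
  assumes M: "module K M" and \<phi>: "\<phi> \<in> trilinear_maps K C M"
  shows "(\<lambda>a b. sweedler C M (\<lambda>c d. \<phi> c d b) a) \<in> bilinear_maps K C C M"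
  using trilinear_bilinear[OF \<phi>] trilinearD[OF \<phi>]
  by (intro bilinearI sweedler_linear_param[OF M module_axioms] sweedler_linear[OF M]) auto

sublocale C_CC: tensor_pair K C "tensor K C C"
  by (simp add: tensor_pair_def module_axioms CC.tensor_module)

sublocale CC_C: tensor_pair K "tensor K C C" C
  by (simp add: tensor_pair_def module_axioms CC.tensor_module)

abbreviation "C3 \<equiv> tensor K C (tensor K C C)"
abbreviation "pure3 \<equiv> (\<lambda>a b c. pure_tensor K C (tensor K C C) a (pure_tensor K C C b c))"

lemma pure3_trilinear: "pure3 \<in> trilinear_maps K C C3"
  by (intro trilinearI linear_bilinear_left[OF C_CC.pure_bilinear] linear_bilinear_right[OF C_CC.pure_bilinear]
     linear_bilinear_left[OF CC.pure_bilinear] linear_bilinear_right[OF CC.pure_bilinear] linear_id)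
   (auto simp: CC.pure_closed)

lemma comult_right_sweedler:
  "tensor_map K C (tensor K C C) (\<lambda>c. c) (comult C) (comult C x) =
     sweedler C C3 (\<lambda>a b. pure_tensor K C (tensor K C C) a (comult C b)) x"
  by (simp add: tensor_map_eq sweedler_def)

text \<open>
  Both sides of the coassociativity law become iterated Sweedler sums of \<open>a \<otimes> (b \<otimes> c)\<close>, here the left one.
  The equality of these two sums is the special case of \<open>sweedler_coassoc\<close> from which the general
  case follows.
\<close>

lemma comult_left_sweedler:
  assumes x: "x \<in> carrier C"
  shows "tensor_assoc K C C C (tensor_map K (tensor K C C) C (comult C) (\<lambda>c. c) (comult C x))
    = sweedler C C3 (\<lambda>a b. sweedler C C3 (\<lambda>c d. pure3 c d b) a) x"
proof -
  note M3 = C_CC.tensor_module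
  have b1: "(\<lambda>u v. pure3 u v w) \<in> bilinear_maps K C C C3" if "w \<in> carrier C" for w
    by (rule trilinear_bilinear(2)[OF pure3_trilinear that])
  have b2: "(\<lambda>X w. tensor_lift (add_monoid C3) (\<lambda>u v. pure3 u v w) X) \<in> bilinear_maps K (tensor K C C) C C3"
    using b1 trilinearD[OF pure3_trilinear]
    by (intro bilinearI CC.tensor_lift_linear[OF M3] CC.tensor_lift_param[OF module_axioms M3]) auto
  have eq: "tensor_assoc K C C C = tensor_lift (add_monoid C3) (\<lambda>X w. tensor_lift (add_monoid C3) (\<lambda>u v. pure3 u v w) X)"
    by (simp add: tensor_assoc_def tensor_lift_tensor_group)
  have lin: "tensor_assoc K C C C \<in> linear_maps K (tensor K (tensor K C C) C) C3"
    unfolding eq by (rule CC_C.tensor_lift_linear[OF M3 b2])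
  have b3: "(\<lambda>a b. pure_tensor K (tensor K C C) C (comult C a) b) \<in> bilinear_maps K C C (tensor K (tensor K C C) C)"
    by (rule bilinear_comp[OF CC_C.pure_bilinear comult_is_linear linear_id])
  have "tensor_assoc K C C C (tensor_map K (tensor K C C) C (comult C) (\<lambda>c. c) (comult C x))
     = tensor_assoc K C C C (sweedler C (tensor K (tensor K C C) C) (\<lambda>a b. pure_tensor K (tensor K C C) C (comult C a) b) x)"
    by (simp add: tensor_map_eq sweedler_def)
  also have "\<dots> = sweedler C C3 (\<lambda>a b. tensor_assoc K C C C (pure_tensor K (tensor K C C) C (comult C a) b)) x"
    by (rule sweedler_post[OF CC_C.tensor_module M3 lin b3 x])
  also have "\<dots> = sweedler C C3 (\<lambda>a b. sweedler C C3 (\<lambda>c d. pure3 c d b) a) x"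
    by (rule sweedler_cong[OF M3 trilinear_sweedler_left[OF M3 pure3_trilinear] _ x])
      (simp add: eq CC_C.tensor_lift_pure[OF M3 b2] comult_closed sweedler_def)
  finally show ?thesis .
qed

end

context coalgebra
begin

sublocale comultiplication K C
  by unfold_locales (rule comult_linear)

text \<open>
  Every trilinear map factors through \<open>C \<otimes> (C \<otimes> C)\<close>; apply the factoring linear map to the
  coassociativity law.
\<close>

lemma sweedler_coassoc:
  assumes M: "module K M" and \<phi>: "\<phi> \<in> trilinear_maps K C M" and x: "x \<in> carrier C"
  shows "sweedler C M (\<lambda>a b. sweedler C M (\<lambda>c d. \<phi> c d b) a) x = sweedler C M (\<lambda>a b. sweedler C M (\<lambda>c d. \<phi> a c d) b) x"
proof -
  note M3 = C_CC.tensor_module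
  define \<Phi> where "\<Phi> = tensor_lift (add_monoid M) (\<lambda>a Y. tensor_lift (add_monoid M) (\<phi> a) Y)"
  have b: "(\<lambda>a Y. tensor_lift (add_monoid M) (\<phi> a) Y) \<in> bilinear_maps K C (tensor K C C) M"
    using trilinear_bilinear[OF \<phi>] trilinearD[OF \<phi>]
    by (intro bilinearI CC.tensor_lift_linear[OF M] CC.tensor_lift_param[OF module_axioms M]) auto
  have \<Phi>: "\<Phi> \<in> linear_maps K C3 M" unfolding \<Phi>_def by (rule C_CC.tensor_lift_linear[OF M b])
  have pure: "\<Phi> (pure_tensor K C (tensor K C C) a Y) = tensor_lift (add_monoid M) (\<phi> a) Y"
    if "a \<in> carrier C" "Y \<in> carrier (tensor K C C)" for a Y
    unfolding \<Phi>_def by (rule C_CC.tensor_lift_pure[OF M b that])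
  have pure3: "\<Phi> (pure3 a c d) = \<phi> a c d" if "a \<in> carrier C" "c \<in> carrier C" "d \<in> carrier C" for a c d
    using that by (simp add: pure CC.pure_closed CC.tensor_lift_pure[OF M trilinear_bilinear(1)[OF \<phi>]])
  have eq: "sweedler C C3 (\<lambda>a b. sweedler C C3 (\<lambda>c d. pure3 c d b) a) x
     = sweedler C C3 (\<lambda>a b. pure_tensor K C (tensor K C C) a (comult C b)) x"
    using coassoc[OF x] comult_left_sweedler[OF x] comult_right_sweedler by simp
  have "\<Phi> (sweedler C C3 (\<lambda>a b. sweedler C C3 (\<lambda>c d. pure3 c d b) a) x)
      = sweedler C M (\<lambda>a b. \<Phi> (sweedler C C3 (\<lambda>c d. pure3 c d b) a)) x"
    by (rule sweedler_post[OF M3 M \<Phi> trilinear_sweedler_left[OF M3 pure3_trilinear] x])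
  also have "\<dots> = sweedler C M (\<lambda>a b. sweedler C M (\<lambda>c d. \<phi> c d b) a) x"
  proof (rule sweedler_cong[OF M trilinear_sweedler_left[OF M \<phi>] _ x])
    fix a b assume a: "a \<in> carrier C" and b: "b \<in> carrier C"
    have "\<Phi> (sweedler C C3 (\<lambda>c d. pure3 c d b) a) = sweedler C M (\<lambda>c d. \<Phi> (pure3 c d b)) a"
      by (rule sweedler_post[OF M3 M \<Phi> trilinear_bilinear(2)[OF pure3_trilinear b] a])
    also have "\<dots> = sweedler C M (\<lambda>c d. \<phi> c d b) a"
      by (rule sweedler_cong[OF M trilinear_bilinear(2)[OF \<phi> b] _ a]) (simp add: pure3 b)
    finally show "\<Phi> (sweedler C C3 (\<lambda>c d. pure3 c d b) a) = sweedler C M (\<lambda>c d. \<phi> c d b) a" .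
  qed
  finally have L: "\<Phi> (sweedler C C3 (\<lambda>a b. sweedler C C3 (\<lambda>c d. pure3 c d b) a) x) = \<dots>" .
  have "\<Phi> (sweedler C C3 (\<lambda>a b. pure_tensor K C (tensor K C C) a (comult C b)) x)
     = sweedler C M (\<lambda>a b. \<Phi> (pure_tensor K C (tensor K C C) a (comult C b))) x"
    by (rule sweedler_post[OF M3 M \<Phi> bilinear_comp[OF C_CC.pure_bilinear linear_id comult_linear] x])
  also have "\<dots> = sweedler C M (\<lambda>a b. sweedler C M (\<phi> a) b) x"
    by (rule sweedler_cong[OF M trilinear_sweedler_right[OF M \<phi>] _ x]) (simp add: pure comult_closed sweedler_def)
  finally show ?thesis using L eq by simp
qed

lemma counit_closed: "x \<in> carrier C \<Longrightarrow> counit C x \<in> carrier K"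
  using lin_map[OF counit_linear] by (simp add: regular_module_def)

lemma counit_smult_linear:
  assumes M: "module K M" and u: "u \<in> carrier M"
  shows "(\<lambda>x. counit C x \<odot>\<^bsub>M\<^esub> u) \<in> linear_maps K C M"
proof -
  interpret M: module K M by fact
  show ?thesis
    using u linear_add[OF counit_linear] linear_smult[OF counit_linear]
    by (intro linear_mapsI) (simp_all add: counit_closed regular_module_def M.smult_l_distr M.smult_assoc1)
qed

lemma counit_smult_bilinear:
  assumes M: "module K M" and h: "h \<in> linear_maps K C M"
  shows "(\<lambda>a b. counit C a \<odot>\<^bsub>M\<^esub> h b) \<in> bilinear_maps K C C M"
proof -
  interpret M: module K M by fact
  show ?thesis
    using h
    by (intro bilinearI counit_smult_linear[OF M] lin_map[OF h] linear_mapsI)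
     (simp_all add: counit_closed lin_map linear_add[OF h] linear_smult[OF h] M.smult_r_distr M.smult_assoc1[symmetric] R.m_comm)
qed

lemma sweedler_counit_left:
  assumes M: "module K M" and h: "h \<in> linear_maps K C M" and x: "x \<in> carrier C"
  shows "sweedler C M (\<lambda>a b. counit C a \<odot>\<^bsub>M\<^esub> h b) x = h x"
proof -
  note bC = counit_smult_bilinear[OF module_axioms linear_id]
  have "h x = h (sweedler C C (\<lambda>a b. counit C a \<odot>\<^bsub>C\<^esub> b) x)"
    using counit_left[OF x] by (simp add: sweedler_def)
  also have "\<dots> = sweedler C M (\<lambda>a b. h (counit C a \<odot>\<^bsub>C\<^esub> b)) x"
    by (rule sweedler_post[OF module_axioms M h bC x])
  also have "\<dots> = sweedler C M (\<lambda>a b. counit C a \<odot>\<^bsub>M\<^esub> h b) x"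
    by (rule sweedler_cong[OF M counit_smult_bilinear[OF M h] _ x]) (simp add: counit_closed linear_smult[OF h])
  finally show ?thesis by simp
qed

lemma sweedler_counit_right:
  assumes M: "module K M" and h: "h \<in> linear_maps K C M" and x: "x \<in> carrier C"
  shows "sweedler C M (\<lambda>a b. counit C b \<odot>\<^bsub>M\<^esub> h a) x = h x"
proof -
  note bC = bilinear_flip[OF counit_smult_bilinear[OF module_axioms linear_id]]
  have "h x = h (sweedler C C (\<lambda>a b. counit C b \<odot>\<^bsub>C\<^esub> a) x)"
    using counit_right[OF x] by (simp add: sweedler_def)
  also have "\<dots> = sweedler C M (\<lambda>a b. h (counit C b \<odot>\<^bsub>C\<^esub> a)) x"
    by (rule sweedler_post[OF module_axioms M h bC x])
  also have "\<dots> = sweedler C M (\<lambda>a b. counit C b \<odot>\<^bsub>M\<^esub> h a) x"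
    by (rule sweedler_cong[OF M bilinear_flip[OF counit_smult_bilinear[OF M h]] _ x]) (simp add: counit_closed linear_smult[OF h])
  finally show ?thesis by simp
qed

end

section \<open>Convolution\<close>

locale convolution_pair = C: coalgebra K C + A: assoc_algebra K A for K and C and A (structure)
begin

lemma convolution_bilinear:
  assumes "f \<in> linear_maps K C A" "g \<in> linear_maps K C A"
  shows "(\<lambda>c d. f c \<otimes> g d) \<in> bilinear_maps K C C A"
  by (rule A.mult_bilinear_comp[OF assms])

lemma convolution_linear:
  assumes "f \<in> linear_maps K C A" "g \<in> linear_maps K C A"
  shows "convolution C A f g \<in> linear_maps K C A"
  unfolding convolution_sweedler by (rule C.sweedler_linear[OF A.module_axioms convolution_bilinear[OF assms]])

lemma convolution_trilinear:
  assumes f: "f \<in> linear_maps K C A" and g: "g \<in> linear_maps K C A" and h: "h \<in> linear_maps K C A"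
  shows "(\<lambda>a c d. f a \<otimes> (g c \<otimes> h d)) \<in> trilinear_maps K C A"
  using assms by (intro trilinearI A.mult_linear_left A.mult_linear_right) (simp_all add: lin_map)

lemma convolution_nested:
  assumes f: "f \<in> linear_maps K C A" and g: "g \<in> linear_maps K C A" and h: "h \<in> linear_maps K C A"
    and x: "x \<in> carrier C"
  shows "convolution C A f (convolution C A g h) x =
    sweedler C A (\<lambda>a b. sweedler C A (\<lambda>c d. f a \<otimes> (g c \<otimes> h d)) b) x"
proof -
  note A = A.module_axioms and tri = convolution_trilinear[OF f g h]
  show ?thesis unfolding convolution_sweedler
  proof (rule C.sweedler_cong[OF A C.trilinear_sweedler_right[OF A tri] _ x])
    fix a b assume a: "a \<in> carrier C" and b: "b \<in> carrier C"
    show "f a \<otimes> sweedler C A (\<lambda>c d. g c \<otimes> h d) b = sweedler C A (\<lambda>c d. f a \<otimes> (g c \<otimes> h d)) b"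
      by (rule C.sweedler_post[OF A A A.mult_linear_right[OF linear_id lin_map[OF f a]] convolution_bilinear[OF g h] b])
  qed
qed

lemma convolution_assoc:
  assumes f: "f \<in> linear_maps K C A" and g: "g \<in> linear_maps K C A" and h: "h \<in> linear_maps K C A"
    and x: "x \<in> carrier C"
  shows "convolution C A (convolution C A f g) h x = convolution C A f (convolution C A g h) x"
proof -
  note A = A.module_axioms and tri = convolution_trilinear[OF f g h]
  have "convolution C A (convolution C A f g) h x
    = sweedler C A (\<lambda>a b. sweedler C A (\<lambda>c d. f c \<otimes> (g d \<otimes> h b)) a) x"
    unfolding convolution_sweedler
  proof (rule C.sweedler_cong[OF A C.trilinear_sweedler_left[OF A tri] _ x])
    fix a b assume a: "a \<in> carrier C" and b: "b \<in> carrier C"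
    have "sweedler C A (\<lambda>c d. f c \<otimes> g d) a \<otimes> h b = sweedler C A (\<lambda>c d. f c \<otimes> g d \<otimes> h b) a"
      by (rule C.sweedler_post[OF A A A.mult_linear_left[OF linear_id lin_map[OF h b]] convolution_bilinear[OF f g] a])
    also have "\<dots> = sweedler C A (\<lambda>c d. f c \<otimes> (g d \<otimes> h b)) a"
      by (rule C.sweedler_cong[OF A trilinear_bilinear(2)[OF tri b] _ a])
        (simp add: A.m_assoc lin_map[OF f] lin_map[OF g] lin_map[OF h] b)
    finally show "sweedler C A (\<lambda>c d. f c \<otimes> g d) a \<otimes> h b = \<dots>" .
  qed
  also have "\<dots> = convolution C A f (convolution C A g h) x"
    by (simp add: convolution_nested[OF f g h x] C.sweedler_coassoc[OF A tri x])
  finally show ?thesis .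
qed

lemma convolution_cong:
  assumes "f \<in> linear_maps K C A" "g \<in> linear_maps K C A"
    "\<And>x. x \<in> carrier C \<Longrightarrow> f' x = f x" "\<And>x. x \<in> carrier C \<Longrightarrow> g' x = g x" "x \<in> carrier C"
  shows "convolution C A f' g' x = convolution C A f g x"
  unfolding convolution_sweedler
  by (rule C.sweedler_cong[OF A.module_axioms convolution_bilinear[OF assms(1,2)] _ assms(5)]) (simp add: assms)

abbreviation "unit_map \<equiv> (\<lambda>x. counit C x \<odot> \<one>)"

lemma unit_map_linear: "unit_map \<in> linear_maps K C A"
  by (rule C.counit_smult_linear[OF A.module_axioms]) simp

lemma convolution_unit_left:
  assumes f: "f \<in> linear_maps K C A" and x: "x \<in> carrier C"
  shows "convolution C A unit_map f x = f x"
proof -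
  have "convolution C A unit_map f x = sweedler C A (\<lambda>a b. counit C a \<odot> f b) x"
    unfolding convolution_sweedler
    by (rule C.sweedler_cong[OF A.module_axioms C.counit_smult_bilinear[OF A.module_axioms f] _ x])
     (simp add: C.counit_closed lin_map[OF f] A.smult_mult_left)
  then show ?thesis by (simp add: C.sweedler_counit_left[OF A.module_axioms f x])
qed

lemma convolution_unit_right:
  assumes f: "f \<in> linear_maps K C A" and x: "x \<in> carrier C"
  shows "convolution C A f unit_map x = f x"
proof -
  have "convolution C A f unit_map x = sweedler C A (\<lambda>a b. counit C b \<odot> f a) x"
    unfolding convolution_sweedler
    by (rule C.sweedler_cong[OF A.module_axioms bilinear_flip[OF C.counit_smult_bilinear[OF A.module_axioms f]] _ x])
     (simp add: C.counit_closed lin_map[OF f] A.smult_mult_right)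
  then show ?thesis by (simp add: C.sweedler_counit_right[OF A.module_axioms f x])
qed

lemma linear_diff:
  assumes "f \<in> linear_maps K C A" "g \<in> linear_maps K C A"
  shows "(\<lambda>x. f x \<ominus> g x) \<in> linear_maps K C A"
  using assms
  by (intro linear_mapsI)
    (simp_all add: lin_map linear_add linear_smult a_minus_def A.minus_add A.a_ac A.smult_r_distr A.smult_r_minus)

lemma sweedler_diff:
  assumes \<phi>: "\<phi> \<in> bilinear_maps K C C A" and \<psi>: "\<psi> \<in> bilinear_maps K C C A" and x: "x \<in> carrier C"
  shows "sweedler C A (\<lambda>a b. \<phi> a b \<ominus> \<psi> a b) x = sweedler C A \<phi> x \<ominus> sweedler C A \<psi> x"
proof -
  note A = A.module_axioms
  have b: "(\<lambda>a b. \<phi> a b \<ominus> \<psi> a b) \<in> bilinear_maps K C C A"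
    using bilinear_left[OF \<phi>] bilinear_right[OF \<phi>] bilinear_left[OF \<psi>] bilinear_right[OF \<psi>]
    by (intro bilinearI linear_diff) auto
  note l\<phi> = C.CC.tensor_lift_linear[OF A \<phi>] and l\<psi> = C.CC.tensor_lift_linear[OF A \<psi>]
  have d: "(\<lambda>X. tensor_lift (add_monoid A) \<phi> X \<ominus> tensor_lift (add_monoid A) \<psi> X) \<in> linear_maps K (tensor K C C) A"
    using l\<phi> l\<psi> by (intro linear_mapsI)
     (simp_all add: lin_map linear_add linear_smult a_minus_def A.minus_add A.a_ac A.smult_r_distr A.smult_r_minus)
  show ?thesis unfolding sweedler_def
    by (rule C.CC.tensor_linear_eqI[OF A C.CC.tensor_lift_linear[OF A b] d _ C.comult_closed[OF x]])
      (simp add: C.CC.tensor_lift_pure[OF A b] C.CC.tensor_lift_pure[OF A \<phi>] C.CC.tensor_lift_pure[OF A \<psi>])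
qed

lemma convolution_diff_left:
  assumes f: "f \<in> linear_maps K C A" and g: "g \<in> linear_maps K C A" and h: "h \<in> linear_maps K C A"
    and x: "x \<in> carrier C"
  shows "convolution C A (\<lambda>x. f x \<ominus> g x) h x = convolution C A f h x \<ominus> convolution C A g h x"
proof -
  have "convolution C A (\<lambda>x. f x \<ominus> g x) h x = sweedler C A (\<lambda>a b. f a \<otimes> h b \<ominus> g a \<otimes> h b) x"
    unfolding convolution_sweedler
    using C.sweedler_cong[OF A.module_axioms convolution_bilinear[OF linear_diff[OF f g] h] _ x, of "\<lambda>a b. f a \<otimes> h b \<ominus> g a \<otimes> h b"]
    by (simp add: lin_map[OF f] lin_map[OF g] lin_map[OF h] a_minus_def A.l_distr A.l_minus)
  then show ?thesis
    unfolding convolution_sweedler by (simp add: sweedler_diff convolution_bilinear f g h x)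
qed

lemma convolution_diff_right:
  assumes f: "f \<in> linear_maps K C A" and g: "g \<in> linear_maps K C A" and h: "h \<in> linear_maps K C A"
    and x: "x \<in> carrier C"
  shows "convolution C A h (\<lambda>x. f x \<ominus> g x) x = convolution C A h f x \<ominus> convolution C A h g x"
proof -
  have "convolution C A h (\<lambda>x. f x \<ominus> g x) x = sweedler C A (\<lambda>a b. h a \<otimes> f b \<ominus> h a \<otimes> g b) x"
    unfolding convolution_sweedler
    using C.sweedler_cong[OF A.module_axioms convolution_bilinear[OF h linear_diff[OF f g]] _ x, of "\<lambda>a b. h a \<otimes> f b \<ominus> h a \<otimes> g b"]
    by (simp add: lin_map[OF f] lin_map[OF g] lin_map[OF h] a_minus_def A.r_distr A.r_minus)
  then show ?thesis
    unfolding convolution_sweedler by (simp add: sweedler_diff convolution_bilinear f g h x)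
qed

text \<open>
  Expand \<open>l = l * (m' * r)\<close> and \<open>r = (l * m) * r\<close>. For \<open>m = m'\<close> this is the uniqueness of inverses; in
  general it bounds the difference of the inverses by that of \<open>m\<close> and \<open>m'\<close>.
\<close>

lemma convolution_inverse_difference:
  assumes l: "l \<in> linear_maps K C A" and r: "r \<in> linear_maps K C A"
    and m: "m \<in> linear_maps K C A" and m': "m' \<in> linear_maps K C A"
    and lm: "\<And>x. x \<in> carrier C \<Longrightarrow> convolution C A l m x = unit_map x"
    and mr: "\<And>x. x \<in> carrier C \<Longrightarrow> convolution C A m' r x = unit_map x"
    and x: "x \<in> carrier C"
  shows "l x \<ominus> r x = convolution C A l (convolution C A (\<lambda>y. m' y \<ominus> m y) r) x"
proof -
  have "l x = convolution C A l unit_map x" by (simp add: convolution_unit_right[OF l x])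
  also have "\<dots> = convolution C A l (convolution C A m' r) x"
    by (rule convolution_cong[OF l convolution_linear[OF m' r] _ _ x]) (simp_all add: mr)
  finally have L: "l x = \<dots>" .
  have "r x = convolution C A unit_map r x" by (simp add: convolution_unit_left[OF r x])
  also have "\<dots> = convolution C A (convolution C A l m) r x"
    by (rule convolution_cong[OF convolution_linear[OF l m] r _ _ x]) (simp_all add: lm)
  also have "\<dots> = convolution C A l (convolution C A m r) x" by (rule convolution_assoc[OF l m r x])
  finally have R: "r x = \<dots>" .
  have "convolution C A l (convolution C A (\<lambda>y. m' y \<ominus> m y) r) x
      = convolution C A l (\<lambda>x. convolution C A m' r x \<ominus> convolution C A m r x) x"
    by (rule convolution_cong[OF l linear_diff[OF convolution_linear[OF m' r] convolution_linear[OF m r]] _ _ x])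
      (simp_all add: convolution_diff_left[OF m' m r])
  also have "\<dots> = l x \<ominus> r x"
    unfolding L R by (rule convolution_diff_right[OF convolution_linear[OF m' r] convolution_linear[OF m r] l x])
  finally show ?thesis by simp
qed

lemma convolution_inverse_unique:
  assumes l: "l \<in> linear_maps K C A" and r: "r \<in> linear_maps K C A" and m: "m \<in> linear_maps K C A"
    and lm: "\<And>x. x \<in> carrier C \<Longrightarrow> convolution C A l m x = unit_map x"
    and mr: "\<And>x. x \<in> carrier C \<Longrightarrow> convolution C A m r x = unit_map x"
    and x: "x \<in> carrier C"
  shows "l x = r x"
proof -
  have "l x = convolution C A l unit_map x" by (simp add: convolution_unit_right[OF l x])
  also have "\<dots> = convolution C A l (convolution C A m r) x"
    by (rule convolution_cong[OF l convolution_linear[OF m r] _ _ x]) (simp_all add: mr)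
  also have "\<dots> = convolution C A (convolution C A l m) r x" by (rule convolution_assoc[OF l m r x, symmetric])
  also have "\<dots> = convolution C A unit_map r x"
    by (rule convolution_cong[OF unit_map_linear r _ _ x]) (simp_all add: lm)
  finally show ?thesis by (simp add: convolution_unit_left[OF r x])
qed

text \<open>
  The form in which the difference formula is used: with \<open>B = 0\<close> and a subcoalgebra \<open>X\<close> it says that the
  inverses agree where the maps do, and with \<open>X = C\<close> that they are congruent modulo an ideal \<open>B\<close> if the
  maps are.
\<close>

lemma convolution_inverse_difference_in_subgroup:
  assumes l: "l \<in> linear_maps K C A" and r: "r \<in> linear_maps K C A"
    and m: "m \<in> linear_maps K C A" and m': "m' \<in> linear_maps K C A"
    and lm: "\<And>x. x \<in> carrier C \<Longrightarrow> convolution C A l m x = unit_map x"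
    and mr: "\<And>x. x \<in> carrier C \<Longrightarrow> convolution C A m' r x = unit_map x"
    and X: "coclosed K C X" and B: "subgroup B (add_monoid A)"
    and in_B: "\<And>a c d. a \<in> X \<Longrightarrow> c \<in> X \<Longrightarrow> d \<in> X \<Longrightarrow> l a \<otimes> ((m' c \<ominus> m c) \<otimes> r d) \<in> B"
    and x: "x \<in> X"
  shows "l x \<ominus> r x \<in> B"
proof -
  note A = A.module_axioms
  have Xc: "X \<subseteq> carrier C" using X by (simp add: coclosed_def)
  note tri = convolution_trilinear[OF l linear_diff[OF m' m] r]
  have "sweedler C A (\<lambda>a b. sweedler C A (\<lambda>c d. l a \<otimes> ((m' c \<ominus> m c) \<otimes> r d)) b) x \<in> B"
  proof (rule C.sweedler_in_subgroup[OF A X C.trilinear_sweedler_right[OF A tri] B _ x])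
    fix a b assume "a \<in> X" "b \<in> X"
    then show "sweedler C A (\<lambda>c d. l a \<otimes> ((m' c \<ominus> m c) \<otimes> r d)) b \<in> B"
      using Xc by (intro C.sweedler_in_subgroup[OF A X trilinear_bilinear(1)[OF tri] B in_B]) auto
  qed
  moreover have "x \<in> carrier C" using x Xc by blast
  ultimately show ?thesis
    by (simp add: convolution_inverse_difference[OF l r m m' lm mr] convolution_nested[OF l linear_diff[OF m' m] r])
qed

end

text \<open>
  Elements are extensional functions, so that pointwise equal linear maps are equal. The purpose of
  this algebra is to serve as the target of another convolution: a linear map from \<open>V\<close> into it is a
  bilinear map \<open>V \<times> C \<rightarrow> A\<close>, which gives convolution in two variables without a coalgebra structure on \<open>V \<otimes> C\<close>.
\<close>

definition convolution_algebra ::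
  "('k, 'm) ring_scheme \<Rightarrow> ('k, 'c, 'x) bialg_scheme \<Rightarrow> ('k, 'a, 'y) module_scheme \<Rightarrow> ('k, 'c \<Rightarrow> 'a) module" where
  "convolution_algebra K C A =
    \<lparr>carrier = linear_maps K C A \<inter> extensional (carrier C),
     monoid.mult = (\<lambda>f g. restrict (convolution C A f g) (carrier C)),
     one = (\<lambda>x\<in>carrier C. counit C x \<odot>\<^bsub>A\<^esub> \<one>\<^bsub>A\<^esub>),
     ring.zero = (\<lambda>x\<in>carrier C. \<zero>\<^bsub>A\<^esub>),
     ring.add = (\<lambda>f g. \<lambda>x\<in>carrier C. f x \<oplus>\<^bsub>A\<^esub> g x),
     smult = (\<lambda>a f. \<lambda>x\<in>carrier C. a \<odot>\<^bsub>A\<^esub> f x)\<rparr>"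

context convolution_pair
begin

abbreviation "L \<equiv> convolution_algebra K C A"

lemma restrict_linear:
  "f \<in> linear_maps K C A \<Longrightarrow> restrict f (carrier C) \<in> carrier L"
  using linear_cong[OF C.module_axioms, of f A "restrict f (carrier C)"]
  by (simp add: convolution_algebra_def)

lemma L_linear: "f \<in> carrier L \<Longrightarrow> f \<in> linear_maps K C A"
  by (simp add: convolution_algebra_def)

lemma L_eqI:
  assumes "f \<in> carrier L" "g \<in> carrier L" "\<And>x. x \<in> carrier C \<Longrightarrow> f x = g x"
  shows "f = g"
  using assms by (auto simp: convolution_algebra_def intro: extensionalityI)

lemma L_apply:
  assumes "x \<in> carrier C"
  shows "(f \<oplus>\<^bsub>L\<^esub> g) x = f x \<oplus> g x" "(a \<odot>\<^bsub>L\<^esub> f) x = a \<odot> f x" "\<zero>\<^bsub>L\<^esub> x = \<zero>"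
    "(f \<otimes>\<^bsub>L\<^esub> g) x = convolution C A f g x" "\<one>\<^bsub>L\<^esub> x = unit_map x"
  using assms by (simp_all add: convolution_algebra_def)

lemma L_closed:
  shows "f \<in> carrier L \<Longrightarrow> g \<in> carrier L \<Longrightarrow> f \<oplus>\<^bsub>L\<^esub> g \<in> carrier L"
    and "a \<in> carrier K \<Longrightarrow> f \<in> carrier L \<Longrightarrow> a \<odot>\<^bsub>L\<^esub> f \<in> carrier L"
    and "\<zero>\<^bsub>L\<^esub> \<in> carrier L" and "\<one>\<^bsub>L\<^esub> \<in> carrier L"
    and "f \<in> carrier L \<Longrightarrow> g \<in> carrier L \<Longrightarrow> f \<otimes>\<^bsub>L\<^esub> g \<in> carrier L"
proof -
  show "f \<oplus>\<^bsub>L\<^esub> g \<in> carrier L" if "f \<in> carrier L" "g \<in> carrier L"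
  proof -
    have "(\<lambda>x. f x \<oplus> g x) \<in> linear_maps K C A"
      using L_linear[OF that(1)] L_linear[OF that(2)]
      by (intro linear_mapsI) (simp_all add: lin_map linear_add linear_smult A.a_ac A.smult_r_distr)
    from restrict_linear[OF this] show ?thesis by (simp add: convolution_algebra_def)
  qed
  show "a \<odot>\<^bsub>L\<^esub> f \<in> carrier L" if "a \<in> carrier K" "f \<in> carrier L"
  proof -
    have "(\<lambda>x. a \<odot> f x) \<in> linear_maps K C A"
      using L_linear[OF that(2)] that(1)
      by (intro linear_mapsI) (simp_all add: lin_map linear_add linear_smult A.smult_r_distr A.smult_assoc1[symmetric] C.R.m_comm)
    from restrict_linear[OF this] show ?thesis by (simp add: convolution_algebra_def)
  qed
  show "\<zero>\<^bsub>L\<^esub> \<in> carrier L"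
    using restrict_linear[of "\<lambda>_. \<zero>"] by (simp add: convolution_algebra_def linear_mapsI)
  show "\<one>\<^bsub>L\<^esub> \<in> carrier L"
    using restrict_linear[OF unit_map_linear] by (simp add: convolution_algebra_def)
  show "f \<otimes>\<^bsub>L\<^esub> g \<in> carrier L" if "f \<in> carrier L" "g \<in> carrier L"
    using restrict_linear[OF convolution_linear[OF that[THEN L_linear]]] by (simp add: convolution_algebra_def)
qed

lemma L_value: "f \<in> carrier L \<Longrightarrow> x \<in> carrier C \<Longrightarrow> f x \<in> carrier A"
  by (rule lin_map[OF L_linear])

lemma L_module: "module K L"
proof (intro moduleI abelian_groupI)
  fix f assume f: "f \<in> carrier L"
  have n: "\<ominus>\<^bsub>K\<^esub> \<one>\<^bsub>K\<^esub> \<odot>\<^bsub>L\<^esub> f \<in> carrier L" using f by (simp add: L_closed)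
  have "(\<ominus>\<^bsub>K\<^esub> \<one>\<^bsub>K\<^esub> \<odot>\<^bsub>L\<^esub> f) \<oplus>\<^bsub>L\<^esub> f = \<zero>\<^bsub>L\<^esub>"
    by (rule L_eqI) (use f n in \<open>simp_all add: L_closed L_apply L_value A.smult_l_minus A.l_neg\<close>)
  with n show "\<exists>g\<in>carrier L. g \<oplus>\<^bsub>L\<^esub> f = \<zero>\<^bsub>L\<^esub>" by blast
qed (rule C.R.is_cring | (simp add: L_closed; fail) |
  (rule L_eqI; simp add: L_closed L_apply L_value A.a_ac A.smult_l_distr A.smult_r_distr A.smult_assoc1))+

lemma L_eval_linear: "x \<in> carrier C \<Longrightarrow> (\<lambda>f. f x) \<in> linear_maps K L A"
  by (intro linear_mapsI) (simp_all add: L_apply L_value)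

lemma L_mult_bilinear: "monoid.mult L \<in> bilinear_maps K L L L"
proof -
  have l: "(\<lambda>f. convolution C A f g x) \<in> linear_maps K L A" if "g \<in> carrier L" "x \<in> carrier C" for g x
    unfolding convolution_sweedler
    using that L_linear L_value
    by (intro C.sweedler_linear_param[OF A.module_axioms L_module] convolution_bilinear A.mult_linear_left L_eval_linear) auto
  have r: "(\<lambda>g. convolution C A f g x) \<in> linear_maps K L A" if "f \<in> carrier L" "x \<in> carrier C" for f x
    unfolding convolution_sweedler
    using that L_linear L_value
    by (intro C.sweedler_linear_param[OF A.module_axioms L_module] convolution_bilinear A.mult_linear_right L_eval_linear) auto
  show ?thesis
  proof (rule bilinearI; rule linear_mapsI)
  qed (simp add: L_closed; fail |
     (rule L_eqI; simp add: L_closed L_apply linear_add[OF l] linear_add[OF r] linear_smult[OF l] linear_smult[OF r]))+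
qed

lemma L_assoc_algebra: "assoc_algebra K L"
proof (rule assoc_algebraI[OF L_module L_mult_bilinear])
  fix f g h assume f: "f \<in> carrier L" and g: "g \<in> carrier L" and h: "h \<in> carrier L"
  note lin = f[THEN L_linear] g[THEN L_linear] h[THEN L_linear]
  show "(f \<otimes>\<^bsub>L\<^esub> g) \<otimes>\<^bsub>L\<^esub> h = f \<otimes>\<^bsub>L\<^esub> (g \<otimes>\<^bsub>L\<^esub> h)"
  proof (rule L_eqI)
    fix x assume x: "x \<in> carrier C"
    have "convolution C A (f \<otimes>\<^bsub>L\<^esub> g) h x = convolution C A (convolution C A f g) h x"
      by (rule convolution_cong) (simp_all add: lin convolution_linear L_apply x)
    moreover have "convolution C A f (g \<otimes>\<^bsub>L\<^esub> h) x = convolution C A f (convolution C A g h) x"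
      by (rule convolution_cong) (simp_all add: lin convolution_linear L_apply x)
    ultimately show "((f \<otimes>\<^bsub>L\<^esub> g) \<otimes>\<^bsub>L\<^esub> h) x = (f \<otimes>\<^bsub>L\<^esub> (g \<otimes>\<^bsub>L\<^esub> h)) x"
      using convolution_assoc[OF lin x] by (simp add: L_apply x)
  qed (simp_all add: f g h L_closed)
next
  fix f assume f: "f \<in> carrier L"
  note lin = L_linear[OF f]
  show "\<one>\<^bsub>L\<^esub> \<otimes>\<^bsub>L\<^esub> f = f"
  proof (rule L_eqI)
    fix x assume x: "x \<in> carrier C"
    have "convolution C A \<one>\<^bsub>L\<^esub> f x = convolution C A unit_map f x"
      by (rule convolution_cong[OF unit_map_linear lin _ _ x]) (simp_all add: L_apply)
    then show "(\<one>\<^bsub>L\<^esub> \<otimes>\<^bsub>L\<^esub> f) x = f x" by (simp add: L_apply x convolution_unit_left[OF lin x])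
  qed (simp_all add: f L_closed)
  show "f \<otimes>\<^bsub>L\<^esub> \<one>\<^bsub>L\<^esub> = f"
  proof (rule L_eqI)
    fix x assume x: "x \<in> carrier C"
    have "convolution C A f \<one>\<^bsub>L\<^esub> x = convolution C A f unit_map x"
      by (rule convolution_cong[OF lin unit_map_linear _ _ x]) (simp_all add: L_apply)
    then show "(f \<otimes>\<^bsub>L\<^esub> \<one>\<^bsub>L\<^esub>) x = f x" by (simp add: L_apply x convolution_unit_right[OF lin x])
  qed (simp_all add: f L_closed)
qed (rule L_closed)

lemma curry_linear:
  assumes "module K V" "\<phi> \<in> bilinear_maps K V C A"
  shows "(\<lambda>x. restrict (\<phi> x) (carrier C)) \<in> linear_maps K V L"
proof -
  interpret V: module K V by fact
  note cl = restrict_linear[OF bilinear_right[OF assms(2)]]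
  show ?thesis
    by (rule linear_mapsI; (simp add: cl; fail)?; rule L_eqI)
      (simp_all add: cl L_closed L_apply linear_add[OF bilinear_left[OF assms(2)]] linear_smult[OF bilinear_left[OF assms(2)]])
qed

end

section \<open>The antipode is an anti-homomorphism\<close>

context bialgebra
begin

sublocale BB: tensor_algebras K B B ..

abbreviation "T2 \<equiv> tensor K B B"

lemma T2_one: "\<one>\<^bsub>T2\<^esub> = pure_tensor K B B \<one>\<^bsub>B\<^esub> \<one>\<^bsub>B\<^esub>" by (simp add: tensor_def)

lemma comult_mult: "x \<in> carrier B \<Longrightarrow> y \<in> carrier B \<Longrightarrow> comult B (x \<otimes>\<^bsub>B\<^esub> y) = comult B x \<otimes>\<^bsub>T2\<^esub> comult B y"
  using comult_ring_hom by (simp add: ring_hom_def)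

lemma comult_one: "comult B \<one>\<^bsub>B\<^esub> = pure_tensor K B B \<one>\<^bsub>B\<^esub> \<one>\<^bsub>B\<^esub>"
  using comult_ring_hom by (simp add: ring_hom_def T2_one)

lemma counit_mult: "x \<in> carrier B \<Longrightarrow> y \<in> carrier B \<Longrightarrow> counit B (x \<otimes>\<^bsub>B\<^esub> y) = counit B x \<otimes>\<^bsub>K\<^esub> counit B y"
  using counit_ring_hom by (simp add: ring_hom_def)

lemma counit_one: "counit B \<one>\<^bsub>B\<^esub> = \<one>\<^bsub>K\<^esub>"
  using counit_ring_hom by (simp add: ring_hom_def)

lemma sweedler_mult_inner_bilinear:
  assumes M: "module K M" and \<phi>: "\<phi> \<in> bilinear_maps K B B M" and Y: "Y \<in> carrier T2"
  shows "(\<lambda>a b. tensor_lift (add_monoid M) (\<lambda>c d. \<phi> (a \<otimes>\<^bsub>B\<^esub> c) (b \<otimes>\<^bsub>B\<^esub> d)) Y) \<in> bilinear_maps K B B M"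
proof (rule bilinearI; rule CC.tensor_lift_param[OF module_axioms M _ _ Y])
  show "(\<lambda>c d. \<phi> (a \<otimes>\<^bsub>B\<^esub> c) (b \<otimes>\<^bsub>B\<^esub> d)) \<in> bilinear_maps K B B M"
    "(\<lambda>c d. \<phi> (a \<otimes>\<^bsub>B\<^esub> c) (b \<otimes>\<^bsub>B\<^esub> d)) \<in> bilinear_maps K B B M"
    if "a \<in> carrier B" "b \<in> carrier B" for a b
    using that by (auto intro!: bilinear_comp[OF \<phi>] mult_linear_right linear_id)
  show "(\<lambda>b. \<phi> (b \<otimes>\<^bsub>B\<^esub> v) (a \<otimes>\<^bsub>B\<^esub> w)) \<in> linear_maps K B M"
    "(\<lambda>b. \<phi> (a \<otimes>\<^bsub>B\<^esub> v) (b \<otimes>\<^bsub>B\<^esub> w)) \<in> linear_maps K B M"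
    if "a \<in> carrier B" "v \<in> carrier B" "w \<in> carrier B" for a v w
    using that by (auto intro!: linear_bilinear_left[OF \<phi>] linear_bilinear_right[OF \<phi>] mult_linear_left linear_id)
qed

text \<open>
  The multiplicativity of the comultiplication in Sweedler form. Both sides are the values of maps that
  are linear in the coproduct of \<open>x\<close> and in that of \<open>y\<close>, so they are compared on pure tensors.
\<close>

lemma sweedler_mult:
  assumes M: "module K M" and \<phi>: "\<phi> \<in> bilinear_maps K B B M" and x: "x \<in> carrier B" and y: "y \<in> carrier B"
  shows "sweedler B M \<phi> (x \<otimes>\<^bsub>B\<^esub> y) = sweedler B M (\<lambda>a b. sweedler B M (\<lambda>c d. \<phi> (a \<otimes>\<^bsub>B\<^esub> c) (b \<otimes>\<^bsub>B\<^esub> d)) y) x"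
proof -
  note Y = comult_closed[OF y] and X = comult_closed[OF x]
  note lin = CC.tensor_lift_linear[OF M \<phi>]
  have bl: "(\<lambda>c d. \<phi> (a \<otimes>\<^bsub>B\<^esub> c) (b \<otimes>\<^bsub>B\<^esub> d)) \<in> bilinear_maps K B B M" if "a \<in> carrier B" "b \<in> carrier B" for a b
    using that by (auto intro!: bilinear_comp[OF \<phi>] mult_linear_right linear_id)
  note b = sweedler_mult_inner_bilinear[OF M \<phi> Y]
  have "tensor_lift (add_monoid M) \<phi> (comult B x \<otimes>\<^bsub>T2\<^esub> comult B y) =
    tensor_lift (add_monoid M) (\<lambda>a b. tensor_lift (add_monoid M) (\<lambda>c d. \<phi> (a \<otimes>\<^bsub>B\<^esub> c) (b \<otimes>\<^bsub>B\<^esub> d)) (comult B y)) (comult B x)"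
  proof (rule CC.tensor_linear_eqI[OF M linear_comp[OF lin linear_bilinear_left[OF BB.tensor_mult_bilinear linear_id Y]]
       CC.tensor_lift_linear[OF M b] _ X])
    fix v w assume v: "v \<in> carrier B" and w: "w \<in> carrier B"
    note p = CC.pure_closed[OF v w]
    have "tensor_lift (add_monoid M) \<phi> (pure_tensor K B B v w \<otimes>\<^bsub>T2\<^esub> comult B y) =
      tensor_lift (add_monoid M) (\<lambda>c d. \<phi> (v \<otimes>\<^bsub>B\<^esub> c) (w \<otimes>\<^bsub>B\<^esub> d)) (comult B y)"
      by (rule CC.tensor_linear_eqI[OF M linear_comp[OF lin linear_bilinear_right[OF BB.tensor_mult_bilinear linear_id p]]
        CC.tensor_lift_linear[OF M bl[OF v w]] _ Y])
       (simp add: BB.tensor_mult_pure v w CC.tensor_lift_pure[OF M \<phi>] CC.tensor_lift_pure[OF M bl[OF v w]])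
    then show "tensor_lift (add_monoid M) \<phi> (pure_tensor K B B v w \<otimes>\<^bsub>T2\<^esub> comult B y) =
      tensor_lift (add_monoid M) (\<lambda>a b. tensor_lift (add_monoid M) (\<lambda>c d. \<phi> (a \<otimes>\<^bsub>B\<^esub> c) (b \<otimes>\<^bsub>B\<^esub> d)) (comult B y)) (pure_tensor K B B v w)"
      by (simp add: CC.tensor_lift_pure[OF M b] v w)
  qed
  then show ?thesis by (simp add: sweedler_def comult_mult x y)
qed

end

locale hopf = bialgebra K H for K and H (structure) +
  fixes S assumes S: "antipode K H S"
begin

sublocale HH: convolution_pair K H H ..

lemma S_linear: "S \<in> linear_maps K H H" using S by (simp add: antipode_def)

lemma S_closed [simp]: "x \<in> carrier H \<Longrightarrow> S x \<in> carrier H" by (rule lin_map[OF S_linear])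

lemma S_left: "x \<in> carrier H \<Longrightarrow> convolution H H S (\<lambda>y. y) x = counit H x \<odot> \<one>"
  and S_right: "x \<in> carrier H \<Longrightarrow> convolution H H (\<lambda>y. y) S x = counit H x \<odot> \<one>"
  using S by (simp_all add: antipode_def)

lemma S_one: "S \<one> = \<one>"
  using S_left[OF one_closed] CC.tensor_lift_pure[OF module_axioms HH.convolution_bilinear[OF S_linear linear_id] one_closed one_closed]
  by (simp add: convolution_def comult_one counit_one)

text \<open>
  Both \<open>S (x y)\<close> and \<open>S y \<cdot> S x\<close> are inverses of the product map \<open>(x, y) \<mapsto> x y\<close> for the convolution in two
  variables, that is, for the convolution of maps from \<open>H\<close> to the convolution algebra of \<open>H\<close>.
\<close>

lemma S_mult:
  assumes x: "x \<in> carrier H" and y: "y \<in> carrier H"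
  shows "S (x \<otimes> y) = S y \<otimes> S x"
proof -
  let ?L = "convolution_algebra K H H"
  interpret L: assoc_algebra K ?L by (rule HH.L_assoc_algebra)
  interpret HL: convolution_pair K H ?L ..
  note M = module_axioms and modL = L.module_axioms
  note Sl = S_linear and idl = linear_id[of K H]
  have bl: "(\<lambda>x y. S (x \<otimes> y)) \<in> bilinear_maps K H H H" by (rule bilinear_post[OF Sl mult_bilinear])
  have br: "(\<lambda>x y. S y \<otimes> S x) \<in> bilinear_maps K H H H"
    by (rule bilinear_flip[OF HH.convolution_bilinear[OF Sl Sl]])
  define l where "l x = (\<lambda>y\<in>carrier H. S (x \<otimes> y))" for x
  define m where "m x = (\<lambda>y\<in>carrier H. x \<otimes> y)" for x
  define r where "r x = (\<lambda>y\<in>carrier H. S y \<otimes> S x)" for x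
  have l: "l \<in> linear_maps K H ?L" using HH.curry_linear[OF M bl] by (simp add: l_def[abs_def])
  have m: "m \<in> linear_maps K H ?L" using HH.curry_linear[OF M mult_bilinear] by (simp add: m_def[abs_def])
  have r: "r \<in> linear_maps K H ?L" using HH.curry_linear[OF M br] by (simp add: r_def[abs_def])
  have eval: "convolution H ?L f g x y = sweedler H H (\<lambda>a b. convolution H H (f a) (g b) y) x"
    if f: "f \<in> linear_maps K H ?L" and g: "g \<in> linear_maps K H ?L" and x: "x \<in> carrier H" and y: "y \<in> carrier H" for f g x y
  proof -
    have "convolution H ?L f g x y = sweedler H H (\<lambda>a b. (f a \<otimes>\<^bsub>?L\<^esub> g b) y) x"
      unfolding convolution_sweedler[of _ ?L]
      by (rule sweedler_post[OF modL M HH.L_eval_linear[OF y] HL.convolution_bilinear[OF f g] x])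
    then show ?thesis by (simp add: HH.L_apply y)
  qed
  have lm: "convolution H ?L l m x = counit H x \<odot>\<^bsub>?L\<^esub> \<one>\<^bsub>?L\<^esub>" if x: "x \<in> carrier H" for x
  proof (rule HH.L_eqI)
    fix y assume y: "y \<in> carrier H"
    have "convolution H ?L l m x y = sweedler H H (\<lambda>a b. convolution H H (l a) (m b) y) x" by (rule eval[OF l m x y])
    also have "\<dots> = sweedler H H (\<lambda>a b. sweedler H H (\<lambda>c d. S (a \<otimes> c) \<otimes> (b \<otimes> d)) y) x"
    proof (rule sweedler_cong[OF M _ _ x])
      show "(\<lambda>a b. sweedler H H (\<lambda>c d. S (a \<otimes> c) \<otimes> (b \<otimes> d)) y) \<in> bilinear_maps K H H H"
        using sweedler_mult_inner_bilinear[OF M HH.convolution_bilinear[OF Sl idl] comult_closed[OF y]] by (simp add: sweedler_def)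
      fix a b assume a: "a \<in> carrier H" and b: "b \<in> carrier H"
      show "convolution H H (l a) (m b) y = sweedler H H (\<lambda>c d. S (a \<otimes> c) \<otimes> (b \<otimes> d)) y"
        unfolding convolution_sweedler[symmetric]
        by (rule HH.convolution_cong[OF bilinear_right[OF bl a] bilinear_right[OF mult_bilinear b] _ _ y]) (simp_all add: l_def m_def)
    qed
    also have "\<dots> = convolution H H S (\<lambda>y. y) (x \<otimes> y)"
      unfolding convolution_sweedler by (rule sweedler_mult[OF M HH.convolution_bilinear[OF Sl idl] x y, symmetric])
    also have "\<dots> = (counit H x \<odot>\<^bsub>?L\<^esub> \<one>\<^bsub>?L\<^esub>) y"
      using x y by (simp add: S_left counit_mult HH.L_apply smult_assoc1 counit_closed)
    finally show "convolution H ?L l m x y = (counit H x \<odot>\<^bsub>?L\<^esub> \<one>\<^bsub>?L\<^esub>) y" .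
  qed (use lin_map[OF HL.convolution_linear[OF l m] x] lin_map[OF HL.unit_map_linear x] in simp_all)
  have mr: "convolution H ?L m r x = counit H x \<odot>\<^bsub>?L\<^esub> \<one>\<^bsub>?L\<^esub>" if x: "x \<in> carrier H" for x
  proof (rule HH.L_eqI)
    fix y assume y: "y \<in> carrier H"
    have inner: "convolution H H (m a) (r b) y = counit H y \<odot> (a \<otimes> S b)" if a: "a \<in> carrier H" and b: "b \<in> carrier H" for a b
    proof -
      have h: "(\<lambda>z. a \<otimes> z \<otimes> S b) \<in> linear_maps K H H"
        using a b by (intro mult_linear_left mult_linear_right linear_id) simp_all
      have "convolution H H (m a) (r b) y = convolution H H (\<lambda>c. a \<otimes> c) (\<lambda>d. S d \<otimes> S b) y"
        by (rule HH.convolution_cong[OF bilinear_right[OF mult_bilinear a] bilinear_right[OF br b] _ _ y]) (simp_all add: m_def r_def)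
      also have "\<dots> = sweedler H H (\<lambda>c d. a \<otimes> (c \<otimes> S d) \<otimes> S b) y"
        unfolding convolution_sweedler
        by (rule sweedler_cong[OF M bilinear_post[OF h HH.convolution_bilinear[OF idl Sl]] _ y]) (simp add: a b m_assoc)
      also have "\<dots> = a \<otimes> convolution H H (\<lambda>y. y) S y \<otimes> S b"
        unfolding convolution_sweedler by (rule sweedler_post[OF M M h HH.convolution_bilinear[OF idl Sl] y, symmetric])
      finally show ?thesis using a b y by (simp add: S_right smult_mult_left smult_mult_right counit_closed)
    qed
    have h: "(\<lambda>z. counit H y \<odot> z) \<in> linear_maps K H H"
      using counit_closed[OF y] by (intro linear_mapsI) (simp_all add: smult_r_distr smult_assoc1[symmetric] m_comm)
    have "convolution H ?L m r x y = sweedler H H (\<lambda>a b. convolution H H (m a) (r b) y) x" by (rule eval[OF m r x y])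
    also have "\<dots> = sweedler H H (\<lambda>a b. counit H y \<odot> (a \<otimes> S b)) x"
      by (rule sweedler_cong[OF M bilinear_post[OF h HH.convolution_bilinear[OF idl Sl]] _ x]) (rule inner)
    also have "\<dots> = counit H y \<odot> convolution H H (\<lambda>y. y) S x"
      unfolding convolution_sweedler by (rule sweedler_post[OF M M h HH.convolution_bilinear[OF idl Sl] x, symmetric])
    also have "\<dots> = (counit H x \<odot>\<^bsub>?L\<^esub> \<one>\<^bsub>?L\<^esub>) y"
      using x y by (simp add: S_right HH.L_apply smult_assoc1[symmetric] counit_closed m_comm)
    finally show "convolution H ?L m r x y = (counit H x \<odot>\<^bsub>?L\<^esub> \<one>\<^bsub>?L\<^esub>) y" .
  qed (use lin_map[OF HL.convolution_linear[OF m r] x] lin_map[OF HL.unit_map_linear x] in simp_all)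
  have "l x = r x" by (rule HL.convolution_inverse_unique[OF l r m lm mr x])
  then have "l x y = r x y" by simp
  then show ?thesis using y by (simp add: l_def r_def)
qed

text \<open>
  Both sides are inverses of the comultiplication for the convolution of maps from \<open>H\<close> to \<open>H \<otimes> H\<close>. On
  the right this is \<open>\<Sum> x\<^sub>1 S(x\<^sub>4) \<otimes> x\<^sub>2 S(x\<^sub>3) = \<Sum> x\<^sub>1 S(x\<^sub>2) \<otimes> 1 = \<epsilon>(x) 1 \<otimes> 1\<close>.
\<close>

lemma S_comult:
  assumes x: "x \<in> carrier H"
  shows "comult H (S x) = sweedler H T2 (\<lambda>a b. pure_tensor K H H (S b) (S a)) x"
proof -
  interpret T: assoc_algebra K T2 by (rule BB.tensor_assoc_algebra)
  interpret HT: convolution_pair K H T2 ..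
  note M = module_axioms and MT = CC.tensor_module
  note Sl = S_linear and idl = linear_id[of K H] and \<Delta> = comult_linear
  note pb = CC.pure_bilinear
  have bS: "(\<lambda>a b. pure_tensor K H H (S b) (S a)) \<in> bilinear_maps K H H T2"
    by (rule bilinear_flip[OF bilinear_comp[OF pb Sl Sl]])
  define r where "r = sweedler H T2 (\<lambda>a b. pure_tensor K H H (S b) (S a))"
  have r: "r \<in> linear_maps K H T2" unfolding r_def by (rule sweedler_linear[OF MT bS])
  have l: "(\<lambda>x. comult H (S x)) \<in> linear_maps K H T2" by (rule linear_comp[OF \<Delta> Sl])
  have "comult H (S x) = r x"
  proof (rule HT.convolution_inverse_unique[OF l r \<Delta> _ _ x])
    fix x assume x: "x \<in> carrier H"
    have "convolution H T2 (\<lambda>x. comult H (S x)) (comult H) x = sweedler H T2 (\<lambda>a b. comult H (S a \<otimes> b)) x"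
      unfolding convolution_sweedler
      by (rule sweedler_cong[OF MT bilinear_post[OF \<Delta> HH.convolution_bilinear[OF Sl idl]] _ x]) (simp add: comult_mult)
    also have "\<dots> = comult H (convolution H H S (\<lambda>y. y) x)"
      unfolding convolution_sweedler by (rule sweedler_post[OF M MT \<Delta> HH.convolution_bilinear[OF Sl idl] x, symmetric])
    also have "\<dots> = HT.unit_map x"
      using x by (simp add: S_left linear_smult[OF \<Delta>] counit_closed comult_one T2_one)
    finally show "convolution H T2 (\<lambda>x. comult H (S x)) (comult H) x = HT.unit_map x" .
  next
    fix x assume x: "x \<in> carrier H"
    have tri1: "(\<lambda>p q b. pure_tensor K H H p q \<otimes>\<^bsub>T2\<^esub> r b) \<in> trilinear_maps K H T2"
      by (intro trilinearI T.mult_linear_left T.mult_linear_right linear_bilinear_left[OF pb] linear_bilinear_right[OF pb] linear_id r)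
       (simp_all add: lin_map[OF r] CC.pure_closed)
    have tri2: "(\<lambda>q c d. pure_tensor K H H (p \<otimes> S d) (q \<otimes> S c)) \<in> trilinear_maps K H T2" if "p \<in> carrier H" for p
      using that by (intro trilinearI linear_bilinear_left[OF pb] linear_bilinear_right[OF pb] mult_linear_left mult_linear_right linear_id Sl)
       simp_all
    have step: "pure_tensor K H H p q \<otimes>\<^bsub>T2\<^esub> r b = sweedler H T2 (\<lambda>c d. pure_tensor K H H (p \<otimes> S d) (q \<otimes> S c)) b"
      if p: "p \<in> carrier H" and q: "q \<in> carrier H" and b: "b \<in> carrier H" for p q b
    proof -
      have "pure_tensor K H H p q \<otimes>\<^bsub>T2\<^esub> r b = sweedler H T2 (\<lambda>c d. pure_tensor K H H p q \<otimes>\<^bsub>T2\<^esub> pure_tensor K H H (S d) (S c)) b"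
        unfolding r_def
        by (rule sweedler_post[OF MT MT T.mult_linear_right[OF linear_id CC.pure_closed[OF p q]] bS b])
      also have "\<dots> = sweedler H T2 (\<lambda>c d. pure_tensor K H H (p \<otimes> S d) (q \<otimes> S c)) b"
        by (rule sweedler_cong[OF MT trilinear_bilinear(1)[OF tri2[OF p] q] _ b]) (simp add: BB.tensor_mult_pure p q)
      finally show ?thesis .
    qed
    \<comment> \<open>\<open>\<Sum> p S(b\<^sub>3) \<otimes> b\<^sub>1 S(b\<^sub>2) = p S(b) \<otimes> 1\<close>\<close>
    have collapse: "sweedler H T2 (\<lambda>q b'. pure_tensor K H H p q \<otimes>\<^bsub>T2\<^esub> r b') b = pure_tensor K H H (p \<otimes> S b) \<one>"
      if p: "p \<in> carrier H" and b: "b \<in> carrier H" for p b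
    proof -
      have h: "(\<lambda>d. pure_tensor K H H (p \<otimes> S d) \<one>) \<in> linear_maps K H T2"
        using p by (intro linear_bilinear_left[OF pb] mult_linear_right Sl) simp_all
      have "sweedler H T2 (\<lambda>q b'. pure_tensor K H H p q \<otimes>\<^bsub>T2\<^esub> r b') b
         = sweedler H T2 (\<lambda>q b'. sweedler H T2 (\<lambda>c d. pure_tensor K H H (p \<otimes> S d) (q \<otimes> S c)) b') b"
        by (rule sweedler_cong[OF MT trilinear_sweedler_right[OF MT tri2[OF p]] _ b]) (rule step[OF p])
      also have "\<dots> = sweedler H T2 (\<lambda>a d. sweedler H T2 (\<lambda>q c. pure_tensor K H H (p \<otimes> S d) (q \<otimes> S c)) a) b"
        by (rule sweedler_coassoc[OF MT tri2[OF p] b, symmetric])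
      also have "\<dots> = sweedler H T2 (\<lambda>a d. counit H a \<odot>\<^bsub>T2\<^esub> pure_tensor K H H (p \<otimes> S d) \<one>) b"
      proof (rule sweedler_cong[OF MT counit_smult_bilinear[OF MT h] _ b])
        fix a d assume a: "a \<in> carrier H" and d: "d \<in> carrier H"
        have "p \<otimes> S d \<in> carrier H" using p d by simp
        note g = linear_bilinear_right[OF pb linear_id this]
        have "sweedler H T2 (\<lambda>q c. pure_tensor K H H (p \<otimes> S d) (q \<otimes> S c)) a
          = pure_tensor K H H (p \<otimes> S d) (convolution H H (\<lambda>y. y) S a)"
          unfolding convolution_sweedler by (rule sweedler_post[OF M MT g HH.convolution_bilinear[OF idl Sl] a, symmetric])
        then show "sweedler H T2 (\<lambda>q c. pure_tensor K H H (p \<otimes> S d) (q \<otimes> S c)) a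
          = counit H a \<odot>\<^bsub>T2\<^esub> pure_tensor K H H (p \<otimes> S d) \<one>"
          using a p d by (simp add: S_right CC.pure_smult_right counit_closed)
      qed
      also have "\<dots> = pure_tensor K H H (p \<otimes> S b) \<one>"
        by (rule sweedler_counit_left[OF MT h b])
      finally show ?thesis .
    qed
    have bil: "(\<lambda>a b. comult H a \<otimes>\<^bsub>T2\<^esub> r b) \<in> bilinear_maps K H H T2" by (rule HT.convolution_bilinear[OF \<Delta> r])
    have h: "(\<lambda>y. pure_tensor K H H y \<one>) \<in> linear_maps K H T2"
      by (intro linear_bilinear_left[OF pb] linear_id) simp
    have "convolution H T2 (comult H) r x = sweedler H T2 (\<lambda>a b. sweedler H T2 (\<lambda>p q. pure_tensor K H H p q \<otimes>\<^bsub>T2\<^esub> r b) a) x"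
      unfolding convolution_sweedler
    proof (rule sweedler_cong[OF MT trilinear_sweedler_left[OF MT tri1] _ x])
      fix a b assume a: "a \<in> carrier H" and b: "b \<in> carrier H"
      have "comult H a \<otimes>\<^bsub>T2\<^esub> r b = sweedler H T2 (pure_tensor K H H) a \<otimes>\<^bsub>T2\<^esub> r b" by (simp add: sweedler_pure a)
      also have "\<dots> = sweedler H T2 (\<lambda>p q. pure_tensor K H H p q \<otimes>\<^bsub>T2\<^esub> r b) a"
        by (rule sweedler_post[OF MT MT T.mult_linear_left[OF linear_id lin_map[OF r b]] pb a])
      finally show "comult H a \<otimes>\<^bsub>T2\<^esub> r b = sweedler H T2 (\<lambda>p q. pure_tensor K H H p q \<otimes>\<^bsub>T2\<^esub> r b) a" .
    qed
    also have "\<dots> = sweedler H T2 (\<lambda>p b. sweedler H T2 (\<lambda>q b'. pure_tensor K H H p q \<otimes>\<^bsub>T2\<^esub> r b') b) x"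
      by (rule sweedler_coassoc[OF MT tri1 x])
    also have "\<dots> = sweedler H T2 (\<lambda>p b. pure_tensor K H H (p \<otimes> S b) \<one>) x"
      by (rule sweedler_cong[OF MT bilinear_post[OF h HH.convolution_bilinear[OF idl Sl]] _ x]) (rule collapse)
    also have "\<dots> = pure_tensor K H H (convolution H H (\<lambda>y. y) S x) \<one>"
      unfolding convolution_sweedler by (rule sweedler_post[OF M MT h HH.convolution_bilinear[OF idl Sl] x, symmetric])
    also have "\<dots> = HT.unit_map x"
      using x by (simp add: S_right T2_one CC.tensor_smult_pure counit_closed)
    finally show "convolution H T2 (comult H) r x = HT.unit_map x" .
  qed
  then show ?thesis by (simp add: r_def)
qed

end

section \<open>Subquotients of a bialgebra\<close>

lemma (in tensor_pair) tensor_lift_tensor_map: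
  assumes V': "module K V'" and W': "module K W'" and M: "module K M"
    and \<phi>: "\<phi> \<in> bilinear_maps K V' W' M" and f: "f \<in> linear_maps K V V'" and g: "g \<in> linear_maps K W W'"
    and X: "X \<in> carrier (tensor K V W)"
  shows "tensor_lift (add_monoid M) \<phi> (tensor_map K V' W' f g X) = tensor_lift (add_monoid M) (\<lambda>a b. \<phi> (f a) (g b)) X"
proof -
  interpret T': tensor_pair K V' W' using V' W' by (simp add: tensor_pair_def)
  note b1 = bilinear_comp[OF T'.pure_bilinear f g] and b2 = bilinear_comp[OF \<phi> f g]
  show ?thesis unfolding tensor_map_eq
    by (rule tensor_linear_eqI[OF M linear_comp[OF T'.tensor_lift_linear[OF M \<phi>] tensor_lift_linear[OF T'.tensor_module b1]]
          tensor_lift_linear[OF M b2] _ X])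
      (simp add: tensor_lift_pure[OF T'.tensor_module b1] tensor_lift_pure[OF M b2] T'.tensor_lift_pure[OF M \<phi>] lin_map[OF f] lin_map[OF g])
qed

lemma (in tensor_pair) tensor_map_linear:
  assumes V': "module K V'" and W': "module K W'"
    and f: "f \<in> linear_maps K V V'" and g: "g \<in> linear_maps K W W'"
  shows "tensor_map K V' W' f g \<in> linear_maps K (tensor K V W) (tensor K V' W')"
proof -
  interpret T': tensor_pair K V' W' using V' W' by (simp add: tensor_pair_def)
  show ?thesis unfolding tensor_map_eq by (rule tensor_lift_linear[OF T'.tensor_module bilinear_comp[OF T'.pure_bilinear f g]])
qed

text \<open>
  For a linear projection \<open>p\<close> of \<open>H\<close> onto a subspace, the structure of \<open>H\<close> is transported to the subspace
  along \<open>p\<close>. The tensor square of the subspace must exist before the comultiplication with values in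
  it can be given; hence the two steps.
\<close>

definition subquotient ::
  "('k, 'm) ring_scheme \<Rightarrow> ('k, 'a) bialg \<Rightarrow> ('a \<Rightarrow> 'a) \<Rightarrow> ('k, 'a) bialg" where
  "subquotient K H p =
    (let Q = H\<lparr>carrier := p ` carrier H, monoid.mult := (\<lambda>x y. p (x \<otimes>\<^bsub>H\<^esub> y)), one := p \<one>\<^bsub>H\<^esub>\<rparr>
     in Q\<lparr>comult := (\<lambda>x. tensor_map K Q Q p p (comult H x))\<rparr>)"

lemma subquotient_simps [simp]:
  "carrier (subquotient K H p) = p ` carrier H"
  "monoid.mult (subquotient K H p) = (\<lambda>x y. p (x \<otimes>\<^bsub>H\<^esub> y))"
  "one (subquotient K H p) = p \<one>\<^bsub>H\<^esub>"
  "ring.zero (subquotient K H p) = ring.zero H"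
  "ring.add (subquotient K H p) = ring.add H"
  "smult (subquotient K H p) = smult H"
  "counit (subquotient K H p) = counit H"
  by (simp_all add: subquotient_def)

lemma tensor_map_cong_module:
  assumes "carrier V = carrier V'" "ring.add V = ring.add V'" "smult V = smult V'"
  shows "tensor_map K V V f g = tensor_map K V' V' f g"
  by (simp add: tensor_map_def tensor_group_def tensor_kernel_def tensor_rels_def pure_tensor_def[abs_def] assms)

lemma comult_subquotient:
  "comult (subquotient K H p) x = tensor_map K (subquotient K H p) (subquotient K H p) p p (comult H x)"
  by (simp add: subquotient_def Let_def) (rule fun_cong[OF tensor_map_cong_module]; simp)

text \<open>
  \<open>E\<close> is a subalgebra and subcoalgebra, and \<open>p\<close> projects \<open>H\<close> onto a subspace of \<open>E\<close> in such a way that the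
  kernel of \<open>p\<close> on \<open>E\<close> is a biideal: the last three axioms say that \<open>p\<close> respects products, coproducts
  and the counit. If \<open>p\<close> is the identity on \<open>E\<close>, the resulting bialgebra is the subbialgebra \<open>E\<close>; if \<open>E\<close>
  is all of \<open>H\<close>, it is the quotient of \<open>H\<close> by the kernel of \<open>p\<close>.
\<close>

locale bialgebra_subquotient = bialgebra K H for K and H :: "('k, 'a) bialg" (structure) +
  fixes E p
  assumes E_coclosed: "coclosed K H E"
    and E_one: "\<one> \<in> E"
    and E_mult: "\<lbrakk>x \<in> E; y \<in> E\<rbrakk> \<Longrightarrow> x \<otimes> y \<in> E"
    and p_linear: "p \<in> linear_maps K H H"
    and p_in_E: "x \<in> carrier H \<Longrightarrow> p x \<in> E"
    and p_idem: "x \<in> carrier H \<Longrightarrow> p (p x) = p x"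
    and p_mult: "\<lbrakk>x \<in> E; y \<in> E\<rbrakk> \<Longrightarrow> p (p x \<otimes> p y) = p (x \<otimes> y)"
    and p_comult: "x \<in> E \<Longrightarrow> tensor_map K H H p p (comult H (p x)) = tensor_map K H H p p (comult H x)"
    and p_counit: "x \<in> E \<Longrightarrow> counit H (p x) = counit H x"
begin

abbreviation "Q \<equiv> subquotient K H p"

lemma E_carrier: "x \<in> E \<Longrightarrow> x \<in> carrier H"
  using E_coclosed by (auto simp: coclosed_def)

lemma p_closed [simp]: "x \<in> carrier H \<Longrightarrow> p x \<in> carrier H" by (rule lin_map[OF p_linear])

lemma Q_E: "x \<in> carrier Q \<Longrightarrow> x \<in> E" by (auto simp: p_in_E)
lemma Q_carrier: "x \<in> carrier Q \<Longrightarrow> x \<in> carrier H" by auto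
lemma Q_p: "x \<in> carrier Q \<Longrightarrow> p x = x" by (auto simp: p_idem)

lemma Q_module: "module K Q"
proof (intro moduleI abelian_groupI)
  show "cring K" by (rule is_cring)
  show "x \<oplus>\<^bsub>Q\<^esub> y \<in> carrier Q" if "x \<in> carrier Q" "y \<in> carrier Q" for x y
    using that by (auto simp: linear_add[OF p_linear, symmetric])
  show "\<zero>\<^bsub>Q\<^esub> \<in> carrier Q"
    using linear_zero[OF module_axioms module_axioms p_linear] by (auto simp: image_iff intro!: bexI[of _ "\<zero>"])
  show "a \<odot>\<^bsub>Q\<^esub> x \<in> carrier Q" if "a \<in> carrier K" "x \<in> carrier Q" for a x
    using that by (auto simp: linear_smult[OF p_linear, symmetric])
  show "\<exists>y\<in>carrier Q. y \<oplus>\<^bsub>Q\<^esub> x = \<zero>\<^bsub>Q\<^esub>" if x: "x \<in> carrier Q" for x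
  proof -
    have "\<ominus> x = p (\<ominus> x)"
      using linear_uminus[OF module_axioms module_axioms p_linear Q_carrier[OF x]] by (simp add: Q_p[OF x])
    then show ?thesis using Q_carrier[OF x] by (intro bexI[of _ "\<ominus> x"]) (auto simp: M.l_neg)
  qed
qed (auto simp: M.a_ac smult_l_distr smult_r_distr smult_assoc1)

lemma p_linear_Q: "p \<in> linear_maps K H Q"
  by (rule linear_mapsI) (simp_all add: linear_add[OF p_linear] linear_smult[OF p_linear])

lemma inclusion_linear: "(\<lambda>x. x) \<in> linear_maps K Q H"
  by (rule linear_mapsI) auto

lemma Q_mult_bilinear: "monoid.mult Q \<in> bilinear_maps K Q Q Q"
  using linear_comp[OF p_linear_Q mult_linear_left[OF inclusion_linear]]
    linear_comp[OF p_linear_Q mult_linear_right[OF inclusion_linear]]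
  by (intro bilinearI) auto

lemma Q_assoc_algebra: "assoc_algebra K Q"
proof (rule assoc_algebraI[OF Q_module Q_mult_bilinear])
  fix x y z assume x: "x \<in> carrier Q" and y: "y \<in> carrier Q" and z: "z \<in> carrier Q"
  note E = x[THEN Q_E] y[THEN Q_E] z[THEN Q_E] and c = x[THEN Q_carrier] y[THEN Q_carrier] z[THEN Q_carrier]
  have "p (p (x \<otimes> y) \<otimes> z) = p (x \<otimes> y \<otimes> z)"
    using p_mult[OF E_mult[OF E(1,2)] E(3)] by (simp add: Q_p[OF z])
  moreover have "p (x \<otimes> p (y \<otimes> z)) = p (x \<otimes> (y \<otimes> z))"
    using p_mult[OF E(1) E_mult[OF E(2,3)]] by (simp add: Q_p[OF x])
  ultimately show "x \<otimes>\<^bsub>Q\<^esub> y \<otimes>\<^bsub>Q\<^esub> z = x \<otimes>\<^bsub>Q\<^esub> (y \<otimes>\<^bsub>Q\<^esub> z)"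
    using c by (simp add: m_assoc)
next
  fix x assume x: "x \<in> carrier Q"
  note c = Q_carrier[OF x]
  show "\<one>\<^bsub>Q\<^esub> \<otimes>\<^bsub>Q\<^esub> x = x" "x \<otimes>\<^bsub>Q\<^esub> \<one>\<^bsub>Q\<^esub> = x"
    using p_mult[OF E_one Q_E[OF x]] p_mult[OF Q_E[OF x] E_one] c by (simp_all add: Q_p[OF x])
qed simp

lemma pp_bilinear: "\<phi> \<in> bilinear_maps K Q Q M \<Longrightarrow> (\<lambda>a b. \<phi> (p a) (p b)) \<in> bilinear_maps K H H M"
  by (rule bilinear_comp[OF _ p_linear_Q p_linear_Q])

lemma sweedler_Q:
  assumes M: "module K M" and \<phi>: "\<phi> \<in> bilinear_maps K Q Q M" and x: "x \<in> carrier H"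
  shows "sweedler Q M \<phi> x = sweedler H M (\<lambda>a b. \<phi> (p a) (p b)) x"
  by (simp add: sweedler_def comult_subquotient
     CC.tensor_lift_tensor_map[OF Q_module Q_module M \<phi> p_linear_Q p_linear_Q comult_closed[OF x]])

text \<open>
  A Sweedler sum in the subquotient is a Sweedler sum in \<open>H\<close>. Every law for \<open>Q\<close> is reduced in this way to
  the law for \<open>H\<close>.
\<close>

lemma sweedler_Q_p:
  assumes M: "module K M" and \<phi>: "\<phi> \<in> bilinear_maps K Q Q M" and x: "x \<in> E"
  shows "sweedler Q M \<phi> (p x) = sweedler H M (\<lambda>a b. \<phi> (p a) (p b)) x"
proof -
  note pp = pp_bilinear[OF \<phi>]
  have *: "tensor_lift (add_monoid M) (\<lambda>a b. \<phi> (p a) (p b)) (comult H y)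
     = tensor_lift (add_monoid M) (\<lambda>a b. \<phi> (p a) (p b)) (tensor_map K H H p p (comult H y))"
    if y: "y \<in> carrier H" for y
    unfolding CC.tensor_lift_tensor_map[OF module_axioms module_axioms M pp p_linear p_linear comult_closed[OF y]]
    using sweedler_cong[OF M pp _ y, of "\<lambda>a b. \<phi> (p (p a)) (p (p b))"] by (simp add: sweedler_def p_idem)
  have "sweedler Q M \<phi> (p x) = sweedler H M (\<lambda>a b. \<phi> (p a) (p b)) (p x)"
    by (rule sweedler_Q[OF M \<phi>]) (simp add: E_carrier x)
  also have "\<dots> = sweedler H M (\<lambda>a b. \<phi> (p a) (p b)) x"
    using *[of "p x"] *[of x] x by (simp add: E_carrier sweedler_def p_comult)
  finally show ?thesis .
qed

lemma Q_comult_linear: "comult Q \<in> linear_maps K Q (tensor K Q Q)"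
proof -
  have "(\<lambda>x. tensor_map K Q Q p p (comult H x)) \<in> linear_maps K Q (tensor K Q Q)"
    by (rule linear_comp[OF CC.tensor_map_linear[OF Q_module Q_module p_linear_Q p_linear_Q] linear_comp[OF comult_linear inclusion_linear]])
  then show ?thesis by (simp add: comult_subquotient[abs_def])
qed

lemma Q_counit_linear: "counit Q \<in> linear_maps K Q (regular_module K)"
  using linear_comp[OF counit_linear inclusion_linear] by simp

interpretation Q: comultiplication K Q
  by (simp add: comultiplication_def comultiplication_axioms_def Q_module Q_comult_linear)

lemma Q_comult_p:
  assumes x: "x \<in> E"
  shows "comult Q (p x) = sweedler H (tensor K Q Q) (\<lambda>a b. pure_tensor K Q Q (p a) (p b)) x"
  using Q.sweedler_pure[of "p x"] x E_carrier[OF x]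
  by (simp add: sweedler_Q_p[OF Q.CC.tensor_module Q.CC.pure_bilinear])

text \<open>
  The law for \<open>H\<close>, applied to the trilinear map \<open>p a \<otimes> (p b \<otimes> p c)\<close>. In the nested sums \<open>p\<close> can be removed
  from the argument of the inner comultiplication because the outer components may be taken in \<open>E\<close>.
\<close>

lemma Q_coassoc:
  assumes x: "x \<in> carrier Q"
  shows "tensor_assoc K Q Q Q (tensor_map K (tensor K Q Q) Q (comult Q) (\<lambda>c. c) (comult Q x))
      = tensor_map K Q (tensor K Q Q) (\<lambda>c. c) (comult Q) (comult Q x)"
proof -
  let ?T = "tensor K Q Q" and ?T3 = "tensor K Q (tensor K Q Q)"
  note M3 = Q.C_CC.tensor_module and xE = Q_E[OF x] and xH = Q_carrier[OF x] and tri = Q.pure3_trilinear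
  have tri': "(\<lambda>a b c. Q.pure3 (p a) (p b) (p c)) \<in> trilinear_maps K H ?T3"
    using trilinearD[OF tri]
    by (intro trilinearI linear_comp[OF _ p_linear_Q, of "\<lambda>a. Q.pure3 a _ _"]
      linear_comp[OF _ p_linear_Q, of "\<lambda>a. Q.pure3 _ a _"] linear_comp[OF _ p_linear_Q, of "\<lambda>a. Q.pure3 _ _ a"]) auto
  have "tensor_assoc K Q Q Q (tensor_map K ?T Q (comult Q) (\<lambda>c. c) (comult Q x))
     = sweedler Q ?T3 (\<lambda>a b. sweedler Q ?T3 (\<lambda>c d. Q.pure3 c d b) a) x"
    by (rule Q.comult_left_sweedler[OF x])
  also have "\<dots> = sweedler H ?T3 (\<lambda>a b. sweedler Q ?T3 (\<lambda>c d. Q.pure3 c d (p b)) (p a)) x"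
    by (rule sweedler_Q[OF M3 Q.trilinear_sweedler_left[OF M3 tri] xH])
  also have "\<dots> = sweedler H ?T3 (\<lambda>a b. sweedler H ?T3 (\<lambda>c d. Q.pure3 (p c) (p d) (p b)) a) x"
  proof (rule sweedler_cong_coclosed[OF M3 E_coclosed _ trilinear_sweedler_left[OF M3 tri'] _ xE])
    show "(\<lambda>a b. sweedler Q ?T3 (\<lambda>c d. Q.pure3 c d (p b)) (p a)) \<in> bilinear_maps K H H ?T3"
      by (rule pp_bilinear[OF Q.trilinear_sweedler_left[OF M3 tri]])
    show "sweedler Q ?T3 (\<lambda>c d. Q.pure3 c d (p b)) (p a) = sweedler H ?T3 (\<lambda>c d. Q.pure3 (p c) (p d) (p b)) a"
      if "a \<in> E" "b \<in> E" for a b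
      using that by (intro sweedler_Q_p[OF M3 trilinear_bilinear(2)[OF tri]]) (simp_all add: E_carrier)
  qed
  also have "\<dots> = sweedler H ?T3 (\<lambda>a b. sweedler H ?T3 (\<lambda>c d. Q.pure3 (p a) (p c) (p d)) b) x"
    by (rule sweedler_coassoc[OF M3 tri' xH])
  also have "\<dots> = sweedler H ?T3 (\<lambda>a b. pure_tensor K Q ?T (p a) (comult Q (p b))) x"
  proof (rule sweedler_cong_coclosed[OF M3 E_coclosed trilinear_sweedler_right[OF M3 tri'] _ _ xE])
    show "(\<lambda>a b. pure_tensor K Q ?T (p a) (comult Q (p b))) \<in> bilinear_maps K H H ?T3"
      by (rule bilinear_comp[OF Q.C_CC.pure_bilinear p_linear_Q linear_comp[OF Q_comult_linear p_linear_Q]])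
    fix a b assume a: "a \<in> E" and b: "b \<in> E"
    then have pa: "p a \<in> carrier Q" by (simp add: E_carrier)
    have "pure_tensor K Q ?T (p a) (comult Q (p b)) = pure_tensor K Q ?T (p a) (sweedler H ?T (\<lambda>c d. pure_tensor K Q Q (p c) (p d)) b)"
      by (simp only: Q_comult_p[OF b])
    also have "\<dots> = sweedler H ?T3 (\<lambda>c d. Q.pure3 (p a) (p c) (p d)) b"
      by (rule sweedler_post[OF Q.CC.tensor_module M3 linear_bilinear_right[OF Q.C_CC.pure_bilinear linear_id pa]
           pp_bilinear[OF Q.CC.pure_bilinear] E_carrier[OF b]])
    finally show "sweedler H ?T3 (\<lambda>c d. Q.pure3 (p a) (p c) (p d)) b = pure_tensor K Q ?T (p a) (comult Q (p b))" by simp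
  qed
  also have "\<dots> = sweedler Q ?T3 (\<lambda>a b. pure_tensor K Q ?T a (comult Q b)) x"
    by (rule sweedler_Q[OF M3 bilinear_comp[OF Q.C_CC.pure_bilinear linear_id Q_comult_linear] xH, symmetric])
  also have "\<dots> = tensor_map K Q ?T (\<lambda>c. c) (comult Q) (comult Q x)"
    by (rule Q.comult_right_sweedler[symmetric])
  finally show ?thesis .
qed

lemma Q_counit_laws:
  assumes x: "x \<in> carrier Q"
  shows "tensor_lift (add_monoid Q) (\<lambda>c d. counit Q c \<odot>\<^bsub>Q\<^esub> d) (comult Q x) = x"
    and "tensor_lift (add_monoid Q) (\<lambda>c d. counit Q d \<odot>\<^bsub>Q\<^esub> c) (comult Q x) = x"
proof -
  interpret QM: module K Q by (rule Q_module)
  note xE = Q_E[OF x] and xH = Q_carrier[OF x]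
  have "(\<lambda>c. counit Q c \<odot>\<^bsub>Q\<^esub> d) \<in> linear_maps K Q Q" if "d \<in> carrier Q" for d
    using linear_comp[OF counit_smult_linear[OF Q_module that] inclusion_linear] by simp
  moreover have "(\<lambda>d. counit Q c \<odot>\<^bsub>Q\<^esub> d) \<in> linear_maps K Q Q" if "c \<in> carrier Q" for c
    using counit_closed[OF Q_carrier[OF that]]
    by (intro linear_mapsI) (auto simp: smult_r_distr smult_assoc1[symmetric] m_comm linear_smult[OF p_linear, symmetric])
  ultimately have b: "(\<lambda>c d. counit Q c \<odot>\<^bsub>Q\<^esub> d) \<in> bilinear_maps K Q Q Q" by (rule bilinearI)
  note b' = bilinear_flip[OF b]
  note bp = counit_smult_bilinear[OF Q_module p_linear_Q] and bp' = bilinear_flip[OF counit_smult_bilinear[OF Q_module p_linear_Q]]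
  have "sweedler Q Q (\<lambda>c d. counit Q c \<odot>\<^bsub>Q\<^esub> d) x = sweedler H Q (\<lambda>a b. counit Q (p a) \<odot>\<^bsub>Q\<^esub> p b) x"
    by (rule sweedler_Q[OF Q_module b xH])
  also have "\<dots> = sweedler H Q (\<lambda>a b. counit H a \<odot>\<^bsub>Q\<^esub> p b) x"
    by (rule sweedler_cong_coclosed[OF Q_module E_coclosed pp_bilinear[OF b] bp _ xE]) (simp add: p_counit)
  also have "\<dots> = x" by (simp only: sweedler_counit_left[OF Q_module p_linear_Q xH] Q_p[OF x])
  finally show "tensor_lift (add_monoid Q) (\<lambda>c d. counit Q c \<odot>\<^bsub>Q\<^esub> d) (comult Q x) = x" by (simp only: sweedler_def)
  have "sweedler Q Q (\<lambda>c d. counit Q d \<odot>\<^bsub>Q\<^esub> c) x = sweedler H Q (\<lambda>a b. counit Q (p b) \<odot>\<^bsub>Q\<^esub> p a) x"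
    by (rule sweedler_Q[OF Q_module b' xH])
  also have "\<dots> = sweedler H Q (\<lambda>a b. counit H b \<odot>\<^bsub>Q\<^esub> p a) x"
    by (rule sweedler_cong_coclosed[OF Q_module E_coclosed pp_bilinear[OF b'] bp' _ xE]) (simp add: p_counit)
  also have "\<dots> = x" by (simp only: sweedler_counit_right[OF Q_module p_linear_Q xH] Q_p[OF x])
  finally show "tensor_lift (add_monoid Q) (\<lambda>c d. counit Q d \<odot>\<^bsub>Q\<^esub> c) (comult Q x) = x" by (simp only: sweedler_def)
qed

lemma Q_comult_mult:
  assumes x: "x \<in> carrier Q" and y: "y \<in> carrier Q"
  shows "comult Q (x \<otimes>\<^bsub>Q\<^esub> y) = comult Q x \<otimes>\<^bsub>tensor K Q Q\<^esub> comult Q y"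
proof -
  let ?T = "tensor K Q Q" and ?\<pi> = "\<lambda>a b. pure_tensor K Q Q (p a) (p b)"
  interpret QA: assoc_algebra K Q by (rule Q_assoc_algebra)
  interpret QQ: tensor_algebras K Q Q ..
  interpret T: assoc_algebra K ?T by (rule QQ.tensor_assoc_algebra)
  note MT = Q.CC.tensor_module and E = x[THEN Q_E] y[THEN Q_E] and H = x[THEN Q_carrier] y[THEN Q_carrier]
  note \<pi> = pp_bilinear[OF Q.CC.pure_bilinear]
  have \<Delta>: "comult Q z = sweedler H ?T ?\<pi> z" if "z \<in> carrier Q" for z
    using Q_comult_p[OF Q_E[OF that]] by (simp only: Q_p[OF that])
  have \<pi>E: "?\<pi> (a \<otimes> c) (b \<otimes> d) = ?\<pi> a b \<otimes>\<^bsub>?T\<^esub> ?\<pi> c d" if "a \<in> E" "b \<in> E" "c \<in> E" "d \<in> E" for a b c d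
    using that by (subst QQ.tensor_mult_pure) (simp_all add: E_carrier p_mult)
  have br: "(\<lambda>c d. ?\<pi> a b \<otimes>\<^bsub>?T\<^esub> ?\<pi> c d) \<in> bilinear_maps K H H ?T" if "a \<in> carrier H" "b \<in> carrier H" for a b
    using that by (intro bilinear_post[OF T.mult_linear_right[OF linear_id] \<pi>] Q.CC.pure_closed) simp_all
  have bl: "(\<lambda>a b. ?\<pi> a b \<otimes>\<^bsub>?T\<^esub> comult Q y) \<in> bilinear_maps K H H ?T"
    by (rule bilinear_post[OF T.mult_linear_left[OF linear_id Q.comult_closed[OF y]] \<pi>])
  have "comult Q (x \<otimes>\<^bsub>Q\<^esub> y) = sweedler H ?T ?\<pi> (x \<otimes> y)"
    using Q_comult_p[OF E_mult[OF E]] by simp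
  also have "\<dots> = sweedler H ?T (\<lambda>a b. sweedler H ?T (\<lambda>c d. ?\<pi> (a \<otimes> c) (b \<otimes> d)) y) x"
    by (rule sweedler_mult[OF MT \<pi> H])
  also have "\<dots> = sweedler H ?T (\<lambda>a b. ?\<pi> a b \<otimes>\<^bsub>?T\<^esub> comult Q y) x"
  proof (rule sweedler_cong_coclosed[OF MT E_coclosed _ bl _ E(1)])
    show "(\<lambda>a b. sweedler H ?T (\<lambda>c d. ?\<pi> (a \<otimes> c) (b \<otimes> d)) y) \<in> bilinear_maps K H H ?T"
      using sweedler_mult_inner_bilinear[OF MT \<pi> comult_closed[OF H(2)]] by (simp only: sweedler_def)
    fix a b assume ab: "a \<in> E" "b \<in> E"
    have "sweedler H ?T (\<lambda>c d. ?\<pi> (a \<otimes> c) (b \<otimes> d)) y = sweedler H ?T (\<lambda>c d. ?\<pi> a b \<otimes>\<^bsub>?T\<^esub> ?\<pi> c d) y"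
      by (rule sweedler_cong_coclosed[OF MT E_coclosed _ br _ E(2)])
       (use ab \<pi>E in \<open>auto intro!: bilinear_comp[OF \<pi>] mult_linear_right linear_id simp: E_carrier\<close>)
    also have "\<dots> = ?\<pi> a b \<otimes>\<^bsub>?T\<^esub> sweedler H ?T ?\<pi> y"
      using ab by (intro sweedler_post[OF MT MT T.mult_linear_right[OF linear_id] \<pi> H(2), symmetric] Q.CC.pure_closed) (simp_all add: E_carrier)
    finally show "sweedler H ?T (\<lambda>c d. ?\<pi> (a \<otimes> c) (b \<otimes> d)) y = ?\<pi> a b \<otimes>\<^bsub>?T\<^esub> comult Q y"
      by (simp only: \<Delta>[OF y])
  qed
  also have "\<dots> = sweedler H ?T ?\<pi> x \<otimes>\<^bsub>?T\<^esub> comult Q y"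
    by (rule sweedler_post[OF MT MT T.mult_linear_left[OF linear_id Q.comult_closed[OF y]] \<pi> H(1), symmetric])
  finally show ?thesis by (simp only: \<Delta>[OF x])
qed

lemma Q_bialgebra: "bialgebra K Q"
proof -
  interpret QA: assoc_algebra K Q by (rule Q_assoc_algebra)
  have co: "coalgebra K Q"
    by (intro coalgebra.intro Q_module coalgebra_axioms.intro Q_comult_linear Q_counit_linear Q_coassoc Q_counit_laws)
  have "comult Q \<one>\<^bsub>Q\<^esub> = pure_tensor K Q Q \<one>\<^bsub>Q\<^esub> \<one>\<^bsub>Q\<^esub>"
    using Q_comult_p[OF E_one] CC.tensor_lift_pure[OF Q.CC.tensor_module pp_bilinear[OF Q.CC.pure_bilinear] one_closed one_closed]
    by (simp add: sweedler_def comult_one)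
  then have c1: "comult Q \<in> ring_hom Q (tensor K Q Q)"
    using Q_comult_mult linear_add[OF Q_comult_linear] Q.comult_closed
    by (intro ring_hom_memI) (simp_all add: tensor_def del: subquotient_simps)
  have c2: "counit Q \<in> ring_hom Q K"
    using counit_ring_hom
    by (intro ring_hom_memI) (auto simp: counit_closed p_counit E_mult p_in_E counit_mult counit_one E_one ring_hom_def)
  show ?thesis
    by (intro bialgebra.intro field_axioms QA.assoc_algebra_axioms co bialgebra_axioms.intro c1 c2)
qed

lemma Q_antipode:
  assumes S: "antipode K H S" and SE: "\<And>x. x \<in> E \<Longrightarrow> S x \<in> E"
    and pS: "\<And>x. x \<in> E \<Longrightarrow> p (S (p x)) = p (S x)"
  shows "antipode K Q (\<lambda>x. p (S x))"
proof -
  interpret hopf K H S by unfold_locales (rule S)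
  interpret QA: assoc_algebra K Q by (rule Q_assoc_algebra)
  have Sl: "(\<lambda>x. p (S x)) \<in> linear_maps K Q Q"
    by (rule linear_comp[OF p_linear_Q linear_comp[OF S_linear inclusion_linear]])
  have lin: "(\<lambda>x. x) \<in> linear_maps K Q Q" by (rule linear_id)
  note bS = QA.mult_bilinear_comp[OF Sl lin] and bS' = QA.mult_bilinear_comp[OF lin Sl]
  show ?thesis
    unfolding antipode_def
  proof (intro conjI ballI Sl)
    fix x assume x: "x \<in> carrier Q"
    note xE = Q_E[OF x] and xH = Q_carrier[OF x]
    have e: "p (counit H x \<odot> \<one>) = counit Q x \<odot>\<^bsub>Q\<^esub> \<one>\<^bsub>Q\<^esub>"
      by (simp add: linear_smult[OF p_linear] counit_closed[OF xH])
    have "convolution Q Q (\<lambda>x. p (S x)) (\<lambda>y. y) x = sweedler H Q (\<lambda>a b. p (S (p a)) \<otimes>\<^bsub>Q\<^esub> p b) x"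
      unfolding convolution_sweedler by (rule sweedler_Q[OF Q_module bS xH])
    also have "\<dots> = sweedler H Q (\<lambda>a b. p (S a \<otimes> b)) x"
      by (rule sweedler_cong_coclosed[OF Q_module E_coclosed pp_bilinear[OF bS] bilinear_post[OF p_linear_Q HH.convolution_bilinear[OF S_linear linear_id]] _ xE])
        (simp add: pS p_mult SE)
    also have "\<dots> = p (convolution H H S (\<lambda>y. y) x)"
      unfolding convolution_sweedler
      by (rule sweedler_post[OF module_axioms Q_module p_linear_Q HH.convolution_bilinear[OF S_linear linear_id] xH, symmetric])
    finally show "convolution Q Q (\<lambda>x. p (S x)) (\<lambda>y. y) x = counit Q x \<odot>\<^bsub>Q\<^esub> \<one>\<^bsub>Q\<^esub>"
      by (simp only: S_left[OF xH] e)
    have "convolution Q Q (\<lambda>y. y) (\<lambda>x. p (S x)) x = sweedler H Q (\<lambda>a b. p a \<otimes>\<^bsub>Q\<^esub> p (S (p b))) x"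
      unfolding convolution_sweedler by (rule sweedler_Q[OF Q_module bS' xH])
    also have "\<dots> = sweedler H Q (\<lambda>a b. p (a \<otimes> S b)) x"
      by (rule sweedler_cong_coclosed[OF Q_module E_coclosed pp_bilinear[OF bS'] bilinear_post[OF p_linear_Q HH.convolution_bilinear[OF linear_id S_linear]] _ xE])
        (simp add: pS p_mult SE)
    also have "\<dots> = p (convolution H H (\<lambda>y. y) S x)"
      unfolding convolution_sweedler
      by (rule sweedler_post[OF module_axioms Q_module p_linear_Q HH.convolution_bilinear[OF linear_id S_linear] xH, symmetric])
    finally show "convolution Q Q (\<lambda>y. y) (\<lambda>x. p (S x)) x = counit Q x \<odot>\<^bsub>Q\<^esub> \<one>\<^bsub>Q\<^esub>"
      by (simp only: S_right[OF xH] e)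
  qed
qed

lemma Q_hopf_algebra:
  assumes S: "antipode K H S" and SE: "\<And>x. x \<in> E \<Longrightarrow> S x \<in> E"
    and pS: "\<And>x. x \<in> E \<Longrightarrow> p (S (p x)) = p (S x)"
  shows "hopf_algebra K Q"
proof -
  have "antipode K Q (\<lambda>x. p (S x))" by (rule Q_antipode[OF S]) (simp_all add: SE pS)
  with Q_bialgebra show ?thesis unfolding hopf_algebra_def by blast
qed

lemma Q_bijective_antipode:
  assumes S: "antipode K H S" and SE: "\<And>x. x \<in> E \<Longrightarrow> S x \<in> E"
    and pS: "\<And>x. x \<in> E \<Longrightarrow> p (S (p x)) = p (S x)"
    and TE: "\<And>x. x \<in> E \<Longrightarrow> T x \<in> E" and pT: "\<And>x. x \<in> E \<Longrightarrow> p (T (p x)) = p (T x)"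
    and ST: "\<And>x. x \<in> carrier H \<Longrightarrow> S (T x) = x" and TS: "\<And>x. x \<in> carrier H \<Longrightarrow> T (S x) = x"
  shows "bijective_antipode K Q"
proof -
  have "antipode K Q (\<lambda>x. p (S x))" by (rule Q_antipode[OF S]) (simp_all add: SE pS)
  moreover have "bij_betw (\<lambda>x. p (S x)) (carrier Q) (carrier Q)"
  proof (rule bij_betw_byWitness[where f' = "\<lambda>x. p (T x)"])
    have cl: "p y \<in> carrier Q" if "y \<in> E" for y
      using E_carrier[OF that] by simp
    show "\<forall>x\<in>carrier Q. p (T (p (S x))) = x"
    proof
      fix x assume x: "x \<in> carrier Q"
      show "p (T (p (S x))) = x" using pT[OF SE[OF Q_E[OF x]]] TS[OF Q_carrier[OF x]] Q_p[OF x] by argo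
    qed
    show "\<forall>x\<in>carrier Q. p (S (p (T x))) = x"
    proof
      fix x assume x: "x \<in> carrier Q"
      show "p (S (p (T x))) = x" using pS[OF TE[OF Q_E[OF x]]] ST[OF Q_carrier[OF x]] Q_p[OF x] by argo
    qed
    show "(\<lambda>x. p (S x)) ` carrier Q \<subseteq> carrier Q"
      by (rule image_subsetI) (rule cl[OF SE[OF Q_E]])
    show "(\<lambda>x. p (T x)) ` carrier Q \<subseteq> carrier Q"
      by (rule image_subsetI) (rule cl[OF TE[OF Q_E]])
  qed
  ultimately show ?thesis unfolding bijective_antipode_def by blast
qed

end

section \<open>Homomorphisms and subquotients\<close>

lemma bialg_homD:
  assumes "f \<in> bialg_hom K A B"
  shows "f \<in> extensional (carrier A)" "f \<in> linear_maps K A B"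
    and "\<And>x y. x \<in> carrier A \<Longrightarrow> y \<in> carrier A \<Longrightarrow> f (x \<otimes>\<^bsub>A\<^esub> y) = f x \<otimes>\<^bsub>B\<^esub> f y"
    and "f \<one>\<^bsub>A\<^esub> = \<one>\<^bsub>B\<^esub>"
    and "\<And>x. x \<in> carrier A \<Longrightarrow> comult B (f x) = tensor_map K B B f f (comult A x)"
    and "\<And>x. x \<in> carrier A \<Longrightarrow> counit B (f x) = counit A x"
    and "\<And>x. x \<in> carrier A \<Longrightarrow> f x \<in> carrier B"
  using assms by (auto simp: bialg_hom_def ring_hom_def)

lemma bialg_homI:
  assumes "f \<in> extensional (carrier A)" "f \<in> linear_maps K A B"
    and "\<And>x y. x \<in> carrier A \<Longrightarrow> y \<in> carrier A \<Longrightarrow> f (x \<otimes>\<^bsub>A\<^esub> y) = f x \<otimes>\<^bsub>B\<^esub> f y"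
    and "f \<one>\<^bsub>A\<^esub> = \<one>\<^bsub>B\<^esub>"
    and "\<And>x. x \<in> carrier A \<Longrightarrow> comult B (f x) = tensor_map K B B f f (comult A x)"
    and "\<And>x. x \<in> carrier A \<Longrightarrow> counit B (f x) = counit A x"
  shows "f \<in> bialg_hom K A B"
  using assms by (auto simp: bialg_hom_def ring_hom_def lin_map linear_add)

lemma sweedler_bialg_hom:
  assumes "bialgebra K A" "bialgebra K B" and f: "f \<in> bialg_hom K A B"
    and M: "module K M" and \<phi>: "\<phi> \<in> bilinear_maps K B B M" and x: "x \<in> carrier A"
  shows "sweedler B M \<phi> (f x) = sweedler A M (\<lambda>a b. \<phi> (f a) (f b)) x"
proof -
  interpret A: bialgebra K A by fact
  interpret B: bialgebra K B by fact
  show ?thesis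
    by (simp add: sweedler_def bialg_homD(5)[OF f x]
      A.CC.tensor_lift_tensor_map[OF B.module_axioms B.module_axioms M \<phi> bialg_homD(2)[OF f] bialg_homD(2)[OF f] A.comult_closed[OF x]])
qed

context bialgebra_subquotient
begin

lemma inclusion_bialg_hom:
  assumes pE: "\<And>x. x \<in> E \<Longrightarrow> p x = x"
  shows "(\<lambda>x\<in>carrier Q. x) \<in> bialg_hom K Q H"
proof (rule bialg_homI)
  interpret Q: bialgebra K Q by (rule Q_bialgebra)
  let ?i = "\<lambda>x\<in>carrier Q. x"
  show i: "?i \<in> linear_maps K Q H" by (rule linear_cong[OF Q_module inclusion_linear]) simp
  fix x assume x: "x \<in> carrier Q"
  note xE = Q_E[OF x] and xH = Q_carrier[OF x]
  have EQ: "e \<in> carrier Q" if "e \<in> E" for e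
    using pE[OF that] E_carrier[OF that] by (metis imageI subquotient_simps(1))
  have b: "(\<lambda>a b. pure_tensor K H H (?i a) (?i b)) \<in> bilinear_maps K Q Q T2"
    by (rule bilinear_comp[OF CC.pure_bilinear i i])
  have "tensor_map K H H ?i ?i (comult Q x) = sweedler Q T2 (\<lambda>a b. pure_tensor K H H (?i a) (?i b)) x"
    by (simp add: tensor_map_eq sweedler_def)
  also have "\<dots> = sweedler H T2 (\<lambda>a b. pure_tensor K H H (?i (p a)) (?i (p b))) x"
    by (rule sweedler_Q[OF CC.tensor_module b xH])
  also have "\<dots> = sweedler H T2 (pure_tensor K H H) x"
    by (rule sweedler_cong_coclosed[OF CC.tensor_module E_coclosed pp_bilinear[OF b] CC.pure_bilinear _ xE])
      (simp add: pE EQ del: subquotient_simps)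
  finally show "comult H (?i x) = tensor_map K H H ?i ?i (comult Q x)"
    using x xH by (simp add: sweedler_pure)
next
  fix x y assume x: "x \<in> carrier Q" and y: "y \<in> carrier Q"
  then have xy: "x \<otimes> y \<in> E" by (intro E_mult Q_E)
  then have "x \<otimes> y \<in> carrier Q" using pE[OF xy] E_carrier[OF xy] by (auto simp: image_iff intro!: bexI[of _ "x \<otimes> y"])
  then show "(\<lambda>x\<in>carrier Q. x) (x \<otimes>\<^bsub>Q\<^esub> y) = (\<lambda>x\<in>carrier Q. x) x \<otimes> (\<lambda>x\<in>carrier Q. x) y"
    using x y pE[OF xy] by simp
qed (use imageI[of "\<one>" "carrier H" p] pE[OF E_one] in auto)

lemma corestrict_bialg_hom:
  assumes B: "bialgebra K B" and h: "h \<in> bialg_hom K B H"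
    and hE: "\<And>x. x \<in> carrier B \<Longrightarrow> p (h x) = h x"
  shows "h \<in> bialg_hom K B Q"
proof -
  interpret B: bialgebra K B by (rule B)
  note hD = bialg_homD[OF h]
  show ?thesis
  proof (rule bialg_homI)
    show "h \<in> extensional (carrier B)" by (rule hD)
    show hl: "h \<in> linear_maps K B Q"
      by (rule linear_cong[OF B.module_axioms linear_comp[OF p_linear_Q hD(2)]]) (simp add: hE)
    fix x assume x: "x \<in> carrier B"
    interpret QQ: tensor_pair K Q Q by (simp add: tensor_pair_def Q_module)
    have "comult Q (h x) = sweedler H (tensor K Q Q) (\<lambda>a b. pure_tensor K Q Q (p a) (p b)) (h x)"
      by (simp only: comult_subquotient tensor_map_eq sweedler_def)
    also have "\<dots> = sweedler B (tensor K Q Q) (\<lambda>a b. pure_tensor K Q Q (p (h a)) (p (h b))) x"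
      by (rule sweedler_bialg_hom[OF B bialgebra_axioms h QQ.tensor_module pp_bilinear[OF QQ.pure_bilinear] x])
    also have "\<dots> = sweedler B (tensor K Q Q) (\<lambda>a b. pure_tensor K Q Q (h a) (h b)) x"
      by (rule B.sweedler_cong[OF QQ.tensor_module bilinear_comp[OF QQ.pure_bilinear hl hl] _ x]) (simp add: hE)
    finally show "comult Q (h x) = tensor_map K Q Q h h (comult B x)"
      by (simp only: tensor_map_eq sweedler_def)
    show "counit Q (h x) = counit B x" by (simp add: hD x)
  next
    fix x y assume "x \<in> carrier B" "y \<in> carrier B"
    then show "h (x \<otimes>\<^bsub>B\<^esub> y) = h x \<otimes>\<^bsub>Q\<^esub> h y"
      using B.m_closed hE by (simp add: bialg_homD(3)[OF h, symmetric])
  next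
    show "h \<one>\<^bsub>B\<^esub> = \<one>\<^bsub>Q\<^esub>" using hE[OF B.one_closed] by (simp add: bialg_homD(4)[OF h])
  qed
qed

lemma projection_bialg_hom:
  assumes E: "E = carrier H"
  shows "(\<lambda>x\<in>carrier H. p x) \<in> bialg_hom K H Q"
proof (rule bialg_homI)
  let ?q = "\<lambda>x\<in>carrier H. p x"
  interpret QQ: tensor_pair K Q Q by (simp add: tensor_pair_def Q_module)
  show q: "?q \<in> linear_maps K H Q" by (rule linear_cong[OF module_axioms p_linear_Q]) simp
  fix x assume x: "x \<in> carrier H"
  have "comult Q (?q x) = sweedler H (tensor K Q Q) (\<lambda>a b. pure_tensor K Q Q (p a) (p b)) x"
    using x by (simp add: Q_comult_p E)
  also have "\<dots> = sweedler H (tensor K Q Q) (\<lambda>a b. pure_tensor K Q Q (?q a) (?q b)) x"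
    by (rule sweedler_cong[OF QQ.tensor_module bilinear_comp[OF QQ.pure_bilinear q q] _ x]) simp
  finally show "comult Q (?q x) = tensor_map K Q Q ?q ?q (comult H x)"
    by (simp only: tensor_map_eq sweedler_def)
qed (auto simp: E p_mult p_counit)

lemma factor_bialg_hom:
  assumes E: "E = carrier H" and B: "bialgebra K B" and h: "h \<in> bialg_hom K H B"
    and hp: "\<And>x. x \<in> carrier H \<Longrightarrow> h (p x) = h x"
  shows "(\<lambda>x\<in>carrier Q. h x) \<in> bialg_hom K Q B"
proof (rule bialg_homI)
  interpret B: bialgebra K B by (rule B)
  note hD = bialg_homD[OF h]
  let ?h = "\<lambda>x\<in>carrier Q. h x"
  show hl: "?h \<in> linear_maps K Q B"
    by (rule linear_cong[OF Q_module linear_comp[OF hD(2) inclusion_linear]]) simp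
  fix x assume x: "x \<in> carrier Q"
  note xH = Q_carrier[OF x]
  have b: "(\<lambda>a b. pure_tensor K B B (?h a) (?h b)) \<in> bilinear_maps K Q Q (tensor K B B)"
    by (rule bilinear_comp[OF B.CC.pure_bilinear hl hl])
  have "tensor_map K B B ?h ?h (comult Q x) = sweedler Q (tensor K B B) (\<lambda>a b. pure_tensor K B B (?h a) (?h b)) x"
    by (simp only: tensor_map_eq sweedler_def)
  also have "\<dots> = sweedler H (tensor K B B) (\<lambda>a b. pure_tensor K B B (?h (p a)) (?h (p b))) x"
    by (rule sweedler_Q[OF B.CC.tensor_module b xH])
  also have "\<dots> = sweedler H (tensor K B B) (\<lambda>a b. pure_tensor K B B (h a) (h b)) x"
    by (rule sweedler_cong[OF B.CC.tensor_module bilinear_comp[OF B.CC.pure_bilinear hD(2) hD(2)] _ xH]) (simp add: hp)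
  also have "\<dots> = comult B (?h x)" using x xH by (simp add: hD(5) tensor_map_eq sweedler_def)
  finally show "comult B (?h x) = tensor_map K B B ?h ?h (comult Q x)" by simp
  show "counit B (?h x) = counit Q x" using x xH by (simp add: hD(6))
next
  fix x y assume x: "x \<in> carrier Q" and y: "y \<in> carrier Q"
  then show "(\<lambda>x\<in>carrier Q. h x) (x \<otimes>\<^bsub>Q\<^esub> y) = (\<lambda>x\<in>carrier Q. h x) x \<otimes>\<^bsub>B\<^esub> (\<lambda>x\<in>carrier Q. h x) y"
    using bialg_homD(3)[OF h Q_carrier[OF x] Q_carrier[OF y]] Q_carrier[OF x] Q_carrier[OF y] by (simp add: hp)
qed (use bialg_homD(4)[OF h] in \<open>auto simp: hp\<close>)

end

section \<open>Antipodes and inverse antipodes\<close>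

text \<open>
  The algebra \<open>A\<close> or its opposite. With it the arguments for the antipode and for its inverse are the
  same, except for the value of \<open>b\<close>.
\<close>

definition oriented_algebra :: "bool \<Rightarrow> ('k, 'a, 'x) module_scheme \<Rightarrow> ('k, 'a, 'x) module_scheme" where
  "oriented_algebra b A = (if b then A else opposite_algebra A)"

lemma oriented_algebra_simps [simp]:
  "carrier (oriented_algebra b A) = carrier A" "one (oriented_algebra b A) = one A"
  "monoid.mult (oriented_algebra b A) = (\<lambda>x y. if b then x \<otimes>\<^bsub>A\<^esub> y else y \<otimes>\<^bsub>A\<^esub> x)"
  "ring.zero (oriented_algebra b A) = ring.zero A" "ring.add (oriented_algebra b A) = ring.add A"
  "smult (oriented_algebra b A) = smult A"
  "a_minus (oriented_algebra b A) = a_minus A"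
  "linear_maps K V (oriented_algebra b A) = linear_maps K V A"
  "linear_maps K (oriented_algebra b A) V = linear_maps K A V"
  by (auto simp: oriented_algebra_def a_minus_def[abs_def] a_inv_def)

lemma (in assoc_algebra) oriented_assoc_algebra: "assoc_algebra K (oriented_algebra b A)"
  by (simp add: oriented_algebra_def opposite_assoc_algebra assoc_algebra_axioms)

text \<open>
  The properties shared by an antipode (\<open>b = True\<close>) and by the inverse of a bijective antipode
  (\<open>b = False\<close>): it reverses products and coproducts and is a convolution inverse of the identity,
  in the second case for the opposite multiplication.
\<close>

locale twisted_antipode = bialgebra K H for K and H (structure) +
  fixes S :: "'c \<Rightarrow> 'c" and b :: bool
  assumes S_linear: "S \<in> linear_maps K H H"
    and S_mult: "\<lbrakk>x \<in> carrier H; y \<in> carrier H\<rbrakk> \<Longrightarrow> S (x \<otimes> y) = S y \<otimes> S x"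
    and S_comult: "x \<in> carrier H \<Longrightarrow> comult H (S x) = sweedler H (tensor K H H) (\<lambda>a b. pure_tensor K H H (S b) (S a)) x"
    and S_left: "x \<in> carrier H \<Longrightarrow> convolution H (oriented_algebra b H) S (\<lambda>y. y) x = counit H x \<odot> \<one>"
    and S_right: "x \<in> carrier H \<Longrightarrow> convolution H (oriented_algebra b H) (\<lambda>y. y) S x = counit H x \<odot> \<one>"

lemma (in hopf) antipode_twisted: "twisted_antipode K H S True"
proof -
  have "oriented_algebra True H = H" by (simp add: oriented_algebra_def)
  then show ?thesis
    by unfold_locales (simp_all add: S_linear S_mult S_comult S_left S_right)
qed

text \<open>
  All identities are obtained by applying \<open>S\<close>, which is injective. For instance \<open>S\<close> maps
  \<open>\<Sum> x\<^sub>2 T(x\<^sub>1)\<close> to \<open>\<Sum> x\<^sub>1 S(x\<^sub>2) = \<epsilon>(x) 1 = S(\<epsilon>(x) 1)\<close>.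
\<close>

lemma (in hopf) inverse_antipode_twisted:
  assumes T: "\<And>x. x \<in> carrier H \<Longrightarrow> T x \<in> carrier H"
    and ST: "\<And>x. x \<in> carrier H \<Longrightarrow> S (T x) = x" and TS: "\<And>x. x \<in> carrier H \<Longrightarrow> T (S x) = x"
  shows "twisted_antipode K H T False"
proof -
  have eqI: "x = y" if "S x = S y" "x \<in> carrier H" "y \<in> carrier H" for x y
    using TS that by metis
  have Tl: "T \<in> linear_maps K H H"
    by (rule linear_mapsI; (rule eqI)?) (simp_all add: T ST linear_add[OF S_linear] linear_smult[OF S_linear])
  have T_mult: "T (x \<otimes> y) = T y \<otimes> T x" if "x \<in> carrier H" "y \<in> carrier H" for x y
    by (rule eqI) (use that in \<open>simp_all add: T ST S_mult\<close>)
  have bT: "(\<lambda>a b. pure_tensor K H H (T b) (T a)) \<in> bilinear_maps K H H T2"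
    by (rule bilinear_flip[OF bilinear_comp[OF CC.pure_bilinear Tl Tl]])
  have bS: "(\<lambda>a b. pure_tensor K H H (S b) (S a)) \<in> bilinear_maps K H H T2"
    by (rule bilinear_flip[OF bilinear_comp[OF CC.pure_bilinear S_linear S_linear]])
  have T_comult: "comult H (T x) = sweedler H T2 (\<lambda>a b. pure_tensor K H H (T b) (T a)) x" if x: "x \<in> carrier H" for x
  proof -
    let ?h = "tensor_lift (add_monoid T2) (\<lambda>a b. pure_tensor K H H (T b) (T a))"
    have h: "?h \<in> linear_maps K T2 T2" by (rule CC.tensor_lift_linear[OF CC.tensor_module bT])
    have "sweedler H T2 (\<lambda>a b. pure_tensor K H H (T b) (T a)) x = ?h (comult H (S (T x)))"
      by (simp add: sweedler_def ST x)
    also have "\<dots> = ?h (sweedler H T2 (\<lambda>a b. pure_tensor K H H (S b) (S a)) (T x))"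
      by (simp add: S_comult T x)
    also have "\<dots> = sweedler H T2 (\<lambda>a b. ?h (pure_tensor K H H (S b) (S a))) (T x)"
      by (rule sweedler_post[OF CC.tensor_module CC.tensor_module h bS T[OF x]])
    also have "\<dots> = sweedler H T2 (pure_tensor K H H) (T x)"
      by (rule sweedler_cong[OF CC.tensor_module CC.pure_bilinear _ T[OF x]])
        (simp add: CC.tensor_lift_pure[OF CC.tensor_module bT] TS)
    finally show ?thesis by (simp add: sweedler_pure T x)
  qed
  interpret O: assoc_algebra K "oriented_algebra False H" by (rule oriented_assoc_algebra)
  interpret HO: convolution_pair K H "oriented_algebra False H" ..
  note MO = O.module_axioms and M = module_axioms
  have S': "S \<in> linear_maps K (oriented_algebra False H) H" by (simp add: S_linear)
  have lin: "T \<in> linear_maps K H (oriented_algebra False H)" "(\<lambda>y. y) \<in> linear_maps K H (oriented_algebra False H)"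
    by (simp_all add: Tl linear_id)
  have e: "S (counit H x \<odot> \<one>) = counit H x \<odot> \<one>" if "x \<in> carrier H" for x
    using that by (simp add: linear_smult[OF S_linear] counit_closed S_one)
  show ?thesis
  proof (unfold_locales; (fact Tl T_mult T_comult)?)
    fix x assume x: "x \<in> carrier H"
    have "S (convolution H (oriented_algebra False H) T (\<lambda>y. y) x) = sweedler H H (\<lambda>a b. S (b \<otimes> T a)) x"
      unfolding convolution_sweedler
      using sweedler_post[OF MO M S' HO.convolution_bilinear[OF lin] x] by simp
    also have "\<dots> = convolution H H (\<lambda>y. y) S x"
      unfolding convolution_sweedler
      by (rule sweedler_cong[OF M HH.convolution_bilinear[OF linear_id S_linear] _ x]) (simp add: S_mult ST T)
    also have "\<dots> = S (counit H x \<odot> \<one>)" by (simp add: S_right x e)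
    finally show "convolution H (oriented_algebra False H) T (\<lambda>y. y) x = counit H x \<odot> \<one>"
      by (rule eqI) (use lin_map[OF HO.convolution_linear[OF lin] x] x in \<open>simp_all add: counit_closed\<close>)
    have "S (convolution H (oriented_algebra False H) (\<lambda>y. y) T x) = sweedler H H (\<lambda>a b. S (T b \<otimes> a)) x"
      unfolding convolution_sweedler
      using sweedler_post[OF MO M S' HO.convolution_bilinear[OF lin(2,1)] x] by simp
    also have "\<dots> = convolution H H S (\<lambda>y. y) x"
      unfolding convolution_sweedler
      by (rule sweedler_cong[OF M HH.convolution_bilinear[OF S_linear linear_id] _ x]) (simp add: S_mult ST T)
    also have "\<dots> = S (counit H x \<odot> \<one>)" by (simp add: S_left x e)
    finally show "convolution H (oriented_algebra False H) (\<lambda>y. y) T x = counit H x \<odot> \<one>"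
      by (rule eqI) (use lin_map[OF HO.convolution_linear[OF lin(2,1)] x] x in \<open>simp_all add: counit_closed\<close>)
  qed
qed

lemma bijective_antipode_obtain:
  assumes "bialgebra K H" "bijective_antipode K H"
  obtains S T where "antipode K H S" "twisted_antipode K H S True" "twisted_antipode K H T False"
    "\<And>x. x \<in> carrier H \<Longrightarrow> S (T x) = x" "\<And>x. x \<in> carrier H \<Longrightarrow> T (S x) = x"
proof -
  obtain S where S: "antipode K H S" and bij: "bij_betw S (carrier H) (carrier H)"
    using assms(2) by (auto simp: bijective_antipode_def)
  interpret hopf K H S using assms(1) S by (simp add: hopf_def hopf_axioms_def)
  define T where "T = inv_into (carrier H) S"
  have "S (T x) = x" "T (S x) = x" "T x \<in> carrier H" if "x \<in> carrier H" for x
    using bij that unfolding T_def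
    by (simp_all add: bij_betw_inv_into_right bij_betw_inv_into_left bij_betw_apply[OF bij_betw_inv_into])
  then show ?thesis using that[of S T] S antipode_twisted inverse_antipode_twisted[of T] by blast
qed

context twisted_antipode
begin

lemma S_closed: "x \<in> carrier H \<Longrightarrow> S x \<in> carrier H" by (rule lin_map[OF S_linear])

lemma convolution_hom_after:
  assumes Z: "bialgebra K Z" and f: "f \<in> bialg_hom K H Z" and x: "x \<in> carrier H"
  shows "convolution H (oriented_algebra b Z) (\<lambda>x. f (S x)) f x = counit H x \<odot>\<^bsub>oriented_algebra b Z\<^esub> \<one>\<^bsub>oriented_algebra b Z\<^esub>"
    and "convolution H (oriented_algebra b Z) f (\<lambda>x. f (S x)) x = counit H x \<odot>\<^bsub>oriented_algebra b Z\<^esub> \<one>\<^bsub>oriented_algebra b Z\<^esub>"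
proof -
  interpret Z: bialgebra K Z by (rule Z)
  note fD = bialg_homD[OF f]
  interpret O: assoc_algebra K "oriented_algebra b H" by (rule oriented_assoc_algebra)
  interpret OZ: assoc_algebra K "oriented_algebra b Z" by (rule Z.oriented_assoc_algebra)
  interpret HO: convolution_pair K H "oriented_algebra b H" ..
  note MO = O.module_axioms and MZ = OZ.module_axioms
  have f': "f \<in> linear_maps K (oriented_algebra b H) (oriented_algebra b Z)" by (simp add: fD)
  have lin: "S \<in> linear_maps K H (oriented_algebra b H)" "(\<lambda>y. y) \<in> linear_maps K H (oriented_algebra b H)"
    by (simp_all add: S_linear linear_id)
  note bl = HO.convolution_bilinear[OF lin] and br = HO.convolution_bilinear[OF lin(2,1)]
  have fm: "f (u \<otimes>\<^bsub>oriented_algebra b H\<^esub> v) = f u \<otimes>\<^bsub>oriented_algebra b Z\<^esub> f v" if "u \<in> carrier H" "v \<in> carrier H" for u v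
    using that by (simp add: fD)
  have e: "f (counit H x \<odot> \<one>) = counit H x \<odot>\<^bsub>Z\<^esub> \<one>\<^bsub>Z\<^esub>"
    by (simp add: linear_smult[OF fD(2)] counit_closed x fD(4))
  have "convolution H (oriented_algebra b Z) (\<lambda>x. f (S x)) f x = f (convolution H (oriented_algebra b H) S (\<lambda>y. y) x)"
    unfolding convolution_sweedler sweedler_post[OF MO MZ f' bl x]
    by (rule sweedler_cong[OF MZ bilinear_post[OF f' bl] _ x]) (simp add: fm S_closed del: oriented_algebra_simps)
  then show "convolution H (oriented_algebra b Z) (\<lambda>x. f (S x)) f x = counit H x \<odot>\<^bsub>oriented_algebra b Z\<^esub> \<one>\<^bsub>oriented_algebra b Z\<^esub>"
    by (simp add: S_left x e)
  have "convolution H (oriented_algebra b Z) f (\<lambda>x. f (S x)) x = f (convolution H (oriented_algebra b H) (\<lambda>y. y) S x)"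
    unfolding convolution_sweedler sweedler_post[OF MO MZ f' br x]
    by (rule sweedler_cong[OF MZ bilinear_post[OF f' br] _ x]) (simp add: fm S_closed del: oriented_algebra_simps)
  then show "convolution H (oriented_algebra b Z) f (\<lambda>x. f (S x)) x = counit H x \<odot>\<^bsub>oriented_algebra b Z\<^esub> \<one>\<^bsub>oriented_algebra b Z\<^esub>"
    by (simp add: S_right x e)
qed

lemma convolution_hom_before:
  assumes W: "bialgebra K W" and f: "f \<in> bialg_hom K W H" and x: "x \<in> carrier W"
  shows "convolution W (oriented_algebra b H) (\<lambda>x. S (f x)) f x = counit W x \<odot>\<^bsub>oriented_algebra b H\<^esub> \<one>\<^bsub>oriented_algebra b H\<^esub>"
    and "convolution W (oriented_algebra b H) f (\<lambda>x. S (f x)) x = counit W x \<odot>\<^bsub>oriented_algebra b H\<^esub> \<one>\<^bsub>oriented_algebra b H\<^esub>"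
proof -
  interpret O: assoc_algebra K "oriented_algebra b H" by (rule oriented_assoc_algebra)
  interpret HO: convolution_pair K H "oriented_algebra b H" ..
  note fD = bialg_homD[OF f]
  have lin: "S \<in> linear_maps K H (oriented_algebra b H)" "(\<lambda>y. y) \<in> linear_maps K H (oriented_algebra b H)"
    by (simp_all add: S_linear linear_id)
  note hom = sweedler_bialg_hom[OF W bialgebra_axioms f O.module_axioms _ x]
  show "convolution W (oriented_algebra b H) (\<lambda>x. S (f x)) f x = counit W x \<odot>\<^bsub>oriented_algebra b H\<^esub> \<one>\<^bsub>oriented_algebra b H\<^esub>"
    using hom[OF HO.convolution_bilinear[OF lin]] S_left[OF fD(7)[OF x]]
    by (simp add: convolution_sweedler fD(6)[OF x])
  show "convolution W (oriented_algebra b H) f (\<lambda>x. S (f x)) x = counit W x \<odot>\<^bsub>oriented_algebra b H\<^esub> \<one>\<^bsub>oriented_algebra b H\<^esub>"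
    using hom[OF HO.convolution_bilinear[OF lin(2,1)]] S_right[OF fD(7)[OF x]]
    by (simp add: convolution_sweedler fD(6)[OF x])
qed

end

section \<open>Sets closed under comultiplication\<close>

lemma (in tensor_pair) tensor_span_mono:
  "X \<subseteq> X' \<Longrightarrow> Y \<subseteq> Y' \<Longrightarrow> tensor_span K V W X Y \<subseteq> tensor_span K V W X' Y'"
  unfolding tensor_span_def
  by (rule group.mono_generate[OF abelian_group.a_group[OF tensor_abelian_group]]) blast

context comultiplication
begin

lemma coclosed_Union:
  assumes "\<And>X. X \<in> \<X> \<Longrightarrow> coclosed K C X"
  shows "coclosed K C (\<Union>\<X>)"
  unfolding coclosed_def
proof (intro conjI ballI)
  show "\<Union>\<X> \<subseteq> carrier C" using assms by (auto simp: coclosed_def)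
  fix x assume "x \<in> \<Union>\<X>"
  then obtain X where X: "X \<in> \<X>" "x \<in> X" by blast
  then have "comult C x \<in> tensor_span K C C X X" using assms by (auto simp: coclosed_def)
  also have "\<dots> \<subseteq> tensor_span K C C (\<Union>\<X>) (\<Union>\<X>)" using X by (intro CC.tensor_span_mono) auto
  finally show "comult C x \<in> tensor_span K C C (\<Union>\<X>) (\<Union>\<X>)" .
qed

lemma coclosed_zero: "coclosed K C {\<zero>\<^bsub>C\<^esub>}"
  using subgroup.one_closed[OF CC.tensor_span_subgroup[of "{\<zero>\<^bsub>C\<^esub>}" "{\<zero>\<^bsub>C\<^esub>}"]]
    linear_zero[OF module_axioms CC.tensor_module comult_is_linear]
  by (simp add: coclosed_def)

text \<open>
  The element \<open>0\<close> is needed so that \<open>X\<close> itself is contained in the set of sums.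
\<close>

lemma coclosed_sums:
  assumes X: "coclosed K C X" and 0: "\<zero>\<^bsub>C\<^esub> \<in> X"
  shows "coclosed K C {x \<oplus>\<^bsub>C\<^esub> y | x y. x \<in> X \<and> y \<in> X}" (is "coclosed K C ?Y")
  unfolding coclosed_def
proof (intro conjI ballI)
  have Xc: "x \<in> carrier C" if "x \<in> X" for x using X that by (auto simp: coclosed_def)
  then show Y: "?Y \<subseteq> carrier C" by auto
  have "X \<subseteq> ?Y"
  proof
    fix x assume "x \<in> X"
    then have "x = x \<oplus>\<^bsub>C\<^esub> \<zero>\<^bsub>C\<^esub>" using Xc by simp
    with \<open>x \<in> X\<close> 0 show "x \<in> ?Y" by blast
  qed
  then have span: "comult C x \<in> tensor_span K C C ?Y ?Y" if "x \<in> X" for x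
    using CC.tensor_span_mono[of X ?Y X ?Y] X that unfolding coclosed_def by blast
  fix z assume "z \<in> ?Y"
  then obtain x y where "z = x \<oplus>\<^bsub>C\<^esub> y" "x \<in> X" "y \<in> X" by blast
  then show "comult C z \<in> tensor_span K C C ?Y ?Y"
    using subgroup.m_closed[OF CC.tensor_span_subgroup[OF Y Y] span span, of x y]
    by (simp add: linear_add[OF comult_is_linear] Xc)
qed

lemma coclosed_multiples:
  assumes X: "coclosed K C X"
  shows "coclosed K C {a \<odot>\<^bsub>C\<^esub> x | a x. a \<in> carrier K \<and> x \<in> X}" (is "coclosed K C ?Y")
  unfolding coclosed_def
proof (intro conjI ballI)
  have Xc: "x \<in> carrier C" if "x \<in> X" for x using X that by (auto simp: coclosed_def)
  then show Y: "?Y \<subseteq> carrier C" by auto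
  have XY: "X \<subseteq> ?Y"
  proof
    fix x assume "x \<in> X"
    then show "x \<in> ?Y" using Xc by (auto intro!: exI[of _ x] exI[of _ "\<one>\<^bsub>K\<^esub>"])
  qed
  fix z assume "z \<in> ?Y"
  then obtain a x where z: "z = a \<odot>\<^bsub>C\<^esub> x" "a \<in> carrier K" "x \<in> X" by blast
  have "a \<odot>\<^bsub>tensor K C C\<^esub> comult C x \<in> tensor_span K C C ?Y ?Y"
  proof (rule CC.tensor_span_linear[OF CC.tensor_module, of "\<lambda>U. a \<odot>\<^bsub>tensor K C C\<^esub> U" _ X X])
    show "(\<lambda>U. a \<odot>\<^bsub>tensor K C C\<^esub> U) \<in> linear_maps K (tensor K C C) (tensor K C C)"
      using z(2) by (intro linear_mapsI) (simp_all add: module.smult_closed[OF CC.tensor_module]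
       module.smult_r_distr[OF CC.tensor_module] module.smult_assoc1[OF CC.tensor_module, symmetric] R.m_comm)
    show "subgroup (tensor_span K C C ?Y ?Y) (add_monoid (tensor K C C))" by (rule CC.tensor_span_subgroup[OF Y Y])
    show "comult C x \<in> tensor_span K C C X X" using X z by (auto simp: coclosed_def)
    fix u v assume "u \<in> X" "v \<in> X"
    then show "a \<odot>\<^bsub>tensor K C C\<^esub> pure_tensor K C C u v \<in> tensor_span K C C ?Y ?Y"
      using XY z(2) by (subst CC.tensor_smult_pure) (auto simp: Xc intro!: CC.pure_in_span)
  qed (use Xc in auto)
  then show "comult C z \<in> tensor_span K C C ?Y ?Y" using z Xc by (simp add: linear_smult[OF comult_is_linear])
qed

end

context bialgebra
begin

lemma coclosed_one: "coclosed K B {\<one>\<^bsub>B\<^esub>}"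
  by (simp add: coclosed_def comult_one CC.pure_in_span)

text \<open>
  \<open>X \<otimes> X\<close> times \<open>X \<otimes> X\<close> is contained in \<open>X X \<otimes> X X\<close>.
\<close>

lemma coclosed_products:
  assumes X: "coclosed K B X"
  shows "coclosed K B {x \<otimes>\<^bsub>B\<^esub> y | x y. x \<in> X \<and> y \<in> X}" (is "coclosed K B ?Y")
  unfolding coclosed_def
proof (intro conjI ballI)
  have Xs: "X \<subseteq> carrier B" using X by (simp add: coclosed_def)
  note Xc = subsetD[OF Xs]
  then show Y: "?Y \<subseteq> carrier B" by auto
  interpret T: assoc_algebra K T2 by (rule BB.tensor_assoc_algebra)
  note MT = CC.tensor_module and sub = CC.tensor_span_subgroup[OF Y Y]
  fix z assume "z \<in> ?Y"
  then obtain x y where z: "z = x \<otimes>\<^bsub>B\<^esub> y" and x: "x \<in> X" and y: "y \<in> X" by blast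
  have sx: "comult B x \<in> tensor_span K B B X X" and sy: "comult B y \<in> tensor_span K B B X X"
    using X x y by (auto simp: coclosed_def)
  have "comult B x \<otimes>\<^bsub>T2\<^esub> comult B y \<in> tensor_span K B B ?Y ?Y"
  proof (rule CC.tensor_span_linear[OF MT T.mult_linear_left[OF linear_id comult_closed[OF Xc[OF y]]] sub Xs Xs _ sx])
    fix a b assume a: "a \<in> X" and b: "b \<in> X"
    show "pure_tensor K B B a b \<otimes>\<^bsub>T2\<^esub> comult B y \<in> tensor_span K B B ?Y ?Y"
    proof (rule CC.tensor_span_linear[OF MT T.mult_linear_right[OF linear_id CC.pure_closed] sub Xs Xs _ sy])
      fix c d assume "c \<in> X" "d \<in> X"
      then show "pure_tensor K B B a b \<otimes>\<^bsub>T2\<^esub> pure_tensor K B B c d \<in> tensor_span K B B ?Y ?Y"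
        using a b by (subst BB.tensor_mult_pure) (auto simp: Xc intro!: CC.pure_in_span)
    qed (use a b Xc in auto)
  qed
  then show "comult B z \<in> tensor_span K B B ?Y ?Y" using z x y Xc by (simp add: comult_mult)
qed

lemma coclosed_hom_image:
  assumes W: "bialgebra K W" and h: "h \<in> bialg_hom K W B"
  shows "coclosed K B (h ` carrier W)"
  unfolding coclosed_def
proof (intro conjI ballI)
  interpret W: bialgebra K W by (rule W)
  note hD = bialg_homD[OF h]
  show Y: "h ` carrier W \<subseteq> carrier B" using hD(7) by auto
  note bl = bilinear_comp[OF CC.pure_bilinear hD(2) hD(2)]
  fix z assume "z \<in> h ` carrier W"
  then obtain x where z: "z = h x" and x: "x \<in> carrier W" by blast
  have "sweedler W T2 (\<lambda>a b. pure_tensor K B B (h a) (h b)) x \<in> tensor_span K B B (h ` carrier W) (h ` carrier W)"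
    by (rule W.sweedler_in_subgroup[OF CC.tensor_module W.coclosed_carrier bl CC.tensor_span_subgroup[OF Y Y] _ x])
      (auto intro: CC.pure_in_span)
  then show "comult B z \<in> tensor_span K B B (h ` carrier W) (h ` carrier W)"
    by (simp add: z hD(5)[OF x] tensor_map_eq sweedler_def)
qed

end

lemma (in twisted_antipode) coclosed_antipode_image:
  assumes X: "coclosed K H X"
  shows "coclosed K H (S ` X)"
  unfolding coclosed_def
proof (intro conjI ballI)
  have Xc: "x \<in> carrier H" if "x \<in> X" for x using X that by (auto simp: coclosed_def)
  then show Y: "S ` X \<subseteq> carrier H" using S_closed by auto
  fix z assume "z \<in> S ` X"
  then obtain x where z: "z = S x" and x: "x \<in> X" by blast
  have "sweedler H T2 (\<lambda>a b. pure_tensor K H H (S b) (S a)) x \<in> tensor_span K H H (S ` X) (S ` X)"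
    by (rule sweedler_in_subgroup[OF CC.tensor_module X bilinear_flip[OF bilinear_comp[OF CC.pure_bilinear S_linear S_linear]]
          CC.tensor_span_subgroup[OF Y Y] _ x])
      (auto intro: CC.pure_in_span)
  then show "comult H z \<in> tensor_span K H H (S ` X) (S ` X)"
    by (simp add: z S_comult Xc x)
qed

section \<open>The largest Hopf subalgebra on which two maps agree\<close>

locale bialg_hom_pair = A: bialgebra K A + Z: bialgebra K Z
  for K and A :: "('k, 'a) bialg" and Z :: "('k, 'a) bialg" (structure) +
  fixes f g
  assumes f: "f \<in> bialg_hom K A Z" and g: "g \<in> bialg_hom K A Z"
begin

lemmas fD = bialg_homD[OF f] and gD = bialg_homD[OF g]

definition "agreement = \<Union>{X. coclosed K A X \<and> (\<forall>x\<in>X. f x = g x)}"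

lemma agreement_coclosed: "coclosed K A agreement"
  unfolding agreement_def by (rule A.coclosed_Union) blast

lemma agreement_eq: "x \<in> agreement \<Longrightarrow> f x = g x"
  unfolding agreement_def by blast

lemma agreementI:
  assumes "coclosed K A X" "\<And>x. x \<in> X \<Longrightarrow> f x = g x" "x \<in> X"
  shows "x \<in> agreement"
  using assms unfolding agreement_def by blast

lemma agreement_carrier: "x \<in> agreement \<Longrightarrow> x \<in> carrier A"
  using agreement_coclosed by (auto simp: coclosed_def)

lemma agreement_zero: "\<zero>\<^bsub>A\<^esub> \<in> agreement"
  by (rule agreementI[OF A.coclosed_zero])
    (simp_all add: linear_zero[OF A.module_axioms Z.module_axioms fD(2)] linear_zero[OF A.module_axioms Z.module_axioms gD(2)])

lemma agreement_add: "x \<in> agreement \<Longrightarrow> y \<in> agreement \<Longrightarrow> x \<oplus>\<^bsub>A\<^esub> y \<in> agreement"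
  by (rule agreementI[OF A.coclosed_sums[OF agreement_coclosed agreement_zero]])
    (auto simp: linear_add[OF fD(2)] linear_add[OF gD(2)] agreement_carrier agreement_eq)

lemma agreement_smult: "a \<in> carrier K \<Longrightarrow> x \<in> agreement \<Longrightarrow> a \<odot>\<^bsub>A\<^esub> x \<in> agreement"
  by (rule agreementI[OF A.coclosed_multiples[OF agreement_coclosed]])
    (auto simp: linear_smult[OF fD(2)] linear_smult[OF gD(2)] agreement_carrier agreement_eq)

lemma agreement_one: "\<one>\<^bsub>A\<^esub> \<in> agreement"
  by (rule agreementI[OF A.coclosed_one]) (simp_all add: fD(4) gD(4))

lemma agreement_mult: "x \<in> agreement \<Longrightarrow> y \<in> agreement \<Longrightarrow> x \<otimes>\<^bsub>A\<^esub> y \<in> agreement"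
  by (rule agreementI[OF A.coclosed_products[OF agreement_coclosed]])
    (auto simp: fD(3) gD(3) agreement_carrier agreement_eq)

lemma agreement_submodule: "submodule agreement K A"
proof (rule A.submoduleI)
  show "\<ominus>\<^bsub>A\<^esub> x \<in> agreement" if "x \<in> agreement" for x
    using agreement_smult[OF _ that, of "\<ominus>\<^bsub>K\<^esub> \<one>\<^bsub>K\<^esub>"] A.smult_l_minus[of "\<one>\<^bsub>K\<^esub>" x] agreement_carrier[OF that]
    by simp
qed (auto simp: agreement_carrier agreement_zero agreement_add agreement_smult)

text \<open>
  \<open>f S\<close> and \<open>g S\<close> agree on \<open>agreement\<close>, because \<open>f\<close> and \<open>g\<close> agree there and it is a subcoalgebra; so \<open>S\<close> maps it
  to a coclosed set on which \<open>f\<close> and \<open>g\<close> agree.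
\<close>

lemma agreement_antipode:
  assumes "twisted_antipode K A S b" and x: "x \<in> agreement"
  shows "S x \<in> agreement"
proof -
  interpret S: twisted_antipode K A S b by fact
  interpret O: assoc_algebra K "oriented_algebra b Z" by (rule Z.oriented_assoc_algebra)
  interpret C: convolution_pair K A "oriented_algebra b Z" ..
  have "f (S y) = g (S y)" if y: "y \<in> agreement" for y
  proof -
    have "f (S y) \<ominus>\<^bsub>oriented_algebra b Z\<^esub> g (S y) \<in> {\<zero>}"
    proof (rule C.convolution_inverse_difference_in_subgroup[OF _ _ _ _ _ _ agreement_coclosed _ _ y])
      show "(\<lambda>x. f (S x)) \<in> linear_maps K A (oriented_algebra b Z)" "(\<lambda>x. g (S x)) \<in> linear_maps K A (oriented_algebra b Z)"
        "f \<in> linear_maps K A (oriented_algebra b Z)" "g \<in> linear_maps K A (oriented_algebra b Z)"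
        by (simp_all add: fD gD linear_comp[OF _ S.S_linear])
      show "subgroup {\<zero>} (add_monoid (oriented_algebra b Z))"
        using group.triv_subgroup[OF Z.a_group] by simp
      fix u c d assume "u \<in> agreement" "c \<in> agreement" "d \<in> agreement"
      then show "f (S u) \<otimes>\<^bsub>oriented_algebra b Z\<^esub> ((g c \<ominus>\<^bsub>oriented_algebra b Z\<^esub> f c) \<otimes>\<^bsub>oriented_algebra b Z\<^esub> g (S d)) \<in> {\<zero>}"
        by (simp add: agreement_eq fD(7) gD(7) S.S_closed agreement_carrier a_minus_def Z.r_neg)
    qed (simp_all add: S.convolution_hom_after[OF Z.bialgebra_axioms f] S.convolution_hom_after[OF Z.bialgebra_axioms g]
      del: oriented_algebra_simps)
    moreover have "f (S y) \<in> carrier Z" "g (S y) \<in> carrier Z"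
      using y by (simp_all add: fD(7) gD(7) S.S_closed agreement_carrier)
    ultimately show ?thesis
      by (simp add: a_minus_def) (metis Z.a_inv_closed Z.minus_equality Z.minus_minus)
  qed
  then show ?thesis
    by (intro agreementI[OF S.coclosed_antipode_image[OF agreement_coclosed]]) (use x in auto)
qed

text \<open>
  \<open>E\<close> is \<open>agreement\<close> with the structure of \<open>A\<close>, the subquotient for a linear projection onto it.
\<close>

lemma factor_through_hopf_subalgebra:
  fixes B :: "('k, 'a) bialg"
  assumes B: "bialgebra K B" and h: "h \<in> bialg_hom K B A"
    and eq: "compose (carrier B) f h = compose (carrier B) g h"
  shows "\<exists>(E :: ('k, 'a) bialg) i. bialgebra K E \<and> (hopf_algebra K A \<longrightarrow> hopf_algebra K E) \<and>
    (bijective_antipode K A \<longrightarrow> bijective_antipode K E) \<and> i \<in> bialg_hom K E A \<and> h \<in> bialg_hom K B E \<and>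
    compose (carrier B) i h = h \<and> compose (carrier E) f i = compose (carrier E) g i"
proof -
  obtain p where p: "p \<in> linear_maps K A A" and pD: "\<And>x. x \<in> carrier A \<Longrightarrow> p x \<in> agreement"
    and p_id: "\<And>x. x \<in> agreement \<Longrightarrow> p x = x"
    using A.linear_projection_onto_submodule[OF A.field_axioms agreement_submodule] by blast
  interpret Q: bialgebra_subquotient K A agreement p
    by unfold_locales
      (simp_all add: agreement_coclosed agreement_one agreement_mult p pD p_id)
  let ?i = "\<lambda>x\<in>carrier Q.Q. x"
  have hopf: "hopf_algebra K Q.Q" if hopf: "hopf_algebra K A"
  proof -
    obtain S where S: "antipode K A S" using hopf by (auto simp: hopf_algebra_def)
    interpret hopf K A S using A.bialgebra_axioms S by (simp add: hopf_def hopf_axioms_def)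
    have "S x \<in> agreement" if "x \<in> agreement" for x
      by (rule agreement_antipode[OF antipode_twisted that])
    then show ?thesis by (intro Q.Q_hopf_algebra[OF S]) (simp_all add: p_id)
  qed
  have bijective: "bijective_antipode K Q.Q" if bij: "bijective_antipode K A"
  proof -
    obtain S T where ST: "antipode K A S" "twisted_antipode K A S True" "twisted_antipode K A T False"
      "\<And>x. x \<in> carrier A \<Longrightarrow> S (T x) = x" "\<And>x. x \<in> carrier A \<Longrightarrow> T (S x) = x"
      using bijective_antipode_obtain[OF A.bialgebra_axioms bij] by metis
    show ?thesis
      by (rule Q.Q_bijective_antipode[OF ST(1), of T])
        (simp_all add: ST(4,5) p_id agreement_antipode[OF ST(2)] agreement_antipode[OF ST(3)])
  qed
  have i: "?i \<in> bialg_hom K Q.Q A" by (rule Q.inclusion_bialg_hom[OF p_id])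
  have hQ: "h \<in> bialg_hom K B Q.Q"
  proof (rule Q.corestrict_bialg_hom[OF B h])
    fix x assume "x \<in> carrier B"
    moreover have "f (h y) = g (h y)" if "y \<in> carrier B" for y
      using fun_cong[OF eq, of y] that by (simp add: compose_def)
    ultimately have "h x \<in> agreement"
      by (intro agreementI[OF A.coclosed_hom_image[OF B h]]) auto
    then show "p (h x) = h x" by (rule p_id)
  qed
  have ih: "compose (carrier B) ?i h = h"
    using bialg_homD(1,7)[OF hQ] by (intro extensionalityI[of _ "carrier B"]) (auto simp: compose_def)
  have fi: "compose (carrier Q.Q) f ?i = compose (carrier Q.Q) g ?i"
    by (rule ext) (simp add: compose_def agreement_eq[OF Q.Q_E] del: subquotient_simps)
  show ?thesis
    by (rule exI[of _ Q.Q], rule exI[of _ ?i]) (intro conjI impI Q.Q_bialgebra hopf bijective i hQ ih fi)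
qed

end

section \<open>The Hopf ideal generated by the differences of two maps\<close>

context bialg_hom_pair
begin

definition "difference_ideal =
  generate (add_monoid Z) {u \<otimes> (f w \<ominus> g w) \<otimes> v | u w v. u \<in> carrier Z \<and> w \<in> carrier A \<and> v \<in> carrier Z}"

lemma difference_closed: "w \<in> carrier A \<Longrightarrow> f w \<ominus> g w \<in> carrier Z"
  by (simp add: fD(7) gD(7))

lemma difference_generators:
  "{u \<otimes> (f w \<ominus> g w) \<otimes> v | u w v. u \<in> carrier Z \<and> w \<in> carrier A \<and> v \<in> carrier Z} \<subseteq> carrier (add_monoid Z)"
  using difference_closed by auto

lemma difference_ideal_subgroup: "subgroup difference_ideal (add_monoid Z)"
  unfolding difference_ideal_def by (rule group.generate_is_subgroup[OF Z.a_group difference_generators])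

lemma difference_ideal_carrier: "x \<in> difference_ideal \<Longrightarrow> x \<in> carrier Z"
  using subgroup.subset[OF difference_ideal_subgroup] by auto

lemma generator_in_difference_ideal:
  "u \<in> carrier Z \<Longrightarrow> w \<in> carrier A \<Longrightarrow> v \<in> carrier Z \<Longrightarrow> u \<otimes> (f w \<ominus> g w) \<otimes> v \<in> difference_ideal"
  unfolding difference_ideal_def by (rule generate.incl) blast

lemma difference_in_difference_ideal: "w \<in> carrier A \<Longrightarrow> f w \<ominus> g w \<in> difference_ideal"
  using generator_in_difference_ideal[of "\<one>" w "\<one>"] difference_closed by simp

lemma difference_ideal_linear:
  assumes M: "module K M" and h: "h \<in> linear_maps K Z M" and B: "subgroup B (add_monoid M)"
    and gen: "\<And>u w v. u \<in> carrier Z \<Longrightarrow> w \<in> carrier A \<Longrightarrow> v \<in> carrier Z \<Longrightarrow> h (u \<otimes> (f w \<ominus> g w) \<otimes> v) \<in> B"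
    and x: "x \<in> difference_ideal"
  shows "h x \<in> B"
proof -
  interpret M: module K M by fact
  show ?thesis
    by (rule hom_generate_subgroup[OF Z.a_group M.a_group linear_hom[OF h] B difference_generators _ x[unfolded difference_ideal_def]])
      (use gen in auto)
qed

lemma difference_ideal_mult_left:
  assumes c: "c \<in> carrier Z" and x: "x \<in> difference_ideal"
  shows "c \<otimes> x \<in> difference_ideal"
  by (rule difference_ideal_linear[OF Z.module_axioms Z.mult_linear_right[OF linear_id c] difference_ideal_subgroup _ x])
    (simp add: c difference_closed Z.m_assoc[symmetric] generator_in_difference_ideal)

lemma difference_ideal_mult_right:
  assumes c: "c \<in> carrier Z" and x: "x \<in> difference_ideal"
  shows "x \<otimes> c \<in> difference_ideal"
proof (rule difference_ideal_linear[OF Z.module_axioms Z.mult_linear_left[OF linear_id c] difference_ideal_subgroup _ x])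
  fix u w v assume "u \<in> carrier Z" "w \<in> carrier A" "v \<in> carrier Z"
  then show "u \<otimes> (f w \<ominus> g w) \<otimes> v \<otimes> c \<in> difference_ideal"
    using c generator_in_difference_ideal[of u w "v \<otimes> c"] difference_closed by (simp add: Z.m_assoc)
qed

lemma difference_ideal_submodule: "submodule difference_ideal K Z"
proof (rule Z.submoduleI)
  note sub = difference_ideal_subgroup
  show "difference_ideal \<subseteq> carrier Z" using difference_ideal_carrier by blast
  show "\<zero> \<in> difference_ideal" using subgroup.one_closed[OF sub] by simp
  show "x \<oplus> y \<in> difference_ideal" if "x \<in> difference_ideal" "y \<in> difference_ideal" for x y
    using subgroup.m_closed[OF sub that] by simp
  show "\<ominus> x \<in> difference_ideal" if "x \<in> difference_ideal" for x
    using subgroup.m_inv_closed[OF sub that] by (simp add: a_inv_def)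
  show "a \<odot> x \<in> difference_ideal" if a: "a \<in> carrier K" and x: "x \<in> difference_ideal" for a x
  proof -
    have "a \<odot> x = (a \<odot> \<one>) \<otimes> x"
      using a difference_ideal_carrier[OF x] by (simp add: Z.smult_mult_left)
    then show ?thesis using difference_ideal_mult_left[OF _ x, of "a \<odot> \<one>"] a by simp
  qed
qed

lemma difference_ideal_minus_swap:
  assumes "w \<in> carrier A" shows "g w \<ominus> f w \<in> difference_ideal"
proof -
  have "g w \<ominus> f w = \<ominus> (f w \<ominus> g w)"
    using assms by (simp add: a_minus_def Z.minus_add Z.a_comm fD(7) gD(7))
  then show ?thesis
    using Z.submoduleE(3)[OF difference_ideal_submodule difference_in_difference_ideal[OF assms]] by simp
qed

text \<open>
  In \<open>S (f w) - S (g w) = \<Sum> S (f w\<^sub>1) (g w\<^sub>2 - f w\<^sub>2) S (g w\<^sub>3)\<close> every summand lies in the ideal; for \<open>b = False\<close>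
  the factors come in the opposite order.
\<close>

lemma difference_ideal_antipode:
  assumes "twisted_antipode K Z S b" and x: "x \<in> difference_ideal"
  shows "S x \<in> difference_ideal"
proof -
  interpret S: twisted_antipode K Z S b by fact
  interpret O: assoc_algebra K "oriented_algebra b Z" by (rule Z.oriented_assoc_algebra)
  interpret C: convolution_pair K A "oriented_algebra b Z" ..
  have diff: "S (f w) \<ominus> S (g w) \<in> difference_ideal" if w: "w \<in> carrier A" for w
  proof -
    have "S (f w) \<ominus>\<^bsub>oriented_algebra b Z\<^esub> S (g w) \<in> difference_ideal"
    proof (rule C.convolution_inverse_difference_in_subgroup[OF _ _ _ _ _ _ A.coclosed_carrier _ _ w])
      show "(\<lambda>x. S (f x)) \<in> linear_maps K A (oriented_algebra b Z)" "(\<lambda>x. S (g x)) \<in> linear_maps K A (oriented_algebra b Z)"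
        "f \<in> linear_maps K A (oriented_algebra b Z)" "g \<in> linear_maps K A (oriented_algebra b Z)"
        by (simp_all add: fD gD linear_comp[OF S.S_linear])
      show "subgroup difference_ideal (add_monoid (oriented_algebra b Z))"
        using difference_ideal_subgroup by simp
      fix u c d assume "u \<in> carrier A" "c \<in> carrier A" "d \<in> carrier A"
      then show "S (f u) \<otimes>\<^bsub>oriented_algebra b Z\<^esub> ((g c \<ominus>\<^bsub>oriented_algebra b Z\<^esub> f c) \<otimes>\<^bsub>oriented_algebra b Z\<^esub> S (g d)) \<in> difference_ideal"
        using difference_ideal_minus_swap
        by (simp add: fD(7) gD(7) S.S_closed difference_ideal_mult_left difference_ideal_mult_right)
    qed (simp_all add: S.convolution_hom_before[OF A.bialgebra_axioms f] S.convolution_hom_before[OF A.bialgebra_axioms g]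
      del: oriented_algebra_simps)
    then show ?thesis by simp
  qed
  show ?thesis
  proof (rule difference_ideal_linear[OF Z.module_axioms S.S_linear difference_ideal_subgroup _ x])
    fix u w v assume u: "u \<in> carrier Z" and w: "w \<in> carrier A" and v: "v \<in> carrier Z"
    have "S (u \<otimes> (f w \<ominus> g w) \<otimes> v) = S v \<otimes> ((S (f w) \<ominus> S (g w)) \<otimes> S u)"
      using u v w by (simp add: S.S_mult difference_closed fD(7) gD(7) linear_minus[OF Z.module_axioms Z.module_axioms S.S_linear])
    then show "S (u \<otimes> (f w \<ominus> g w) \<otimes> v) \<in> difference_ideal"
      using diff[OF w] u v by (simp add: S.S_closed difference_ideal_mult_left difference_ideal_mult_right)
  qed
qed

text \<open>
  A linear map kills the ideal if it cannot distinguish \<open>u (f w) v\<close> from \<open>u (g w) v\<close>. The comultiplication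
  followed by the projection, the counit and the homomorphisms which identify \<open>f\<close> and \<open>g\<close> are treated
  in this way.
\<close>

lemma difference_ideal_killed:
  assumes M: "module K M" and h: "h \<in> linear_maps K Z M"
    and gen: "\<And>u w v. u \<in> carrier Z \<Longrightarrow> w \<in> carrier A \<Longrightarrow> v \<in> carrier Z \<Longrightarrow>
       h (u \<otimes> f w \<otimes> v) = h (u \<otimes> g w \<otimes> v)"
    and x: "x \<in> difference_ideal"
  shows "h x = \<zero>\<^bsub>M\<^esub>"
proof -
  interpret M: module K M by fact
  have "h x \<in> {\<zero>\<^bsub>M\<^esub>}"
  proof (rule difference_ideal_linear[OF M h _ _ x])
    show "subgroup {\<zero>\<^bsub>M\<^esub>} (add_monoid M)" using group.triv_subgroup[OF M.a_group] by simp
    fix u w v assume u: "u \<in> carrier Z" and w: "w \<in> carrier A" and v: "v \<in> carrier Z"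
    note fg = fD(7)[OF w] gD(7)[OF w]
    have "u \<otimes> (f w \<ominus> g w) \<otimes> v = u \<otimes> f w \<otimes> v \<ominus> u \<otimes> g w \<otimes> v"
      using u v fg by (simp add: a_minus_def Z.r_distr Z.l_distr Z.r_minus Z.l_minus)
    moreover have "h (u \<otimes> f w \<otimes> v \<ominus> u \<otimes> g w \<otimes> v)
        = h (u \<otimes> f w \<otimes> v) \<ominus>\<^bsub>M\<^esub> h (u \<otimes> g w \<otimes> v)"
      using u v fg by (intro linear_minus[OF Z.module_axioms M h]) simp_all
    ultimately show "h (u \<otimes> (f w \<ominus> g w) \<otimes> v) \<in> {\<zero>\<^bsub>M\<^esub>}"
      using u v fg lin_map[OF h] gen[OF u w v]
      by (simp add: M.minus_eq M.r_neg)
  qed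
  then show ?thesis by simp
qed

end

lemma (in cring) regular_module_module: "module R (regular_module R)"
  by (intro moduleI abelian_groupI)
    (auto simp: regular_module_def is_cring l_distr r_distr m_assoc a_ac intro: bexI[of _ "\<ominus> _"] l_neg)

text \<open>
  If the kernel of \<open>p\<close> is an ideal, so is the kernel of \<open>p \<otimes> p\<close>, that is, \<open>(p \<otimes> p) (X Y)\<close> depends only on
  \<open>(p \<otimes> p) X\<close> and \<open>(p \<otimes> p) Y\<close>.
\<close>

lemma (in bialgebra) tensor_map_mult_congruence:
  assumes p: "p \<in> linear_maps K B B"
    and p_mult: "\<And>x y. \<lbrakk>x \<in> carrier B; y \<in> carrier B\<rbrakk> \<Longrightarrow> p (p x \<otimes>\<^bsub>B\<^esub> p y) = p (x \<otimes>\<^bsub>B\<^esub> y)"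
    and X: "X \<in> carrier T2" and Y: "Y \<in> carrier T2"
  shows "tensor_map K B B p p (tensor_map K B B p p X \<otimes>\<^bsub>T2\<^esub> tensor_map K B B p p Y)
    = tensor_map K B B p p (X \<otimes>\<^bsub>T2\<^esub> Y)"
proof -
  let ?\<pi> = "tensor_map K B B p p"
  interpret T: assoc_algebra K T2 by (rule BB.tensor_assoc_algebra)
  have \<pi>: "?\<pi> \<in> linear_maps K T2 T2" by (rule CC.tensor_map_linear[OF module_axioms module_axioms p p])
  have pure: "?\<pi> (pure_tensor K B B a b) = pure_tensor K B B (p a) (p b)" if "a \<in> carrier B" "b \<in> carrier B" for a b
    unfolding tensor_map_eq by (rule CC.tensor_lift_pure[OF CC.tensor_module bilinear_comp[OF CC.pure_bilinear p p] that])
  note M = CC.tensor_module and \<pi>Y = lin_map[OF \<pi> Y] and pc = lin_map[OF p]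
  show ?thesis
  proof (rule CC.tensor_linear_eqI[OF M linear_comp[OF \<pi> T.mult_linear_left[OF \<pi> \<pi>Y]] linear_comp[OF \<pi> T.mult_linear_left[OF linear_id Y]] _ X])
    fix a b assume a: "a \<in> carrier B" and b: "b \<in> carrier B"
    note ab = CC.pure_closed[OF a b]
    show "?\<pi> (?\<pi> (pure_tensor K B B a b) \<otimes>\<^bsub>T2\<^esub> ?\<pi> Y) = ?\<pi> (pure_tensor K B B a b \<otimes>\<^bsub>T2\<^esub> Y)"
    proof (rule CC.tensor_linear_eqI[OF M linear_comp[OF \<pi> T.mult_linear_right[OF \<pi> lin_map[OF \<pi> ab]]] linear_comp[OF \<pi> T.mult_linear_right[OF linear_id ab]] _ Y])
      fix c d assume "c \<in> carrier B" "d \<in> carrier B"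
      then show "?\<pi> (?\<pi> (pure_tensor K B B a b) \<otimes>\<^bsub>T2\<^esub> ?\<pi> (pure_tensor K B B c d)) = ?\<pi> (pure_tensor K B B a b \<otimes>\<^bsub>T2\<^esub> pure_tensor K B B c d)"
        using a b by (simp add: pure BB.tensor_mult_pure pc p_mult)
    qed
  qed
qed

context bialg_hom_pair
begin

text \<open>
  \<open>Q\<close> is the quotient of \<open>Z\<close> by the difference ideal, realised on a linear complement of the ideal.
\<close>

lemma factor_through_hopf_quotient:
  fixes B :: "('k, 'a) bialg"
  assumes B: "bialgebra K B" and h: "h \<in> bialg_hom K Z B"
    and eq: "compose (carrier A) h f = compose (carrier A) h g"
  shows "\<exists>(Q :: ('k, 'a) bialg) q h'. bialgebra K Q \<and> (hopf_algebra K Z \<longrightarrow> hopf_algebra K Q) \<and>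
    (bijective_antipode K Z \<longrightarrow> bijective_antipode K Q) \<and> q \<in> bialg_hom K Z Q \<and> h' \<in> bialg_hom K Q B \<and>
    compose (carrier Z) h' q = h \<and> compose (carrier A) q f = compose (carrier A) q g"
proof -
  note M = Z.module_axioms
  obtain p0 where p0: "p0 \<in> linear_maps K Z Z" and p0I: "\<And>x. x \<in> carrier Z \<Longrightarrow> p0 x \<in> difference_ideal"
    and p0_id: "\<And>x. x \<in> difference_ideal \<Longrightarrow> p0 x = x"
    using Z.linear_projection_onto_submodule[OF A.field_axioms difference_ideal_submodule] by blast
  \<comment> \<open>As \<open>p0\<close> projects onto the ideal, \<open>p\<close> projects onto a complement and has the ideal as its kernel.\<close>
  define p where "p x = x \<ominus> p0 x" for x
  have pl: "p \<in> linear_maps K Z Z"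
    unfolding p_def[abs_def]
    by (rule linear_mapsI)
      (simp_all add: lin_map[OF p0] linear_add[OF p0] linear_smult[OF p0] Z.minus_eq Z.minus_add Z.a_ac Z.smult_r_distr Z.smult_r_minus)
  note pc = lin_map[OF pl] and Ic = difference_ideal_carrier and IE = Z.submoduleE[OF difference_ideal_submodule]
  have kill: "p x = \<zero>" if "x \<in> difference_ideal" for x
    using Ic[OF that] by (simp add: p_def p0_id that Z.minus_eq Z.r_neg)
  have p_eq: "p x = p y" if "x \<ominus> y \<in> difference_ideal" "x \<in> carrier Z" "y \<in> carrier Z" for x y
  proof -
    have "x = (x \<ominus> y) \<oplus> y" using that by (simp add: Z.minus_eq Z.a_assoc Z.l_neg)
    then have "p x = p (x \<ominus> y) \<oplus> p y" using that linear_add[OF pl, of "x \<ominus> y" y] by simp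
    then show ?thesis using that by (simp add: kill pc)
  qed
  have near: "p x \<ominus> x \<in> difference_ideal" if x: "x \<in> carrier Z" for x
  proof -
    have "p x \<ominus> x = \<ominus> p0 x"
      using x lin_map[OF p0 x] Z.a_lcomm[of x "\<ominus> p0 x" "\<ominus> x"]
      by (simp add: p_def Z.minus_eq Z.a_assoc Z.r_neg)
    then show ?thesis using IE(3)[OF p0I[OF x]] by simp
  qed
  have idem: "p (p x) = p x" if "x \<in> carrier Z" for x
    using that by (intro p_eq near pc)
  have p_mult: "p (p x \<otimes> p y) = p (x \<otimes> y)" if x: "x \<in> carrier Z" and y: "y \<in> carrier Z" for x y
  proof -
    have "p (p x \<otimes> p y) = p (p x \<otimes> y)"
    proof (rule p_eq)
      have "p x \<otimes> p y \<ominus> p x \<otimes> y = p x \<otimes> (p y \<ominus> y)"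
        using x y by (simp add: Z.minus_eq Z.r_distr Z.r_minus pc)
      then show "p x \<otimes> p y \<ominus> p x \<otimes> y \<in> difference_ideal"
        using difference_ideal_mult_left[OF pc[OF x] near[OF y]] by simp
    qed (simp_all add: pc x y)
    also have "\<dots> = p (x \<otimes> y)"
    proof (rule p_eq)
      have "p x \<otimes> y \<ominus> x \<otimes> y = (p x \<ominus> x) \<otimes> y"
        using x y by (simp add: Z.minus_eq Z.l_distr Z.l_minus pc)
      then show "p x \<otimes> y \<ominus> x \<otimes> y \<in> difference_ideal"
        using difference_ideal_mult_right[OF y near[OF x]] by simp
    qed (simp_all add: pc x y)
    finally show ?thesis .
  qed
  have pfg: "p (f w) = p (g w)" if "w \<in> carrier A" for w
    using that difference_in_difference_ideal by (intro p_eq) (simp_all add: fD(7) gD(7))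
  have killed: "h (p x) = h x"
    if N: "module K N" and h: "h \<in> linear_maps K Z N" and x: "x \<in> carrier Z"
      and gen: "\<And>u w v. u \<in> carrier Z \<Longrightarrow> w \<in> carrier A \<Longrightarrow> v \<in> carrier Z \<Longrightarrow>
         h (u \<otimes> f w \<otimes> v) = h (u \<otimes> g w \<otimes> v)" for N :: "('k, 'n, 'y) module_scheme" and h x
  proof -
    interpret N: module K N by (rule N)
    have d: "h (p x \<ominus> x) = \<zero>\<^bsub>N\<^esub>" by (rule difference_ideal_killed[OF N h gen near[OF x]])
    have "p x = (p x \<ominus> x) \<oplus> x" using x pc[OF x] by (simp add: Z.minus_eq Z.a_assoc Z.l_neg)
    then have "h (p x) = h (p x \<ominus> x) \<oplus>\<^bsub>N\<^esub> h x" using x pc[OF x] linear_add[OF h, of "p x \<ominus> x" x] by simp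
    then show ?thesis using x by (simp add: d lin_map[OF h])
  qed
  let ?\<pi> = "tensor_map K Z Z p p"
  have \<pi>: "?\<pi> \<in> linear_maps K Z.T2 Z.T2" by (rule Z.CC.tensor_map_linear[OF M M pl pl])
  interpret T: assoc_algebra K Z.T2 by (rule Z.BB.tensor_assoc_algebra)
  have \<pi>fg: "?\<pi> (comult Z (f w)) = ?\<pi> (comult Z (g w))" if w: "w \<in> carrier A" for w
  proof -
    note b = bilinear_comp[OF Z.CC.pure_bilinear pl pl]
    have "sweedler Z Z.T2 (\<lambda>a b. pure_tensor K Z Z (p a) (p b)) (f w)
       = sweedler A Z.T2 (\<lambda>a b. pure_tensor K Z Z (p (f a)) (p (f b))) w"
      by (rule sweedler_bialg_hom[OF A.bialgebra_axioms Z.bialgebra_axioms f Z.CC.tensor_module b w])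
    also have "\<dots> = sweedler A Z.T2 (\<lambda>a b. pure_tensor K Z Z (p (g a)) (p (g b))) w"
      by (rule A.sweedler_cong[OF Z.CC.tensor_module bilinear_comp[OF b gD(2) gD(2)] _ w]) (simp add: pfg)
    also have "\<dots> = sweedler Z Z.T2 (\<lambda>a b. pure_tensor K Z Z (p a) (p b)) (g w)"
      by (rule sweedler_bialg_hom[OF A.bialgebra_axioms Z.bialgebra_axioms g Z.CC.tensor_module b w, symmetric])
    finally show ?thesis by (simp add: sweedler_def tensor_map_eq)
  qed
  have p_comult: "?\<pi> (comult Z (p x)) = ?\<pi> (comult Z x)" if x: "x \<in> carrier Z" for x
  proof (rule killed[OF Z.CC.tensor_module linear_comp[OF \<pi> Z.comult_linear] x])
    fix u w v assume u: "u \<in> carrier Z" and w: "w \<in> carrier A" and v: "v \<in> carrier Z"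
    note cong = Z.tensor_map_mult_congruence[OF pl p_mult]
    have "?\<pi> (comult Z (u \<otimes> z \<otimes> v))
       = ?\<pi> (?\<pi> (?\<pi> (comult Z u) \<otimes>\<^bsub>Z.T2\<^esub> ?\<pi> (comult Z z)) \<otimes>\<^bsub>Z.T2\<^esub> ?\<pi> (comult Z v))" if z: "z \<in> carrier Z" for z
    proof -
      have "?\<pi> (comult Z u \<otimes>\<^bsub>Z.T2\<^esub> comult Z z \<otimes>\<^bsub>Z.T2\<^esub> comult Z v)
         = ?\<pi> (?\<pi> (comult Z u \<otimes>\<^bsub>Z.T2\<^esub> comult Z z) \<otimes>\<^bsub>Z.T2\<^esub> ?\<pi> (comult Z v))"
        using u v z by (intro cong[symmetric]) (simp_all add: Z.comult_closed)
      also have "?\<pi> (comult Z u \<otimes>\<^bsub>Z.T2\<^esub> comult Z z) = ?\<pi> (?\<pi> (comult Z u) \<otimes>\<^bsub>Z.T2\<^esub> ?\<pi> (comult Z z))"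
        using u z by (intro cong[symmetric]) (simp_all add: Z.comult_closed)
      finally show ?thesis using u v z by (simp add: Z.comult_mult)
    qed
    from this[OF fD(7)[OF w]] this[OF gD(7)[OF w]]
    show "?\<pi> (comult Z (u \<otimes> f w \<otimes> v)) = ?\<pi> (comult Z (u \<otimes> g w \<otimes> v))"
      by (simp add: \<pi>fg[OF w])
  qed
  have p_counit: "counit Z (p x) = counit Z x" if x: "x \<in> carrier Z" for x
    by (rule killed[OF A.regular_module_module Z.counit_linear x])
      (simp add: Z.counit_mult fD(6,7) gD(6,7))
  interpret Q: bialgebra_subquotient K Z "carrier Z" p
    by unfold_locales (simp_all add: Z.coclosed_carrier pl pc idem p_mult p_comult p_counit)
  have pS: "p (S (p x)) = p (S x)" if S: "twisted_antipode K Z S b" and x: "x \<in> carrier Z" for S b x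
  proof -
    interpret S: twisted_antipode K Z S b by (rule S)
    have "S (p x) \<ominus> S x = S (p x \<ominus> x)"
      by (rule linear_minus[OF M M S.S_linear pc[OF x] x, symmetric])
    then show ?thesis
      using difference_ideal_antipode[OF S near[OF x]] x by (intro p_eq) (simp_all add: S.S_closed pc)
  qed
  let ?q = "\<lambda>x\<in>carrier Z. p x" and ?h = "\<lambda>x\<in>carrier Q.Q. h x"
  have hopf: "hopf_algebra K Q.Q" if hopf: "hopf_algebra K Z"
  proof -
    obtain S where S: "antipode K Z S" using hopf by (auto simp: hopf_algebra_def)
    interpret hopf K Z S using Z.bialgebra_axioms S by (simp add: hopf_def hopf_axioms_def)
    show ?thesis by (intro Q.Q_hopf_algebra[OF S]) (simp_all add: pS[OF antipode_twisted])
  qed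
  have bijective: "bijective_antipode K Q.Q" if bij: "bijective_antipode K Z"
  proof -
    obtain S T where ST: "antipode K Z S" "twisted_antipode K Z S True" "twisted_antipode K Z T False"
      "\<And>x. x \<in> carrier Z \<Longrightarrow> S (T x) = x" "\<And>x. x \<in> carrier Z \<Longrightarrow> T (S x) = x"
      using bijective_antipode_obtain[OF Z.bialgebra_axioms bij] by metis
    show ?thesis
      by (rule Q.Q_bijective_antipode[OF ST(1), of T])
        (simp_all add: ST(4,5) pS[OF ST(2)] pS[OF ST(3)] twisted_antipode.S_closed[OF ST(2)] twisted_antipode.S_closed[OF ST(3)])
  qed
  interpret B: bialgebra K B by (rule B)
  note hD = bialg_homD[OF h]
  have hfg: "h (f w) = h (g w)" if "w \<in> carrier A" for w
    using fun_cong[OF eq, of w] that by (simp add: compose_def)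
  have hp: "h (p x) = h x" if x: "x \<in> carrier Z" for x
    by (rule killed[OF B.module_axioms hD(2) x]) (simp add: hD(3) fD(7) gD(7) hfg)
  have h': "?h \<in> bialg_hom K Q.Q B" by (rule Q.factor_bialg_hom[OF refl B h hp])
  have q: "?q \<in> bialg_hom K Z Q.Q" by (rule Q.projection_bialg_hom[OF refl])
  have hq: "compose (carrier Z) ?h ?q = h"
    using hD(1) by (intro extensionalityI[of _ "carrier Z"]) (auto simp: compose_def hp)
  have qf: "compose (carrier A) ?q f = compose (carrier A) ?q g"
    by (rule ext) (simp add: compose_def fD(7) gD(7) pfg)
  show ?thesis
    by (rule exI[of _ Q.Q], rule exI[of _ ?q], rule exI[of _ ?h])
      (intro conjI impI Q.Q_bialgebra hopf bijective q h' hq qf)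
qed

end

section \<open>Reflections and coreflections\<close>

context adjunction
begin

lemma unit_hom: "X \<in> cat_obj C \<Longrightarrow> unit X \<in> cat_hom C X (fun_obj U (fun_obj F X))"
  using unit.component by (simp add: identity_functor_def functor_comp_def)

lemma counit_hom: "Y \<in> cat_obj D \<Longrightarrow> counit Y \<in> cat_hom D (fun_obj F (fun_obj U Y)) Y"
  using counit.component by (simp add: identity_functor_def functor_comp_def)

lemma unit_natural:
  "\<lbrakk>X \<in> cat_obj C; Y \<in> cat_obj C; f \<in> cat_hom C X Y\<rbrakk>
    \<Longrightarrow> cat_comp C X Y (fun_obj U (fun_obj F Y)) (unit Y) f
        = cat_comp C X (fun_obj U (fun_obj F X)) (fun_obj U (fun_obj F Y))
            (fun_map U (fun_obj F X) (fun_obj F Y) (fun_map F X Y f)) (unit X)"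
  using unit.naturality by (simp add: identity_functor_def functor_comp_def)

lemma counit_natural:
  "\<lbrakk>X \<in> cat_obj D; Y \<in> cat_obj D; f \<in> cat_hom D X Y\<rbrakk>
    \<Longrightarrow> cat_comp D (fun_obj F (fun_obj U X)) (fun_obj F (fun_obj U Y)) Y (counit Y)
          (fun_map F (fun_obj U X) (fun_obj U Y) (fun_map U X Y f))
        = cat_comp D (fun_obj F (fun_obj U X)) X Y f (counit X)"
  using counit.naturality by (simp add: identity_functor_def functor_comp_def)

text \<open>
  As usual, the adjunct of \<open>h\<close> is \<open>counit Y\<close> after \<open>F h\<close>.
\<close>

lemma unit_universal:
  assumes X: "X \<in> cat_obj C" and Y: "Y \<in> cat_obj D" and h: "h \<in> cat_hom C X (fun_obj U Y)"
  shows "\<exists>k \<in> cat_hom D (fun_obj F X) Y.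
    cat_comp C X (fun_obj U (fun_obj F X)) (fun_obj U Y) (fun_map U (fun_obj F X) Y k) (unit X) = h"
proof
  let ?FX = "fun_obj F X" and ?UY = "fun_obj U Y"
  let ?k = "cat_comp D ?FX (fun_obj F ?UY) Y (counit Y) (fun_map F X ?UY h)"
  note o = X Y F.fun_obj_closed U.fun_obj_closed
  show "?k \<in> cat_hom D ?FX Y"
    using o h by (intro F.D.comp_in_hom F.fun_map_closed counit_hom) auto
  have "fun_map U ?FX Y ?k = cat_comp C (fun_obj U ?FX) (fun_obj U (fun_obj F ?UY)) ?UY
      (fun_map U (fun_obj F ?UY) Y (counit Y)) (fun_map U ?FX (fun_obj F ?UY) (fun_map F X ?UY h))"
    using o h by (intro U.fun_map_comp F.fun_map_closed counit_hom) auto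
  then have "cat_comp C X (fun_obj U ?FX) ?UY (fun_map U ?FX Y ?k) (unit X)
    = cat_comp C X (fun_obj U (fun_obj F ?UY)) ?UY (fun_map U (fun_obj F ?UY) Y (counit Y))
       (cat_comp C X (fun_obj U ?FX) (fun_obj U (fun_obj F ?UY)) (fun_map U ?FX (fun_obj F ?UY) (fun_map F X ?UY h)) (unit X))"
    using o h by (simp add: F.C.comp_assoc U.fun_map_closed F.fun_map_closed counit_hom unit_hom)
  also have "\<dots> = cat_comp C X (fun_obj U (fun_obj F ?UY)) ?UY (fun_map U (fun_obj F ?UY) Y (counit Y))
       (cat_comp C X ?UY (fun_obj U (fun_obj F ?UY)) (unit ?UY) h)"
    using o h by (simp add: unit_natural)
  also have "\<dots> = cat_comp C X ?UY ?UY (cat_comp C ?UY (fun_obj U (fun_obj F ?UY)) ?UY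
       (fun_map U (fun_obj F ?UY) Y (counit Y)) (unit ?UY)) h"
    using o h by (simp add: F.C.comp_assoc U.fun_map_closed counit_hom unit_hom)
  also have "\<dots> = h" using o h by (simp add: triangle_right F.C.comp_id_left)
  finally show "cat_comp C X (fun_obj U ?FX) ?UY (fun_map U ?FX Y ?k) (unit X) = h" .
qed

text \<open>
  A morphism \<open>m\<close> out of \<open>F X\<close> is recovered as the adjunct of \<open>U m\<close> after the unit.
\<close>

lemma unit_cancel:
  assumes X: "X \<in> cat_obj C" and Y: "Y \<in> cat_obj D"
    and k: "k \<in> cat_hom D (fun_obj F X) Y" and k': "k' \<in> cat_hom D (fun_obj F X) Y"
    and eq: "cat_comp C X (fun_obj U (fun_obj F X)) (fun_obj U Y) (fun_map U (fun_obj F X) Y k) (unit X)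
      = cat_comp C X (fun_obj U (fun_obj F X)) (fun_obj U Y) (fun_map U (fun_obj F X) Y k') (unit X)"
  shows "k = k'"
proof -
  let ?FX = "fun_obj F X" and ?UY = "fun_obj U Y"
  let ?UFX = "fun_obj U ?FX"
  note o = X Y F.fun_obj_closed U.fun_obj_closed
  have "m = cat_comp D ?FX (fun_obj F ?UY) Y (counit Y)
      (fun_map F X ?UY (cat_comp C X ?UFX ?UY (fun_map U ?FX Y m) (unit X)))"
    if m: "m \<in> cat_hom D ?FX Y" for m
  proof -
    have "m = cat_comp D ?FX ?FX Y m (cat_comp D ?FX (fun_obj F ?UFX) ?FX (counit ?FX) (fun_map F X ?UFX (unit X)))"
      using o m by (simp add: triangle_left F.D.comp_id_right)
    also have "\<dots> = cat_comp D ?FX (fun_obj F ?UFX) Y (cat_comp D (fun_obj F ?UFX) ?FX Y m (counit ?FX)) (fun_map F X ?UFX (unit X))"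
      using o m by (simp add: F.D.comp_assoc F.fun_map_closed counit_hom unit_hom)
    also have "\<dots> = cat_comp D ?FX (fun_obj F ?UY) Y (counit Y)
       (cat_comp D ?FX (fun_obj F ?UFX) (fun_obj F ?UY) (fun_map F ?UFX ?UY (fun_map U ?FX Y m)) (fun_map F X ?UFX (unit X)))"
      using o m by (simp add: counit_natural[symmetric] F.D.comp_assoc F.fun_map_closed U.fun_map_closed counit_hom unit_hom)
    also have "\<dots> = cat_comp D ?FX (fun_obj F ?UY) Y (counit Y)
      (fun_map F X ?UY (cat_comp C X ?UFX ?UY (fun_map U ?FX Y m) (unit X)))"
      using o m by (simp add: F.fun_map_comp U.fun_map_closed unit_hom)
    finally show ?thesis .
  qed
  from this[OF k] this[OF k'] eq show ?thesis by simp
qed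

lemma counit_universal:
  assumes X: "X \<in> cat_obj C" and Y: "Y \<in> cat_obj D" and h: "h \<in> cat_hom D (fun_obj F X) Y"
  shows "\<exists>k \<in> cat_hom C X (fun_obj U Y).
    cat_comp D (fun_obj F X) (fun_obj F (fun_obj U Y)) Y (counit Y) (fun_map F X (fun_obj U Y) k) = h"
proof
  let ?FX = "fun_obj F X" and ?UY = "fun_obj U Y"
  let ?UFX = "fun_obj U ?FX"
  let ?k = "cat_comp C X ?UFX ?UY (fun_map U ?FX Y h) (unit X)"
  note o = X Y F.fun_obj_closed U.fun_obj_closed
  show "?k \<in> cat_hom C X ?UY"
    using o h by (intro F.C.comp_in_hom U.fun_map_closed unit_hom) auto
  have "cat_comp D ?FX (fun_obj F ?UY) Y (counit Y) (fun_map F X ?UY ?k)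
    = cat_comp D ?FX (fun_obj F ?UY) Y (counit Y)
       (cat_comp D ?FX (fun_obj F ?UFX) (fun_obj F ?UY) (fun_map F ?UFX ?UY (fun_map U ?FX Y h)) (fun_map F X ?UFX (unit X)))"
    using o h by (simp add: F.fun_map_comp U.fun_map_closed unit_hom)
  also have "\<dots> = cat_comp D ?FX (fun_obj F ?UFX) Y (cat_comp D (fun_obj F ?UFX) ?FX Y h (counit ?FX)) (fun_map F X ?UFX (unit X))"
    using o h by (simp add: counit_natural[symmetric] F.D.comp_assoc F.fun_map_closed U.fun_map_closed counit_hom unit_hom)
  also have "\<dots> = cat_comp D ?FX ?FX Y h (cat_comp D ?FX (fun_obj F ?UFX) ?FX (counit ?FX) (fun_map F X ?UFX (unit X)))"
    using o h by (simp add: F.D.comp_assoc F.fun_map_closed counit_hom unit_hom)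
  also have "\<dots> = h" using o h by (simp add: triangle_left F.D.comp_id_right)
  finally show "cat_comp D ?FX (fun_obj F ?UY) Y (counit Y) (fun_map F X ?UY ?k) = h" .
qed

lemma counit_cancel:
  assumes X: "X \<in> cat_obj C" and Y: "Y \<in> cat_obj D"
    and k: "k \<in> cat_hom C X (fun_obj U Y)" and k': "k' \<in> cat_hom C X (fun_obj U Y)"
    and eq: "cat_comp D (fun_obj F X) (fun_obj F (fun_obj U Y)) Y (counit Y) (fun_map F X (fun_obj U Y) k)
      = cat_comp D (fun_obj F X) (fun_obj F (fun_obj U Y)) Y (counit Y) (fun_map F X (fun_obj U Y) k')"
  shows "k = k'"
proof -
  let ?FX = "fun_obj F X" and ?UY = "fun_obj U Y"
  let ?UFX = "fun_obj U ?FX"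
  note o = X Y F.fun_obj_closed U.fun_obj_closed
  have "m = cat_comp C X ?UFX ?UY (fun_map U ?FX Y (cat_comp D ?FX (fun_obj F ?UY) Y (counit Y) (fun_map F X ?UY m))) (unit X)"
    if m: "m \<in> cat_hom C X ?UY" for m
  proof -
    have "m = cat_comp C X ?UY ?UY (cat_comp C ?UY (fun_obj U (fun_obj F ?UY)) ?UY
       (fun_map U (fun_obj F ?UY) Y (counit Y)) (unit ?UY)) m"
      using o m by (simp add: triangle_right F.C.comp_id_left)
    also have "\<dots> = cat_comp C X (fun_obj U (fun_obj F ?UY)) ?UY (fun_map U (fun_obj F ?UY) Y (counit Y))
       (cat_comp C X ?UY (fun_obj U (fun_obj F ?UY)) (unit ?UY) m)"
      using o m by (simp add: F.C.comp_assoc U.fun_map_closed counit_hom unit_hom)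
    also have "\<dots> = cat_comp C X (fun_obj U (fun_obj F ?UY)) ?UY (fun_map U (fun_obj F ?UY) Y (counit Y))
       (cat_comp C X ?UFX (fun_obj U (fun_obj F ?UY)) (fun_map U ?FX (fun_obj F ?UY) (fun_map F X ?UY m)) (unit X))"
      using o m by (simp add: unit_natural)
    also have "\<dots> = cat_comp C X ?UFX ?UY (cat_comp C ?UFX (fun_obj U (fun_obj F ?UY)) ?UY
        (fun_map U (fun_obj F ?UY) Y (counit Y)) (fun_map U ?FX (fun_obj F ?UY) (fun_map F X ?UY m))) (unit X)"
      using o m by (simp add: F.C.comp_assoc U.fun_map_closed F.fun_map_closed counit_hom unit_hom)
    also have "\<dots> = cat_comp C X ?UFX ?UY (fun_map U ?FX Y (cat_comp D ?FX (fun_obj F ?UY) Y (counit Y) (fun_map F X ?UY m))) (unit X)"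
      using o m by (simp add: U.fun_map_comp F.fun_map_closed counit_hom)
    finally show ?thesis .
  qed
  from this[OF k] this[OF k'] eq show ?thesis by simp
qed

end

lemma full_subcategory_simps [simp]:
  "cat_obj (full_subcategory C P) = cat_obj C \<inter> P"
  "cat_hom (full_subcategory C P) = cat_hom C"
  "cat_id (full_subcategory C P) = cat_id C"
  "cat_comp (full_subcategory C P) = cat_comp C"
  by (simp_all add: full_subcategory_def)

lemma inclusion_functor_simps [simp]:
  "fun_obj inclusion_functor X = X" "fun_map inclusion_functor X Y f = f"
  by (simp_all add: inclusion_functor_def)

text \<open>
  The factorisation \<open>i h\<close> of the unit with \<open>E\<close> in the subcategory gives, by the universal property, some
  \<open>k\<close> with \<open>i k = id\<close>. Then \<open>f = f i k = g i k = g\<close>.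
\<close>

lemma epimorphism_reflection_unit:
  assumes adj: "adjunction C (full_subcategory C P) F inclusion_functor \<eta> \<epsilon>"
    and X: "X \<in> cat_obj C"
    and factor: "\<And>Z f g. \<lbrakk>fun_obj F X \<in> cat_obj C; fun_obj F X \<in> P; \<eta> X \<in> cat_hom C X (fun_obj F X);
        Z \<in> cat_obj C; f \<in> cat_hom C (fun_obj F X) Z; g \<in> cat_hom C (fun_obj F X) Z;
        cat_comp C X (fun_obj F X) Z f (\<eta> X) = cat_comp C X (fun_obj F X) Z g (\<eta> X)\<rbrakk>
      \<Longrightarrow> \<exists>E i h. E \<in> cat_obj C \<and> E \<in> P \<and> i \<in> cat_hom C E (fun_obj F X) \<and> h \<in> cat_hom C X E \<and>
            cat_comp C X E (fun_obj F X) i h = \<eta> X \<and>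
            cat_comp C E (fun_obj F X) Z f i = cat_comp C E (fun_obj F X) Z g i"
  shows "epimorphism C X (fun_obj F X) (\<eta> X)"
proof -
  interpret adjunction C "full_subcategory C P" F inclusion_functor \<eta> \<epsilon> by (rule adj)
  let ?Y = "fun_obj F X"
  have Y: "?Y \<in> cat_obj C" "?Y \<in> P" using F.fun_obj_closed[OF X] by auto
  have \<eta>: "\<eta> X \<in> cat_hom C X ?Y" using unit_hom[OF X] by simp
  have "f = g" if Z: "Z \<in> cat_obj C" and f: "f \<in> cat_hom C ?Y Z" and g: "g \<in> cat_hom C ?Y Z"
    and eq: "cat_comp C X ?Y Z f (\<eta> X) = cat_comp C X ?Y Z g (\<eta> X)" for Z f g
  proof -
    obtain E i h where E: "E \<in> cat_obj C" "E \<in> P" and i: "i \<in> cat_hom C E ?Y" and h: "h \<in> cat_hom C X E"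
      and ih: "cat_comp C X E ?Y i h = \<eta> X" and fi: "cat_comp C E ?Y Z f i = cat_comp C E ?Y Z g i"
      using factor[OF Y \<eta> Z f g eq] by blast
    obtain k where k: "k \<in> cat_hom C ?Y E" and kh: "cat_comp C X ?Y E k (\<eta> X) = h"
      using unit_universal[OF X, of E h] E h by auto
    have "cat_comp C ?Y E ?Y i k = cat_id C ?Y"
    proof (rule unit_cancel[OF X])
      show "cat_comp C X (fun_obj inclusion_functor ?Y) (fun_obj inclusion_functor ?Y) (fun_map inclusion_functor ?Y ?Y (cat_comp C ?Y E ?Y i k)) (\<eta> X)
        = cat_comp C X (fun_obj inclusion_functor ?Y) (fun_obj inclusion_functor ?Y) (fun_map inclusion_functor ?Y ?Y (cat_id C ?Y)) (\<eta> X)"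
        using X Y E i k \<eta> by (simp add: F.C.comp_assoc kh ih F.C.comp_id_left)
    qed (use Y E i k F.C.comp_in_hom F.C.id_in_hom in auto)
    then have "m = cat_comp C ?Y E Z (cat_comp C E ?Y Z m i) k" if "m \<in> cat_hom C ?Y Z" for m
      using that Y E i k Z by (simp add: F.C.comp_assoc F.C.comp_id_right)
    from this[OF f] this[OF g] fi show "f = g" by simp
  qed
  with X Y \<eta> show ?thesis unfolding epimorphism_def by blast
qed

text \<open>
  Dually, \<open>k\<close> with \<open>k q = id\<close> yields \<open>f = k q f = k q g = g\<close>.
\<close>

lemma monomorphism_coreflection_counit:
  assumes adj: "adjunction (full_subcategory C P) C inclusion_functor U \<eta> \<epsilon>"
    and X: "X \<in> cat_obj C"
    and factor: "\<And>Z f g. \<lbrakk>fun_obj U X \<in> cat_obj C; fun_obj U X \<in> P; \<epsilon> X \<in> cat_hom C (fun_obj U X) X;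
        Z \<in> cat_obj C; f \<in> cat_hom C Z (fun_obj U X); g \<in> cat_hom C Z (fun_obj U X);
        cat_comp C Z (fun_obj U X) X (\<epsilon> X) f = cat_comp C Z (fun_obj U X) X (\<epsilon> X) g\<rbrakk>
      \<Longrightarrow> \<exists>Q q h. Q \<in> cat_obj C \<and> Q \<in> P \<and> q \<in> cat_hom C (fun_obj U X) Q \<and> h \<in> cat_hom C Q X \<and>
            cat_comp C (fun_obj U X) Q X h q = \<epsilon> X \<and>
            cat_comp C Z (fun_obj U X) Q q f = cat_comp C Z (fun_obj U X) Q q g"
  shows "monomorphism C (fun_obj U X) X (\<epsilon> X)"
proof -
  interpret adjunction "full_subcategory C P" C inclusion_functor U \<eta> \<epsilon> by (rule adj)
  let ?Y = "fun_obj U X"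
  have Y: "?Y \<in> cat_obj C" "?Y \<in> P" using U.fun_obj_closed[OF X] by auto
  have \<epsilon>: "\<epsilon> X \<in> cat_hom C ?Y X" using counit_hom[OF X] by simp
  have "f = g" if Z: "Z \<in> cat_obj C" and f: "f \<in> cat_hom C Z ?Y" and g: "g \<in> cat_hom C Z ?Y"
    and eq: "cat_comp C Z ?Y X (\<epsilon> X) f = cat_comp C Z ?Y X (\<epsilon> X) g" for Z f g
  proof -
    obtain Q q h where Q: "Q \<in> cat_obj C" "Q \<in> P" and q: "q \<in> cat_hom C ?Y Q" and h: "h \<in> cat_hom C Q X"
      and hq: "cat_comp C ?Y Q X h q = \<epsilon> X" and qf: "cat_comp C Z ?Y Q q f = cat_comp C Z ?Y Q q g"
      using factor[OF Y \<epsilon> Z f g eq] by blast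
    obtain k where k: "k \<in> cat_hom C Q ?Y" and hk: "cat_comp C Q ?Y X (\<epsilon> X) k = h"
      using counit_universal[of Q X h] X Q h by auto
    have "cat_comp C ?Y Q ?Y k q = cat_id C ?Y"
    proof (rule counit_cancel[of ?Y X])
      show "cat_comp C (fun_obj inclusion_functor ?Y) (fun_obj inclusion_functor ?Y) X (\<epsilon> X) (fun_map inclusion_functor ?Y ?Y (cat_comp C ?Y Q ?Y k q))
        = cat_comp C (fun_obj inclusion_functor ?Y) (fun_obj inclusion_functor ?Y) X (\<epsilon> X) (fun_map inclusion_functor ?Y ?Y (cat_id C ?Y))"
        using X Y Q q k \<epsilon> by (simp add: F.D.comp_assoc[symmetric] hk hq F.D.comp_id_right)
    qed (use X Y Q q k F.D.comp_in_hom F.D.id_in_hom in auto)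
    then have "m = cat_comp C Z Q ?Y k (cat_comp C Z ?Y Q q m)" if "m \<in> cat_hom C Z ?Y" for m
      using that Y Q q k Z by (simp add: F.D.comp_assoc[symmetric] F.D.comp_id_left)
    from this[OF f] this[OF g] qf show "f = g" by simp
  qed
  with X Y \<epsilon> show ?thesis unfolding monomorphism_def by blast
qed

section \<open>Units and counits of the adjunctions\<close>

lemma BiAlg_simps [simp]:
  "cat_obj (BiAlg K) = {B. bialgebra K B}" "cat_hom (BiAlg K) = bialg_hom K"
  "cat_comp (BiAlg K) A B C g f = compose (carrier A) g f"
  by (simp_all add: BiAlg_def)

lemma HopfAlg_simps [simp]:
  "cat_obj (HopfAlg K) = {H. hopf_algebra K H}" "cat_hom (HopfAlg K) = bialg_hom K"
  "cat_comp (HopfAlg K) A B C g f = compose (carrier A) g f"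
  by (auto simp: HopfAlg_def hopf_algebra_def)

theorem theorem3p2:
  fixes K :: "('k, 'm) ring_scheme"
  assumes "field K"
  shows
    "(\<forall>(Hup :: (('k, 'a) bialg, 'a \<Rightarrow> 'a, ('k, 'a) bialg, 'a \<Rightarrow> 'a) cat_functor) \<eta> \<epsilon>.
        adjunction (BiAlg K) (HopfAlg K) Hup inclusion_functor \<eta> \<epsilon> \<longrightarrow>
        (\<forall>B. bialgebra K B \<longrightarrow> epimorphism (BiAlg K) B (fun_obj Hup B) (\<eta> B)))
   \<and> (\<forall>(Hlow :: (('k, 'a) bialg, 'a \<Rightarrow> 'a, ('k, 'a) bialg, 'a \<Rightarrow> 'a) cat_functor) \<eta> \<epsilon>.
        adjunction (HopfAlg K) (BiAlg K) inclusion_functor Hlow \<eta> \<epsilon> \<longrightarrow>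
        (\<forall>B. bialgebra K B \<longrightarrow> monomorphism (BiAlg K) (fun_obj Hlow B) B (\<epsilon> B)))
   \<and> (\<forall>(Kup :: (('k, 'a) bialg, 'a \<Rightarrow> 'a, ('k, 'a) bialg, 'a \<Rightarrow> 'a) cat_functor) \<eta> \<epsilon>.
        adjunction (HopfAlg K) (SHopfAlg K) Kup inclusion_functor \<eta> \<epsilon> \<longrightarrow>
        (\<forall>H. hopf_algebra K H \<longrightarrow> epimorphism (HopfAlg K) H (fun_obj Kup H) (\<eta> H)))
   \<and> (\<forall>(Klow :: (('k, 'a) bialg, 'a \<Rightarrow> 'a, ('k, 'a) bialg, 'a \<Rightarrow> 'a) cat_functor) \<eta> \<epsilon>.
        adjunction (SHopfAlg K) (HopfAlg K) inclusion_functor Klow \<eta> \<epsilon> \<longrightarrow>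
        (\<forall>H. hopf_algebra K H \<longrightarrow> monomorphism (HopfAlg K) (fun_obj Klow H) H (\<epsilon> H)))"
proof (intro conjI allI impI)
  fix Hup :: "(('k, 'a) bialg, 'a \<Rightarrow> 'a, ('k, 'a) bialg, 'a \<Rightarrow> 'a) cat_functor" and \<eta> \<epsilon> and B :: "('k, 'a) bialg"
  assume adj: "adjunction (BiAlg K) (HopfAlg K) Hup inclusion_functor \<eta> \<epsilon>" and B: "bialgebra K B"
  show "epimorphism (BiAlg K) B (fun_obj Hup B) (\<eta> B)"
  proof (rule epimorphism_reflection_unit[OF adj[unfolded HopfAlg_def]], goal_cases)
    case (2 Z f g)
    then show ?case using bialg_hom_pair.factor_through_hopf_subalgebra[of K "fun_obj Hup B" Z f g B "\<eta> B"] B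
      by (auto simp: bialg_hom_pair_def bialg_hom_pair_axioms_def)
  qed (simp add: B)
next
  fix Hlow :: "(('k, 'a) bialg, 'a \<Rightarrow> 'a, ('k, 'a) bialg, 'a \<Rightarrow> 'a) cat_functor" and \<eta> \<epsilon> and B :: "('k, 'a) bialg"
  assume adj: "adjunction (HopfAlg K) (BiAlg K) inclusion_functor Hlow \<eta> \<epsilon>" and B: "bialgebra K B"
  show "monomorphism (BiAlg K) (fun_obj Hlow B) B (\<epsilon> B)"
  proof (rule monomorphism_coreflection_counit[OF adj[unfolded HopfAlg_def]], goal_cases)
    case (2 W f g)
    then show ?case using bialg_hom_pair.factor_through_hopf_quotient[of K W "fun_obj Hlow B" f g B "\<epsilon> B"] B
      by (auto simp: bialg_hom_pair_def bialg_hom_pair_axioms_def)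
  qed (simp add: B)
next
  fix Kup :: "(('k, 'a) bialg, 'a \<Rightarrow> 'a, ('k, 'a) bialg, 'a \<Rightarrow> 'a) cat_functor" and \<eta> \<epsilon> and H :: "('k, 'a) bialg"
  assume adj: "adjunction (HopfAlg K) (SHopfAlg K) Kup inclusion_functor \<eta> \<epsilon>" and H: "hopf_algebra K H"
  show "epimorphism (HopfAlg K) H (fun_obj Kup H) (\<eta> H)"
  proof (rule epimorphism_reflection_unit[OF adj[unfolded SHopfAlg_def]], goal_cases)
    case (2 Z f g)
    then show ?case using bialg_hom_pair.factor_through_hopf_subalgebra[of K "fun_obj Kup H" Z f g H "\<eta> H"] H
      by (auto simp: hopf_algebra_def bialg_hom_pair_def bialg_hom_pair_axioms_def)
  qed (simp add: H)
next
  fix Klow :: "(('k, 'a) bialg, 'a \<Rightarrow> 'a, ('k, 'a) bialg, 'a \<Rightarrow> 'a) cat_functor" and \<eta> \<epsilon> and H :: "('k, 'a) bialg"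
  assume adj: "adjunction (SHopfAlg K) (HopfAlg K) inclusion_functor Klow \<eta> \<epsilon>" and H: "hopf_algebra K H"
  show "monomorphism (HopfAlg K) (fun_obj Klow H) H (\<epsilon> H)"
  proof (rule monomorphism_coreflection_counit[OF adj[unfolded SHopfAlg_def]], goal_cases)
    case (2 W f g)
    then show ?case using bialg_hom_pair.factor_through_hopf_quotient[of K W "fun_obj Klow H" f g H "\<epsilon> H"] H
      by (auto simp: hopf_algebra_def bialg_hom_pair_def bialg_hom_pair_axioms_def)
  qed (simp add: H)
qed

end
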